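(* Let $n\in\mathbb{N}$ (so $n\geq 1$), and let $i\geq 2$. (1) If $n=1$ then $\pi_i(F_1(\mathbb{R}P^2))\cong \pi_i(\mathbb{S}^2)$. (2) If $n\geq 2$ then $\pi_i(F_n(\mathbb{R}P^2))\cong \pi_i(\mathbb{S}^3)$.
   Context: For a surface $M$ and $n\geq 1$, $F_n(M)=\{(p_1,\ldots,p_n)\in M^n \mid p_i\neq p_j \text{ if } i\neq j\}$ is the $n$th (ordered) configuration space of $M$. $\mathbb{R}P^2$ is the real projective plane and $\mathbb{S}^k$ is the $k$-sphere. *)

theory Defs
  imports "HOL-Analysis.Analysis" "HOL-Algebra.Group"
begin

section \<open>Homotopy groups\<close>

definition cube :: "nat \<Rightarrow> (nat \<Rightarrow> real) topology" where
  "cube i = product_topology (\<lambda>_. top_of_set {0..1}) {..<i}"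

definition cube_boundary :: "nat \<Rightarrow> (nat \<Rightarrow> real) set" where
  "cube_boundary i = {t \<in> topspace (cube i). \<exists>k<i. t k = 0 \<or> t k = 1}"

definition homotopic_spheroids ::
  "nat \<Rightarrow> 'a topology \<Rightarrow> 'a \<Rightarrow> ((nat \<Rightarrow> real) \<Rightarrow> 'a) \<Rightarrow> ((nat \<Rightarrow> real) \<Rightarrow> 'a) \<Rightarrow> bool" where
  "homotopic_spheroids i X x0 = homotopic_with (\<lambda>f. \<forall>t\<in>cube_boundary i. f t = x0) (cube i) X"

definition spheroids :: "nat \<Rightarrow> 'a topology \<Rightarrow> 'a \<Rightarrow> ((nat \<Rightarrow> real) \<Rightarrow> 'a) set" where
  "spheroids i X x0 = {f. continuous_map (cube i) X f \<and> (\<forall>t\<in>cube_boundary i. f t = x0)}"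

definition concat_spheroids ::
  "((nat \<Rightarrow> real) \<Rightarrow> 'a) \<Rightarrow> ((nat \<Rightarrow> real) \<Rightarrow> 'a) \<Rightarrow> (nat \<Rightarrow> real) \<Rightarrow> 'a" where
  "concat_spheroids f g = (\<lambda>t. if t 0 \<le> 1/2 then f (t(0 := 2 * t 0)) else g (t(0 := 2 * t 0 - 1)))"

definition homotopy_class ::
  "nat \<Rightarrow> 'a topology \<Rightarrow> 'a \<Rightarrow> ((nat \<Rightarrow> real) \<Rightarrow> 'a) \<Rightarrow> ((nat \<Rightarrow> real) \<Rightarrow> 'a) set" where
  "homotopy_class i X x0 f = {g. homotopic_spheroids i X x0 f g}"

text \<open>This is the group $\pi_i(X, x_0)$ for $i \ge 1$ and $x_0 \in X$; nothing is intended for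
  $i = 0$, where there is no coordinate along which to concatenate.  Functions that agree on the
  cube are homotopic in the sense of \<^const>\<open>homotopic_with\<close>, so values off the cube are irrelevant.\<close>

definition homotopy_group ::
  "nat \<Rightarrow> 'a topology \<Rightarrow> 'a \<Rightarrow> ((nat \<Rightarrow> real) \<Rightarrow> 'a) set monoid" where
  "homotopy_group i X x0 =
     \<lparr>carrier = homotopy_class i X x0 ` spheroids i X x0,
      monoid.mult = (\<lambda>A B. {h. \<exists>f\<in>A. \<exists>g\<in>B. homotopic_spheroids i X x0 (concat_spheroids f g) h}),
      one = homotopy_class i X x0 (\<lambda>_. x0)\<rparr>"


section \<open>Real projective spaces\<close>

definition quotient_topology :: "'a topology \<Rightarrow> ('a \<Rightarrow> 'b) \<Rightarrow> 'b topology" where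
  "quotient_topology X q =
     topology (\<lambda>V. V \<subseteq> q ` topspace X \<and> openin X {x \<in> topspace X. q x \<in> V})"

lemma openin_quotient_topology:
  "openin (quotient_topology X q) V \<longleftrightarrow>
     V \<subseteq> q ` topspace X \<and> openin X {x \<in> topspace X. q x \<in> V}"
proof -
  have "istopology (\<lambda>V. V \<subseteq> q ` topspace X \<and> openin X {x \<in> topspace X. q x \<in> V})"
    unfolding istopology_def
  proof (intro conjI allI impI)
    fix S T
    assume S: "S \<subseteq> q ` topspace X \<and> openin X {x \<in> topspace X. q x \<in> S}"
      and T: "T \<subseteq> q ` topspace X \<and> openin X {x \<in> topspace X. q x \<in> T}"
    from S show "S \<inter> T \<subseteq> q ` topspace X"
      by (simp add: le_infI1)
    have "{x \<in> topspace X. q x \<in> S \<inter> T} =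
        {x \<in> topspace X. q x \<in> S} \<inter> {x \<in> topspace X. q x \<in> T}"
      by blast
    then show "openin X {x \<in> topspace X. q x \<in> S \<inter> T}"
      by (simp only: openin_Int S T)
  next
    fix \<K>
    assume *: "\<forall>K\<in>\<K>. K \<subseteq> q ` topspace X \<and> openin X {x \<in> topspace X. q x \<in> K}"
    then show "\<Union>\<K> \<subseteq> q ` topspace X"
      by (simp add: Sup_le_iff)
    have "{x \<in> topspace X. q x \<in> \<Union>\<K>} = (\<Union>K\<in>\<K>. {x \<in> topspace X. q x \<in> K})"
      by blast
    moreover have "openin X (\<Union>K\<in>\<K>. {x \<in> topspace X. q x \<in> K})"
      using * by (simp add: openin_clauses(3))
    ultimately show "openin X {x \<in> topspace X. q x \<in> \<Union>\<K>}"
      by (rule ssubst)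
  qed
  then show ?thesis
    unfolding quotient_topology_def by (simp only: topology_inverse')
qed

lemma quotient_map_quotient_topology: "quotient_map X (quotient_topology X q) q"
proof -
  have "{x \<in> topspace X. q x \<in> q ` topspace X} = topspace X"
    by blast
  then have "openin (quotient_topology X q) (q ` topspace X)"
    by (simp only: openin_quotient_topology order_refl openin_topspace simp_thms)
  then have "q ` topspace X \<subseteq> topspace (quotient_topology X q)"
    by (rule openin_subset)
  moreover have "topspace (quotient_topology X q) \<subseteq> q ` topspace X"
    using openin_topspace [of "quotient_topology X q"]
    unfolding openin_quotient_topology by (rule conjunct1)
  ultimately have "q ` topspace X = topspace (quotient_topology X q)"
    by (rule subset_antisym)
  then show ?thesis
    by (simp add: quotient_map_def openin_quotient_topology)
qed

definition real_projective_space :: "nat \<Rightarrow> (nat \<Rightarrow> real) set topology" where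
  "real_projective_space k = quotient_topology (nsphere k) (\<lambda>x. {x, \<lambda>j. - x j})"


section \<open>Ordered configuration spaces\<close>

definition configuration_space :: "nat \<Rightarrow> 'a topology \<Rightarrow> (nat \<Rightarrow> 'a) topology" where
  "configuration_space n M =
     subtopology (product_topology (\<lambda>_. M) {..<n}) {p. \<forall>i<n. \<forall>j<n. i \<noteq> j \<longrightarrow> p i \<noteq> p j}"

end

theory Submission
  imports Defs "HOL-Complex_Analysis.Complex_Analysis"
begin

text \<open>A map with a continuous transport of points between nearby fibres lifts homotopies, and if its fibres
  are discrete it induces isomorphisms of the groups \<open>\<pi>\<^sub>i\<close>, \<open>i \<ge> 2\<close>.  Lines through the origin lift to unit
  vectors, so the configuration space of the projective plane can be replaced by the space of \<open>n\<close> points on the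
  sphere that are pairwise neither equal nor antipodal.  For \<open>n = 1\<close> this is the sphere.  For \<open>n \<ge> 2\<close> the
  Gram-Schmidt process turns the first two points into a rotation, that is, into a unit quaternion up to sign; after
  rotating back, stereographic projection identifies the remaining data with a configuration space \<open>Z\<^sub>n\<close> of the
  plane, and \<open>S\<^sup>3 \<times> Z\<^sub>n\<close> covers the space.  Forgetting the last point exhibits \<open>Z\<^sub>n\<close> as an iterated bundle whose
  fibres are planes with finitely many punctures, so that \<open>Z\<^sub>n\<close> is aspherical because open sets of the plane are.

  The last fact is an extremal form of Koebe's osculation argument.  A sphere \<open>f\<close> in a bounded open set \<open>U\<close> is
  lifted to spheres \<open>g\<close> in the unit disc with \<open>f = h \<circ> g\<close> for holomorphic \<open>h\<close>.  All these lifts stay in one disc of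
  radius \<open>\<rho> < 1\<close> by the Schwarz-Pick lemma, and \<open>norm (h' 0)\<close> is bounded below.  If \<open>h\<close> nearly attains the infimum
  then \<open>h\<close> maps the disc of radius \<open>\<rho>\<close> into \<open>U\<close>, and contracting \<open>g\<close> linearly contracts \<open>f\<close>.\<close>

text \<open>The assumption \<open>i \<ge> 2\<close> makes the boundary of the cube connected, so
  that a lift of a spheroid through a map with discrete fibres is again constant there. The
  coverings by unit vectors and by quaternions and the squaring map in Koebe's step all rest on
  this. Transport is given by explicit formulas instead of charts: a principal square root, the sign
  of an inner product, a displacement of the plane.

  The rotation forgets the distance between the first two points on the sphere. It survives as a
  positive real coordinate of the planar configuration, which is why the induction on the number of
  points starts from a half-line.

  In the planar part a single sphere has to be contracted; no universal cover is constructed. A near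
  minimizer of \<open>norm (h' 0)\<close> replaces an extremal map, so no limit of holomorphic maps
  is taken. This suffices because \<open>\<rho>\<close> is the same for all lifts.

  Base points are arbitrary on both sides of the isomorphism, whereas lifting produces one
  particular point of the sphere; a reflection moves it to any other.\<close>

abbreviation unit_interval :: "real topology" where
  "unit_interval \<equiv> top_of_set {0..1}"

lemma interval_times_topology:
  assumes "S \<subseteq> T"
  shows "prod_topology (top_of_set S) D = subtopology (prod_topology (top_of_set T) D) (S \<times> topspace D)"
  using assms by (simp add: prod_topology_subtopology subtopology_subtopology inf.absorb2 Times_Int_Times)
lemma subtopology_interval_times:
  assumes "\<And>x. x \<in> topspace (prod_topology (top_of_set T) D) \<Longrightarrow> P x \<longleftrightarrow> fst x \<in> S" "S \<subseteq> T"
  shows "subtopology (prod_topology (top_of_set T) D) {x \<in> topspace (prod_topology (top_of_set T) D). P x} = prod_topology (top_of_set S) D"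
proof -
  have "{x \<in> topspace (prod_topology (top_of_set T) D). P x} = S \<times> topspace D"
    using assms by auto
  then show ?thesis using interval_times_topology[OF assms(2)] by metis
qed
lemma compact_tube: assumes D: "compact_space D" and op: "openin (prod_topology Z D) V" and x: "x \<in> topspace Z" "{x} \<times> topspace D \<subseteq> V"
  obtains U where "openin Z U" "x \<in> U" "U \<times> topspace D \<subseteq> V"
proof -
  obtain U V' where "openin Z U" "x \<in> U" "topspace D \<subseteq> V'" "U \<times> V' \<subseteq> V"
    using tube_lemma_right[OF op _ x] D unfolding compact_space_def by auto
  then show ?thesis using that by blast
qed

section \<open>Homotopy lifting by local transport\<close>

text \<open>For \<open>b\<close> close to \<open>p e\<close>, the point \<open>tr e b\<close> is a continuous choice of a point of the fibre over \<open>b\<close>.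
  Closeness depends on \<open>p e\<close> and \<open>b\<close> only, which makes the length of a lifting step uniform.\<close>

locale local_transport =
  fixes E :: "'e topology" and B :: "'b topology" and p :: "'e \<Rightarrow> 'b"
    and W :: "('b \<times> 'b) set" and tr :: "'e \<Rightarrow> 'b \<Rightarrow> 'e"
  assumes cont_p: "continuous_map E B p"
    and open_W: "openin (prod_topology B B) W"
    and diag_W: "\<And>b. b \<in> topspace B \<Longrightarrow> (b, b) \<in> W"
    and cont_tr: "continuous_map (subtopology (prod_topology E B) {(e, b). (p e, b) \<in> W}) E (\<lambda>(e, b). tr e b)"
    and p_tr: "\<And>e b. e \<in> topspace E \<Longrightarrow> b \<in> topspace B \<Longrightarrow> (p e, b) \<in> W \<Longrightarrow> p (tr e b) = b"
    and tr_p: "\<And>e. e \<in> topspace E \<Longrightarrow> tr e (p e) = e"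
begin

text \<open>Bisection of the time interval: since closeness is a condition on values of
  \<open>H\<close> and not on the lift, compactness of \<open>D\<close> gives around each time one
  step length that is valid for all \<open>t\<close> and all initial lifts. The last clause holds
  because \<open>tr e (p e) = e\<close>; it later keeps lifted homotopies of spheroids fixed on the
  boundary.\<close>

lemma homotopy_lifting:
  assumes D: "compact_space D" and f: "continuous_map D E f"
    and H: "continuous_map (prod_topology unit_interval D) B H"
    and H0: "\<And>t. t \<in> topspace D \<Longrightarrow> H (0, t) = p (f t)"
  obtains F where "continuous_map (prod_topology unit_interval D) E F"
    "\<And>t. t \<in> topspace D \<Longrightarrow> F (0, t) = f t"
    "\<And>s t. s \<in> {0..1} \<Longrightarrow> t \<in> topspace D \<Longrightarrow> p (F (s, t)) = H (s, t)"
    "\<And>t s. t \<in> topspace D \<Longrightarrow> (\<And>u. u \<in> {0..1} \<Longrightarrow> H (u, t) = H (0, t)) \<Longrightarrow> s \<in> {0..1} \<Longrightarrow> F (s, t) = f t"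
proof -
  define stat where "stat t \<longleftrightarrow> (\<forall>u\<in>{0..1}. H (u, t) = H (0, t))" for t
  define lifts where "lifts a b g F \<longleftrightarrow>
      continuous_map (prod_topology (top_of_set {a..b}) D) E F \<and>
      (\<forall>t\<in>topspace D. F (a, t) = g t) \<and>
      (\<forall>s\<in>{a..b}. \<forall>t\<in>topspace D. p (F (s, t)) = H (s, t)) \<and>
      (\<forall>t\<in>topspace D. stat t \<longrightarrow> (\<forall>s\<in>{a..b}. F (s, t) = g t))"
    for a b :: real and g F
  \<comment> \<open>Quantifying over the initial lift \<open>g\<close> makes \<open>P\<close>
    transitive: the final map of one lift is the initial map of the next.\<close>
  define P where "P a b \<longleftrightarrow> (0 \<le> a \<and> a \<le> b \<and> b \<le> 1 \<longrightarrow>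
      (\<forall>g. continuous_map D E g \<and> (\<forall>t\<in>topspace D. p (g t) = H (a, t)) \<longrightarrow> (\<exists>F. lifts a b g F)))"
    for a b :: real
  have "(0::real) \<le> 1" by simp
  then have "P 0 1"
  proof (induction rule: Bolzano[where P=P])
    case (trans a b c)
    show ?case
      unfolding P_def
    proof (intro impI allI)
      fix g assume bd: "0 \<le> a \<and> a \<le> c \<and> c \<le> 1"
        and g: "continuous_map D E g \<and> (\<forall>t\<in>topspace D. p (g t) = H (a, t))"
      obtain F where F: "lifts a b g F"
        using trans bd g unfolding P_def by (meson order_trans)
      have "continuous_map D E (F \<circ> Pair b)"
        using F trans unfolding lifts_def by (intro continuous_map_o_Pair) auto
      moreover have "\<forall>t\<in>topspace D. p ((F \<circ> Pair b) t) = H (b, t)"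
        using F trans unfolding lifts_def by auto
      ultimately obtain G where G: "lifts b c (F \<circ> Pair b) G"
        using trans bd unfolding P_def by (meson order_trans)
      let ?X = "prod_topology (top_of_set {a..c}) D"
      let ?K = "\<lambda>x. if fst x \<le> b then F x else G x"
      have fst: "continuous_map ?X euclideanreal fst"
        using continuous_map_fst continuous_map_into_fulltopology by blast
      have "continuous_map ?X E ?K"
      proof (rule continuous_map_cases_le)
        show "continuous_map ?X euclideanreal fst" by fact
        show "continuous_map ?X euclideanreal (\<lambda>x. b)" by simp
        have "subtopology ?X {x \<in> topspace ?X. fst x \<le> b} = prod_topology (top_of_set {a..b}) D"
          using trans by (intro subtopology_interval_times) auto
        then show "continuous_map (subtopology ?X {x \<in> topspace ?X. fst x \<le> b}) E F"
          using F unfolding lifts_def by simp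
        have "subtopology ?X {x \<in> topspace ?X. b \<le> fst x} = prod_topology (top_of_set {b..c}) D"
          using trans by (intro subtopology_interval_times) auto
        then show "continuous_map (subtopology ?X {x \<in> topspace ?X. b \<le> fst x}) E G"
          using G unfolding lifts_def by simp
        show "\<And>x. x \<in> topspace ?X \<Longrightarrow> fst x = b \<Longrightarrow> F x = G x"
          using G unfolding lifts_def by auto
      qed
      moreover have "G (s, t) = g t" if "t \<in> topspace D" "stat t" "s \<in> {b..c}" for s t
        using F G that trans unfolding lifts_def by simp
      ultimately have "lifts a c g ?K"
        using F G trans unfolding lifts_def by auto
      then show "\<exists>F. lifts a c g F" by blast
    qed
  next
    case (local x)
    \<comment> \<open>The initial time and the current time of a step are the two coordinates of a
      square. One application of the tube lemma at the diagonal point \<open>(x, x)\<close> controls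
      both.\<close>
    let ?Z = "prod_topology (prod_topology unit_interval unit_interval) D"
    let ?V = "{z \<in> topspace ?Z. (H (fst (fst z), snd z), H (snd (fst z), snd z)) \<in> W}"
    have 1: "continuous_map ?Z (prod_topology unit_interval D) (\<lambda>z. (fst (fst z), snd z))"
      by (intro continuous_map_pairedI continuous_map_snd continuous_map_compose[OF continuous_map_fst continuous_map_fst, unfolded o_def])
    have 2: "continuous_map ?Z (prod_topology unit_interval D) (\<lambda>z. (snd (fst z), snd z))"
      by (intro continuous_map_pairedI continuous_map_snd continuous_map_compose[OF continuous_map_fst continuous_map_snd, unfolded o_def])
    have cont: "continuous_map ?Z (prod_topology B B) (\<lambda>z. (H (fst (fst z), snd z), H (snd (fst z), snd z)))"
      using continuous_map_compose[OF 1 H] continuous_map_compose[OF 2 H]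
      by (intro continuous_map_pairedI) (auto simp: o_def)
    have V: "openin ?Z ?V"
      using openin_continuous_map_preimage[OF cont open_W] .
    have xV: "{(x, x)} \<times> topspace D \<subseteq> ?V"
      using local continuous_map_image_subset_topspace[OF H] by (auto intro!: diag_W simp: image_subset_iff)
    have x: "(x, x) \<in> topspace (prod_topology unit_interval unit_interval)"
      using local by simp
    obtain U where U: "openin (prod_topology unit_interval unit_interval) U" "(x, x) \<in> U"
      "U \<times> topspace D \<subseteq> ?V"
      using compact_tube[OF D V x xV] .
    obtain U1 U2 where U12: "openin unit_interval U1" "openin unit_interval U2" "x \<in> U1" "x \<in> U2" "U1 \<times> U2 \<subseteq> U"
      using U(1)[unfolded openin_prod_topology_alt, rule_format, OF U(2)] by auto
    obtain d1 where d1: "d1 > 0" "ball x d1 \<inter> {0..1} \<subseteq> U1"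
      using U12(1,3) unfolding openin_contains_ball by auto
    obtain d2 where d2: "d2 > 0" "ball x d2 \<inter> {0..1} \<subseteq> U2"
      using U12(2,4) unfolding openin_contains_ball by auto
    note d = d1 d2
    show ?case
    proof (intro exI conjI allI impI)
      show "0 < min d1 d2" using d by auto
      fix a b assume ab: "a \<le> x \<and> x \<le> b \<and> b - a < min d1 d2"
      show "P a b" unfolding P_def
      proof (intro impI allI)
        fix g assume bd: "0 \<le> a \<and> a \<le> b \<and> b \<le> 1" and g: "continuous_map D E g \<and> (\<forall>t\<in>topspace D. p (g t) = H (a, t))"
        have inW: "(p (g t), H (s, t)) \<in> W" if "s \<in> {a..b}" "t \<in> topspace D" for s t
        proof -
          have "a \<in> U1" "s \<in> U2" using d ab bd that by (auto simp: dist_real_def subset_iff)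
          then have "((a, s), t) \<in> ?V" using U12 U that by blast
          then show ?thesis using g that by auto
        qed
        let ?F = "\<lambda>z. tr (g (snd z)) (H z)"
        let ?Y = "prod_topology (top_of_set {a..b}) D"
        have "prod_topology (top_of_set {a..b}) D = subtopology (prod_topology unit_interval D) ({a..b} \<times> topspace D)"
          using bd by (intro interval_times_topology) auto
        then have H': "continuous_map ?Y B H"
          using H by (metis continuous_map_from_subtopology)
        have g': "continuous_map ?Y E (\<lambda>z. g (snd z))"
          using g continuous_map_compose[OF continuous_map_snd, of D E g "top_of_set {a..b}"] by (simp add: o_def)
        have "continuous_map ?Y (subtopology (prod_topology E B) {(e, b). (p e, b) \<in> W}) (\<lambda>z. (g (snd z), H z))"
          using inW by (auto intro!: continuous_map_into_subtopology continuous_map_pairedI g' H')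
        from continuous_map_compose[OF this cont_tr] have "continuous_map ?Y E ?F"
          by (simp add: o_def)
        moreover have gE: "g t \<in> topspace E" if "t \<in> topspace D" for t
          using that g continuous_map_image_subset_topspace by blast
        moreover have "H (s, t) \<in> topspace B" if "s \<in> {a..b}" "t \<in> topspace D" for s t
          using continuous_map_image_subset_topspace[OF H'] that by auto
        moreover have "tr (g t) (H (a, t)) = g t" if "t \<in> topspace D" for t
          using tr_p[OF gE[OF that]] g that by simp
        moreover have "tr (g t) (H (s, t)) = g t"
          if "t \<in> topspace D" "stat t" "s \<in> {a..b}" for s t
        proof -
          have "s \<in> {0..1}" "a \<in> {0..1}" using that bd by auto
          then have "H (s, t) = H (a, t)" using that unfolding stat_def by metis
          then show ?thesis using tr_p[OF gE[OF that(1)]] g that by simp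
        qed
        ultimately have "lifts a b g ?F"
          unfolding lifts_def using p_tr inW by auto
        then show "\<exists>F. lifts a b g F" by blast
      qed
    qed
  qed
  then obtain F where F: "lifts 0 1 f F"
    unfolding P_def using f H0 by auto
  show ?thesis
  proof (rule that)
    show "F (s, t) = f t" if "t \<in> topspace D" "\<And>u. u \<in> {0..1} \<Longrightarrow> H (u, t) = H (0, t)" "s \<in> {0..1}" for s t
    proof -
      have "stat t" unfolding stat_def using that(2) by blast
      then show ?thesis using F that(1,3) unfolding lifts_def by blast
    qed
  qed (use F in \<open>auto simp: lifts_def\<close>)
qed

end

section \<open>Spheroids and homotopy groups\<close>

lemma continuous_map_fst_top_of_set: "continuous_map (prod_topology (top_of_set S) Y) euclidean fst"
  using continuous_map_fst by (rule continuous_map_into_fulltopology)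

lemma topspace_cube: "topspace (cube i) = (\<Pi>\<^sub>E k\<in>{..<i}. {0..1})"
  by (simp add: cube_def)

lemma compact_space_cube: "compact_space (cube i)"
  by (simp add: cube_def compact_space_product_topology compact_space_subtopology)

lemma cube_boundary_subset: "cube_boundary i \<subseteq> topspace (cube i)"
  by (auto simp: cube_boundary_def)

lemma continuous_map_into_cube:
  "continuous_map X (cube i) f \<longleftrightarrow>
     f \<in> topspace X \<rightarrow> topspace (cube i) \<and> (\<forall>k<i. continuous_map X euclideanreal (\<lambda>x. f x k))"
  unfolding cube_def continuous_map_componentwise
  by (auto simp: continuous_map_in_subtopology PiE_iff Pi_iff)

lemma continuous_map_cube_coordinate:
  "k < i \<Longrightarrow> continuous_map (cube i) euclideanreal (\<lambda>x. x k)"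
  using continuous_map_into_cube[of "cube i" i "\<lambda>x. x"] by simp

text \<open>Contraction of the cube towards its corner. The value \<open>undefined\<close> is
  forced, because points of the product topology are extensional functions.\<close>

definition cube_scale :: "nat \<Rightarrow> real \<Rightarrow> (nat \<Rightarrow> real) \<Rightarrow> nat \<Rightarrow> real" where
  "cube_scale i s t = (\<lambda>k. if k < i then s * t k else undefined)"

lemma continuous_map_cube_scale:
  "continuous_map (prod_topology unit_interval (cube i)) (cube i) (\<lambda>x. cube_scale i (fst x) (snd x))"
  unfolding continuous_map_into_cube
proof (intro conjI allI impI)
  show "(\<lambda>x. cube_scale i (fst x) (snd x)) \<in> topspace (prod_topology unit_interval (cube i)) \<rightarrow> topspace (cube i)"
    by (simp add: cube_scale_def topspace_cube PiE_iff mult_le_one extensional_def Pi_iff)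
  fix k assume k: "k < i"
  have "continuous_map (prod_topology unit_interval (cube i)) euclideanreal (\<lambda>x. fst x * snd x k)"
    using continuous_map_compose[OF continuous_map_snd continuous_map_cube_coordinate[OF k], unfolded o_def]
    by (intro continuous_map_real_mult continuous_map_fst_top_of_set)
  then show "continuous_map (prod_topology unit_interval (cube i)) euclideanreal (\<lambda>x. cube_scale i (fst x) (snd x) k)"
    using k by (simp add: cube_scale_def)
qed

lemma cube_scale_1: "t \<in> topspace (cube i) \<Longrightarrow> cube_scale i 1 t = t"
  by (auto simp: cube_scale_def topspace_cube PiE_iff extensional_def)

definition cube_origin :: "nat \<Rightarrow> nat \<Rightarrow> real" where
  "cube_origin i = cube_scale i 0 (\<lambda>_. 0)"

lemma cube_scale_0: "cube_scale i 0 t = cube_origin i"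
  by (simp add: cube_scale_def cube_origin_def cong: if_cong)

lemma cube_origin: "cube_origin i \<in> topspace (cube i)"
  by (auto simp: cube_origin_def cube_scale_def topspace_cube PiE_iff extensional_def)

lemma cube_origin_boundary: "i > 0 \<Longrightarrow> cube_origin i \<in> cube_boundary i"
  using cube_origin by (auto simp: cube_boundary_def cube_origin_def cube_scale_def)

lemma connected_space_cube: "connected_space (cube i)"
  by (simp add: cube_def connected_space_product_topology connected_space_subtopology)

lemma connectedin_cube_face:
  assumes "c \<in> {0..1}" "k < i"
  shows "connectedin (cube i) {t \<in> topspace (cube i). t k = c}"
proof -
  have "t \<in> (\<Pi>\<^sub>E j\<in>{..<i}. if j = k then {c} else {0..1}) \<longleftrightarrow> t \<in> topspace (cube i) \<and> t k = c" for t
    using assms unfolding topspace_cube PiE_iff by (metis (full_types) lessThan_iff singleton_iff)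
  then have "{t \<in> topspace (cube i). t k = c} = (\<Pi>\<^sub>E j\<in>{..<i}. if j = k then {c} else {0..1})"
    by blast
  moreover have "connectedin (cube i) (\<Pi>\<^sub>E j\<in>{..<i}. if j = k then {c} else {0..1})"
    unfolding cube_def connectedin_PiE using assms by (simp add: connectedin_subtopology)
  ultimately show ?thesis by simp
qed

text \<open>Each boundary point lies on a face \<open>t l = c\<close>, and with a second index
  \<open>k\<close> this face meets the face \<open>t k = 0\<close>. The unions of two such faces are
  connected and all contain the origin. For \<open>i = 1\<close> the boundary would be two
  points.\<close>

lemma connectedin_cube_boundary:
  assumes "i \<ge> 2"
  shows "connectedin (cube i) (cube_boundary i)"
proof -
  define face where "face k c = {t \<in> topspace (cube i). t k = c}" for k and c :: real
  have conn: "connectedin (cube i) (face k 0 \<union> face l c)"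
    if "k < i" "l < i" "c \<in> {0, 1}" "k \<noteq> l" for k l c
  proof (rule connectedin_Un)
    show "connectedin (cube i) (face k 0)" "connectedin (cube i) (face l c)"
      unfolding face_def using that by (intro connectedin_cube_face; auto)+
    have "(\<lambda>j. if j < i then if j = l then c else 0 else undefined) \<in> face k 0 \<inter> face l c"
      using that by (auto simp: face_def topspace_cube PiE_iff extensional_def)
    then show "face k 0 \<inter> face l c \<noteq> {}" by blast
  qed
  let ?S = "{face k 0 \<union> face l c | k l c. k < i \<and> l < i \<and> c \<in> {0, 1} \<and> k \<noteq> l}"
  have "cube_boundary i = \<Union> ?S"
  proof
    show "cube_boundary i \<subseteq> \<Union> ?S"
    proof
      fix t assume "t \<in> cube_boundary i"
      then obtain l where l: "t \<in> topspace (cube i)" "l < i" "t l \<in> {0, 1}"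
        by (auto simp: cube_boundary_def)
      obtain k where "k < i" "k \<noteq> l"
        using assms by (metis One_nat_def Suc_1 Suc_le_lessD less_le_trans not_less_eq_eq old.nat.exhaust zero_less_Suc zero_neq_one)
      then have "face k 0 \<union> face l (t l) \<in> ?S" using l by blast
      moreover have "t \<in> face k 0 \<union> face l (t l)" using l by (simp add: face_def)
      ultimately show "t \<in> \<Union> ?S" by (rule UnionI)
    qed
    show "\<Union> ?S \<subseteq> cube_boundary i"
      by (auto simp: cube_boundary_def face_def)
  qed
  moreover have "connectedin (cube i) (\<Union> ?S)"
  proof (rule connectedin_Union)
    show "connectedin (cube i) S" if "S \<in> ?S" for S
      using that conn by blast
    have "cube_origin i \<in> S" if "S \<in> ?S" for S
      using that cube_origin by (auto simp: face_def cube_origin_def cube_scale_def)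
    then show "\<Inter> ?S \<noteq> {}" by blast
  qed
  ultimately show ?thesis by simp
qed

lemma homotopic_spheroids:
  "homotopic_spheroids i X x0 f g \<longleftrightarrow>
     (\<exists>h. continuous_map (prod_topology unit_interval (cube i)) X h \<and>
       (\<forall>t\<in>topspace (cube i). h (0, t) = f t) \<and> (\<forall>t\<in>topspace (cube i). h (1, t) = g t) \<and>
       (\<forall>s\<in>{0..1}. \<forall>t\<in>cube_boundary i. h (s, t) = x0))"
  unfolding homotopic_spheroids_def
  using cube_boundary_subset by (subst homotopic_with) (auto simp: subset_iff)

lemma homotopic_spheroidsE:
  assumes "homotopic_spheroids i X x0 f g"
  obtains h where "continuous_map (prod_topology unit_interval (cube i)) X h"
    "\<And>t. t \<in> topspace (cube i) \<Longrightarrow> h (0, t) = f t" "\<And>t. t \<in> topspace (cube i) \<Longrightarrow> h (1, t) = g t"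
    "\<And>s t. s \<in> {0..1} \<Longrightarrow> t \<in> cube_boundary i \<Longrightarrow> h (s, t) = x0"
  using assms unfolding homotopic_spheroids by blast

lemma homotopic_spheroids_trans:
  "homotopic_spheroids i X x0 f g \<Longrightarrow> homotopic_spheroids i X x0 g h \<Longrightarrow> homotopic_spheroids i X x0 f h"
  unfolding homotopic_spheroids_def by (rule homotopic_with_trans)

lemma homotopic_spheroids_sym:
  "homotopic_spheroids i X x0 f g \<longleftrightarrow> homotopic_spheroids i X x0 g f"
  unfolding homotopic_spheroids_def by (rule homotopic_with_sym)

lemma homotopic_spheroids_refl:
  "homotopic_spheroids i X x0 f f \<longleftrightarrow> f \<in> spheroids i X x0"
  unfolding homotopic_spheroids_def spheroids_def by simp

lemma homotopic_spheroids_equal: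
  assumes "f \<in> spheroids i X x0" "\<And>t. t \<in> topspace (cube i) \<Longrightarrow> f t = g t"
  shows "homotopic_spheroids i X x0 f g"
  using assms cube_boundary_subset unfolding homotopic_spheroids_def spheroids_def
  by (intro homotopic_with_equal) (auto simp: subset_iff)

lemma homotopic_spheroids_imp_spheroids:
  assumes "homotopic_spheroids i X x0 f g"
  shows "f \<in> spheroids i X x0" "g \<in> spheroids i X x0"
  using assms homotopic_with_imp_continuous_maps homotopic_with_imp_property
  unfolding homotopic_spheroids_def spheroids_def by blast+

lemma spheroids_compose:
  "f \<in> spheroids i X x0 \<Longrightarrow> continuous_map X Y q \<Longrightarrow> q \<circ> f \<in> spheroids i Y (q x0)"
  by (auto simp: spheroids_def intro: continuous_map_compose)

lemma homotopic_spheroids_compose: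
  "homotopic_spheroids i X x0 f g \<Longrightarrow> continuous_map X Y q \<Longrightarrow> homotopic_spheroids i Y (q x0) (q \<circ> f) (q \<circ> g)"
  unfolding homotopic_spheroids_def
  by (erule (1) homotopic_with_compose_continuous_map_left) simp

lemma homotopic_concat_spheroids:
  assumes i: "i > 0" and f: "homotopic_spheroids i X x0 f f'" and g: "homotopic_spheroids i X x0 g g'"
  shows "homotopic_spheroids i X x0 (concat_spheroids f g) (concat_spheroids f' g')"
proof -
  let ?I = "prod_topology unit_interval (cube i)"
  obtain F where F: "continuous_map ?I X F" "\<And>t. t \<in> topspace (cube i) \<Longrightarrow> F (0, t) = f t"
      "\<And>t. t \<in> topspace (cube i) \<Longrightarrow> F (1, t) = f' t" "\<And>s t. s \<in> {0..1} \<Longrightarrow> t \<in> cube_boundary i \<Longrightarrow> F (s, t) = x0"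
    using f by (elim homotopic_spheroidsE) blast
  obtain G where G: "continuous_map ?I X G" "\<And>t. t \<in> topspace (cube i) \<Longrightarrow> G (0, t) = g t"
      "\<And>t. t \<in> topspace (cube i) \<Longrightarrow> G (1, t) = g' t" "\<And>s t. s \<in> {0..1} \<Longrightarrow> t \<in> cube_boundary i \<Longrightarrow> G (s, t) = x0"
    using g by (elim homotopic_spheroidsE) blast
  define lo hi where "lo t = t(0 := 2 * t 0)" and "hi t = t(0 := 2 * t 0 - 1)" for t :: "nat \<Rightarrow> real"
  have coord0: "continuous_map ?I euclideanreal (\<lambda>x. snd x k)" if "k < i" for k
    using continuous_map_compose[OF continuous_map_snd continuous_map_cube_coordinate[OF that]] by (simp add: o_def)
  have lo_in: "lo t \<in> topspace (cube i)" if "t \<in> topspace (cube i)" "t 0 \<le> 1/2" for t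
    using that i by (auto simp: lo_def topspace_cube PiE_iff extensional_def)
  have hi_in: "hi t \<in> topspace (cube i)" if "t \<in> topspace (cube i)" "1/2 \<le> t 0" for t
    using that i by (auto simp: hi_def topspace_cube PiE_iff extensional_def)
  let ?K = "\<lambda>x. if snd x 0 \<le> 1/2 then F (fst x, lo (snd x)) else G (fst x, hi (snd x))"
  have fstI: "continuous_map (subtopology ?I S) unit_interval fst" for S
    by (intro continuous_map_from_subtopology continuous_map_fst)
  have K: "continuous_map ?I X ?K"
  proof (rule continuous_map_cases_le)
    show "continuous_map ?I euclideanreal (\<lambda>x. snd x 0)" using coord0 i by blast
    show "continuous_map ?I euclideanreal (\<lambda>x. 1/2)" by simp
    have "continuous_map (subtopology ?I {x \<in> topspace ?I. snd x 0 \<le> 1/2}) ?I (\<lambda>x. (fst x, lo (snd x)))"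
      using lo_in
      by (intro continuous_map_pairedI fstI; auto simp: continuous_map_into_cube)
         (auto simp: lo_def fun_upd_def intro!: continuous_map_from_subtopology coord0 continuous_map_real_mult_left)
    from continuous_map_compose[OF this F(1)]
    show "continuous_map (subtopology ?I {x \<in> topspace ?I. snd x 0 \<le> 1/2}) X (\<lambda>x. F (fst x, lo (snd x)))"
      by (simp add: o_def)
    have "continuous_map (subtopology ?I {x \<in> topspace ?I. 1/2 \<le> snd x 0}) ?I (\<lambda>x. (fst x, hi (snd x)))"
      using hi_in
      by (intro continuous_map_pairedI fstI; auto simp: continuous_map_into_cube)
         (auto simp: hi_def fun_upd_def intro!: continuous_map_from_subtopology coord0 continuous_map_real_mult_left continuous_map_diff)
    from continuous_map_compose[OF this G(1)]
    show "continuous_map (subtopology ?I {x \<in> topspace ?I. 1/2 \<le> snd x 0}) X (\<lambda>x. G (fst x, hi (snd x)))"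
      by (simp add: o_def)
    \<comment> \<open>On the seam the first coordinate of \<open>lo\<close> is 1 and that of
      \<open>hi\<close> is 0. Both are boundary points, so both homotopies have the value
      \<open>x0\<close>.\<close>
    fix x assume x: "x \<in> topspace ?I" "snd x 0 = 1/2"
    then have "lo (snd x) \<in> cube_boundary i" "hi (snd x) \<in> cube_boundary i"
      using lo_in hi_in i by (auto simp: cube_boundary_def intro!: exI[of _ 0]) (auto simp: lo_def hi_def)
    then show "F (fst x, lo (snd x)) = G (fst x, hi (snd x))"
      using F G x by auto
  qed
  show ?thesis
    unfolding homotopic_spheroids
  proof (intro exI conjI ballI)
    show "continuous_map ?I X ?K" by fact
    fix t assume t: "t \<in> topspace (cube i)"
    show "?K (0, t) = concat_spheroids f g t"
      using F(2)[OF lo_in] G(2)[OF hi_in] t by (auto simp: concat_spheroids_def lo_def hi_def)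
    show "?K (1, t) = concat_spheroids f' g' t"
      using F(3)[OF lo_in] G(3)[OF hi_in] t by (auto simp: concat_spheroids_def lo_def hi_def)
  next
    fix s :: real and t assume s: "s \<in> {0..1}" and t: "t \<in> cube_boundary i"
    then obtain k where k: "k < i" "t k = 0 \<or> t k = 1" "t \<in> topspace (cube i)"
      by (auto simp: cube_boundary_def)
    have "lo t \<in> cube_boundary i" if "t 0 \<le> 1/2"
      using k that lo_in[OF k(3)] unfolding cube_boundary_def
      by (cases "k = 0") (auto simp: lo_def intro!: exI[of _ k])
    moreover have "hi t \<in> cube_boundary i" if "\<not> t 0 \<le> 1/2"
      using k that hi_in[OF k(3)] unfolding cube_boundary_def
      by (cases "k = 0") (auto simp: hi_def intro!: exI[of _ k])
    ultimately show "?K (s, t) = x0"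
      using F(4)[OF s] G(4)[OF s] by simp
  qed
qed

lemma concat_spheroids_in:
  "i > 0 \<Longrightarrow> f \<in> spheroids i X x0 \<Longrightarrow> g \<in> spheroids i X x0 \<Longrightarrow> concat_spheroids f g \<in> spheroids i X x0"
  using homotopic_concat_spheroids[of i X x0 f f g g] unfolding homotopic_spheroids_refl by blast

lemma concat_spheroids_compose: "concat_spheroids (q \<circ> f) (q \<circ> g) = q \<circ> concat_spheroids f g"
  by (auto simp: concat_spheroids_def)

lemma homotopy_class_eq_iff:
  assumes "f \<in> spheroids i X x0"
  shows "homotopy_class i X x0 f = homotopy_class i X x0 g \<longleftrightarrow> homotopic_spheroids i X x0 f g"
  unfolding homotopy_class_def
  using assms homotopic_spheroids_refl homotopic_spheroids_trans homotopic_spheroids_sym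
  by (smt (verit, best) Collect_cong mem_Collect_eq)

lemma homotopy_group_mult:
  assumes "i > 0" "f \<in> spheroids i X x0" "g \<in> spheroids i X x0"
  shows "homotopy_class i X x0 f \<otimes>\<^bsub>homotopy_group i X x0\<^esub> homotopy_class i X x0 g
       = homotopy_class i X x0 (concat_spheroids f g)"
proof -
  have "homotopic_spheroids i X x0 (concat_spheroids f g) h \<longleftrightarrow>
      (\<exists>f'. homotopic_spheroids i X x0 f f' \<and> (\<exists>g'. homotopic_spheroids i X x0 g g' \<and>
        homotopic_spheroids i X x0 (concat_spheroids f' g') h))" for h
    using assms homotopic_concat_spheroids homotopic_spheroids_refl homotopic_spheroids_trans homotopic_spheroids_sym
    by metis
  then show ?thesis
    by (auto simp: homotopy_group_def homotopy_class_def)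
qed

lemma homotopy_group_mult_closed:
  assumes "i > 0" "a \<in> carrier (homotopy_group i X x0)" "b \<in> carrier (homotopy_group i X x0)"
  shows "a \<otimes>\<^bsub>homotopy_group i X x0\<^esub> b \<in> carrier (homotopy_group i X x0)"
proof -
  obtain f g where fg: "a = homotopy_class i X x0 f" "b = homotopy_class i X x0 g"
    "f \<in> spheroids i X x0" "g \<in> spheroids i X x0"
    using assms by (auto simp: homotopy_group_def)
  show ?thesis
    unfolding fg(1,2) homotopy_group_mult[OF assms(1) fg(3,4)]
    using concat_spheroids_in[OF assms(1) fg(3,4)] by (simp add: homotopy_group_def)
qed

text \<open>Closure is what makes the inverse multiplicative: the product of two preimages has to
  lie in the carrier before injectivity applies to it.\<close>

lemma is_iso_sym_closed:
  assumes "G \<cong> H" and closed: "\<And>x y. x \<in> carrier G \<Longrightarrow> y \<in> carrier G \<Longrightarrow> x \<otimes>\<^bsub>G\<^esub> y \<in> carrier G"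
  shows "H \<cong> G"
proof -
  obtain h where h: "h \<in> hom G H" "bij_betw h (carrier G) (carrier H)"
    using assms unfolding is_iso_def iso_def by auto
  let ?k = "inv_into (carrier G) h"
  have k: "bij_betw ?k (carrier H) (carrier G)" using h bij_betw_inv_into by blast
  have "?k (x \<otimes>\<^bsub>H\<^esub> y) = ?k x \<otimes>\<^bsub>G\<^esub> ?k y" if "x \<in> carrier H" "y \<in> carrier H" for x y
  proof -
    have in': "?k x \<in> carrier G" "?k y \<in> carrier G" using k that bij_betwE by blast+
    have "h (?k x \<otimes>\<^bsub>G\<^esub> ?k y) = x \<otimes>\<^bsub>H\<^esub> y"
      using h in' that by (simp add: hom_mult bij_betw_inv_into_right)
    then show ?thesis
      using closed[OF in'] h bij_betw_inv_into_left by metis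
  qed
  then have "?k \<in> hom H G" using k bij_betwE unfolding hom_def by blast
  then show ?thesis unfolding is_iso_def iso_def using k by blast
qed

lemma homotopy_group_iso_sym:
  "i > 0 \<Longrightarrow> homotopy_group i X x0 \<cong> H \<Longrightarrow> H \<cong> homotopy_group i X x0"
  by (rule is_iso_sym_closed) (auto intro: homotopy_group_mult_closed)

text \<open>Reduces an isomorphism to bijectivity on maps up to homotopy. Multiplicativity is
  automatic, because composing with \<open>q\<close> commutes with concatenation as an equality of
  functions.\<close>

lemma homotopy_group_isoI:
  assumes i: "i > 0" and q: "continuous_map X Y q" "q x0 = y0"
    and surj: "\<And>g. g \<in> spheroids i Y y0 \<Longrightarrow> \<exists>f\<in>spheroids i X x0. homotopic_spheroids i Y y0 (q \<circ> f) g"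
    and inj: "\<And>f g. f \<in> spheroids i X x0 \<Longrightarrow> g \<in> spheroids i X x0 \<Longrightarrow>
        homotopic_spheroids i Y y0 (q \<circ> f) (q \<circ> g) \<Longrightarrow> homotopic_spheroids i X x0 f g"
  shows "homotopy_group i X x0 \<cong> homotopy_group i Y y0"
proof -
  define rep where "rep a = (SOME f. f \<in> spheroids i X x0 \<and> a = homotopy_class i X x0 f)" for a
  define h where "h a = homotopy_class i Y y0 (q \<circ> rep a)" for a
  have qf: "q \<circ> f \<in> spheroids i Y y0" if "f \<in> spheroids i X x0" for f
    using spheroids_compose[OF that q(1)] q(2) by simp
  have h: "h (homotopy_class i X x0 f) = homotopy_class i Y y0 (q \<circ> f)" if f: "f \<in> spheroids i X x0" for f
  proof -
    have "rep (homotopy_class i X x0 f) \<in> spheroids i X x0 \<and>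
        homotopy_class i X x0 f = homotopy_class i X x0 (rep (homotopy_class i X x0 f))"
      unfolding rep_def by (rule someI[where x=f]) (simp add: f)
    then show ?thesis
      using homotopic_spheroids_compose[OF _ q(1)] q(2) f qf
      unfolding h_def by (metis homotopy_class_eq_iff)
  qed
  have carr: "carrier (homotopy_group i X x0) = homotopy_class i X x0 ` spheroids i X x0" for X :: "'c topology" and x0
    by (simp add: homotopy_group_def)
  have "h \<in> hom (homotopy_group i X x0) (homotopy_group i Y y0)"
    unfolding hom_def carr
  proof (intro CollectI conjI funcsetI ballI; elim imageE)
    fix a f assume "a = homotopy_class i X x0 f" "f \<in> spheroids i X x0"
    then show "h a \<in> homotopy_class i Y y0 ` spheroids i Y y0"
      using h[of f] qf[of f] by simp
  next
    fix a b f g assume a: "a = homotopy_class i X x0 f" and f: "f \<in> spheroids i X x0"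
      and b: "b = homotopy_class i X x0 g" and g: "g \<in> spheroids i X x0"
    show "h (a \<otimes>\<^bsub>homotopy_group i X x0\<^esub> b) = h a \<otimes>\<^bsub>homotopy_group i Y y0\<^esub> h b"
      unfolding a b homotopy_group_mult[OF i f g] h[OF f] h[OF g] h[OF concat_spheroids_in[OF i f g]]
        homotopy_group_mult[OF i qf[OF f] qf[OF g]] concat_spheroids_compose ..
  qed
  moreover have "inj_on h (carrier (homotopy_group i X x0))"
    unfolding carr
  proof (rule inj_onI, elim imageE)
    fix a b f g assume "h a = h b" and a: "a = homotopy_class i X x0 f" and f: "f \<in> spheroids i X x0"
      and b: "b = homotopy_class i X x0 g" and g: "g \<in> spheroids i X x0"
    then have "homotopic_spheroids i Y y0 (q \<circ> f) (q \<circ> g)"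
      unfolding a b h[OF f] h[OF g] homotopy_class_eq_iff[OF qf[OF f]] by simp
    then show "a = b"
      unfolding a b homotopy_class_eq_iff[OF f] by (rule inj[OF f g])
  qed
  moreover have "h ` carrier (homotopy_group i X x0) = carrier (homotopy_group i Y y0)"
    unfolding carr
  proof (intro equalityI subsetI)
    fix b assume "b \<in> h ` homotopy_class i X x0 ` spheroids i X x0"
    then obtain f where "f \<in> spheroids i X x0" "b = h (homotopy_class i X x0 f)" by blast
    then show "b \<in> homotopy_class i Y y0 ` spheroids i Y y0" using h[of f] qf[of f] by simp
  next
    fix b assume "b \<in> homotopy_class i Y y0 ` spheroids i Y y0"
    then obtain g where g: "g \<in> spheroids i Y y0" "b = homotopy_class i Y y0 g" by auto
    then obtain f where f: "f \<in> spheroids i X x0" "homotopic_spheroids i Y y0 (q \<circ> f) g"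
      using surj by blast
    then have "b = h (homotopy_class i X x0 f)"
      unfolding g(2) h[OF f(1)] by (intro sym[OF iffD2[OF homotopy_class_eq_iff[OF qf[OF f(1)]] f(2)]])
    then show "b \<in> h ` homotopy_class i X x0 ` spheroids i X x0"
      using f(1) by blast
  qed
  ultimately show ?thesis
    unfolding is_iso_def iso_def bij_betw_def by blast
qed

text \<open>The homotopy downstairs is stationary on the boundary of the cube, hence so is its lift.
  The lift is therefore a homotopy of spheroids, and \<open>f'\<close> is its final map.\<close>

lemma (in local_transport) lift_spheroid_homotopy:
  assumes f: "f \<in> spheroids i E e0" and pfg: "homotopic_spheroids i B (p e0) (p \<circ> f) g"
  obtains f' where "homotopic_spheroids i E e0 f f'" "\<And>t. t \<in> topspace (cube i) \<Longrightarrow> p (f' t) = g t"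
proof -
  obtain H where H: "continuous_map (prod_topology unit_interval (cube i)) B H"
    "\<And>t. t \<in> topspace (cube i) \<Longrightarrow> H (0, t) = (p \<circ> f) t" "\<And>t. t \<in> topspace (cube i) \<Longrightarrow> H (1, t) = g t"
    "\<And>s t. s \<in> {0..1} \<Longrightarrow> t \<in> cube_boundary i \<Longrightarrow> H (s, t) = p e0"
    using homotopic_spheroidsE[OF pfg] by blast
  have fc: "continuous_map (cube i) E f" and fb: "\<And>t. t \<in> cube_boundary i \<Longrightarrow> f t = e0"
    using f by (auto simp: spheroids_def)
  obtain F where F: "continuous_map (prod_topology unit_interval (cube i)) E F"
    "\<And>t. t \<in> topspace (cube i) \<Longrightarrow> F (0, t) = f t"
    "\<And>s t. s \<in> {0..1} \<Longrightarrow> t \<in> topspace (cube i) \<Longrightarrow> p (F (s, t)) = H (s, t)"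
    "\<And>t s. t \<in> topspace (cube i) \<Longrightarrow> (\<And>u. u \<in> {0..1} \<Longrightarrow> H (u, t) = H (0, t)) \<Longrightarrow> s \<in> {0..1} \<Longrightarrow> F (s, t) = f t"
    using homotopy_lifting[OF compact_space_cube fc H(1)] H(2) by auto
  have Fb: "F (s, t) = e0" if "s \<in> {0..1}" "t \<in> cube_boundary i" for s t
  proof -
    have "H (u, t) = H (0, t)" if "u \<in> {0..1}" for u
      using H(4)[OF that \<open>t \<in> cube_boundary i\<close>] H(4)[of 0, OF _ \<open>t \<in> cube_boundary i\<close>] by simp
    then have "F (s, t) = f t" using F(4) that cube_boundary_subset by blast
    then show ?thesis using fb that by simp
  qed
  show thesis
  proof
    show "homotopic_spheroids i E e0 f (F \<circ> Pair 1)"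
      unfolding homotopic_spheroids using F(1,2) Fb by (intro exI[of _ F]) simp
    show "p ((F \<circ> Pair 1) t) = g t" if "t \<in> topspace (cube i)" for t
      using F(3)[of 1 t] H(3)[OF that] that by simp
  qed
qed

text \<open>\<open>N\<close> expresses discreteness of the fibres uniformly. With the Hausdorff
  property it makes the set where two lifts agree both open and closed.\<close>

locale covering_transport = local_transport +
  fixes N :: "('a \<times> 'a) set"
  assumes Hausdorff_E: "Hausdorff_space E"
    and open_N: "openin (prod_topology E E) N"
    and diag_N: "\<And>e. e \<in> topspace E \<Longrightarrow> (e, e) \<in> N"
    and separated: "\<And>e e'. e \<in> topspace E \<Longrightarrow> e' \<in> topspace E \<Longrightarrow> (e, e') \<in> N \<Longrightarrow> p e = p e' \<Longrightarrow> e = e'"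
begin

lemma unique_lift:
  assumes C: "connected_space C" and u: "continuous_map C E u" and v: "continuous_map C E v"
    and eq: "\<And>t. t \<in> topspace C \<Longrightarrow> p (u t) = p (v t)"
    and t0: "t0 \<in> topspace C" "u t0 = v t0" and t: "t \<in> topspace C"
  shows "u t = v t"
proof -
  let ?S = "{t \<in> topspace C. u t = v t}"
  have "closedin C ?S"
    using closedin_continuous_maps_eq[OF Hausdorff_E u v] .
  moreover have "openin C {t \<in> topspace C. (u t, v t) \<in> N}"
    using openin_continuous_map_preimage[OF continuous_map_pairedI[OF u v] open_N] .
  moreover have "{t \<in> topspace C. (u t, v t) \<in> N} = ?S"
  proof -
    have "u x \<in> topspace E" "v x \<in> topspace E" if "x \<in> topspace C" for x
      using that u v continuous_map_image_subset_topspace by blast+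
    then show ?thesis using diag_N separated eq by fastforce
  qed
  ultimately have "?S = {} \<or> ?S = topspace C"
    using C unfolding connected_space_clopen_in by metis
  then show ?thesis using t0 t by blast
qed

text \<open>Scaling contracts \<open>g\<close> to its value at a boundary point, that is, to
  \<open>p e0\<close>. Lifting this homotopy from the constant map at \<open>e0\<close> ends in a
  lift of \<open>g\<close>, which is constant on the connected boundary by uniqueness of
  lifts.\<close>

lemma lift_spheroid:
  assumes i: "i \<ge> 2" and e0: "e0 \<in> topspace E" and g: "g \<in> spheroids i B (p e0)"
  shows "\<exists>f\<in>spheroids i E e0. \<forall>t\<in>topspace (cube i). p (f t) = g t"
proof -
  have gc: "continuous_map (cube i) B g" and gb: "\<And>t. t \<in> cube_boundary i \<Longrightarrow> g t = p e0"
    using g by (auto simp: spheroids_def)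
  have ob: "cube_origin i \<in> cube_boundary i" using cube_origin_boundary i by simp
  have c0: "continuous_map (cube i) E (\<lambda>_. e0)" using e0 by simp
  let ?H = "\<lambda>x. g (cube_scale i (fst x) (snd x))"
  have H: "continuous_map (prod_topology unit_interval (cube i)) B ?H"
    using continuous_map_compose[OF continuous_map_cube_scale gc] by (simp add: o_def)
  have H0: "?H (0, t) = p e0" for t
    using gb[OF ob] by (simp add: cube_scale_0)
  obtain F where F: "continuous_map (prod_topology unit_interval (cube i)) E F"
    "\<And>s t. s \<in> {0..1} \<Longrightarrow> t \<in> topspace (cube i) \<Longrightarrow> p (F (s, t)) = ?H (s, t)"
    "\<And>t s. t \<in> topspace (cube i) \<Longrightarrow> (\<And>u. u \<in> {0..1} \<Longrightarrow> ?H (u, t) = ?H (0, t)) \<Longrightarrow> s \<in> {0..1} \<Longrightarrow> F (s, t) = e0"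
    using homotopy_lifting[OF compact_space_cube c0 H H0] by metis
  define f where "f = F \<circ> Pair 1"
  have f: "continuous_map (cube i) E f"
    unfolding f_def using F(1) by (rule continuous_map_o_Pair) simp
  have pf: "p (f t) = g t" if "t \<in> topspace (cube i)" for t
    using F(2)[of 1 t] that by (simp add: f_def cube_scale_1)
  \<comment> \<open>The origin is fixed by scaling, so the lift is stationary there. This pins down
    one boundary value.\<close>
  have "cube_scale i s (cube_origin i) = cube_origin i" for s
    by (auto simp: cube_origin_def cube_scale_def)
  then have fo: "f (cube_origin i) = e0"
    unfolding f_def o_def by (intro F(3) cube_origin) auto
  have "f t = e0" if "t \<in> cube_boundary i" for t
  proof (rule unique_lift[where C="subtopology (cube i) (cube_boundary i)" and u=f and t=t and v="\<lambda>_. e0" and t0="cube_origin i"])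
    show "connected_space (subtopology (cube i) (cube_boundary i))"
      using connectedin_cube_boundary[OF i] by (simp add: connectedin_def)
    show "continuous_map (subtopology (cube i) (cube_boundary i)) E f"
      using f by (rule continuous_map_from_subtopology)
    show "continuous_map (subtopology (cube i) (cube_boundary i)) E (\<lambda>_. e0)"
      using e0 by simp
  qed (use that pf gb ob fo cube_boundary_subset in auto)
  then show ?thesis using f pf by (auto simp: spheroids_def)
qed

text \<open>Lifting the homotopy from \<open>f\<close> ends in a map \<open>f'\<close> over
  \<open>p \<circ> g\<close>. It agrees with \<open>g\<close> at the origin, hence on the whole
  connected cube.\<close>

lemma lift_homotopic_spheroids:
  assumes f: "f \<in> spheroids i E e0" and g: "g \<in> spheroids i E e0" and i: "i > 0"
    and pfg: "homotopic_spheroids i B (p e0) (p \<circ> f) (p \<circ> g)"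
  shows "homotopic_spheroids i E e0 f g"
proof -
  obtain f' where f': "homotopic_spheroids i E e0 f f'" "\<And>t. t \<in> topspace (cube i) \<Longrightarrow> p (f' t) = (p \<circ> g) t"
    using lift_spheroid_homotopy[OF f pfg] by blast
  note f'_in = homotopic_spheroids_imp_spheroids(2)[OF f'(1)]
  have "f' t = g t" if t: "t \<in> topspace (cube i)" for t
  proof (rule unique_lift[OF connected_space_cube _ _ _ cube_origin _ t])
    show "continuous_map (cube i) E f'" "continuous_map (cube i) E g"
      using f'_in g by (auto simp: spheroids_def)
    show "f' (cube_origin i) = g (cube_origin i)"
      using f'_in g cube_origin_boundary[OF i] by (simp add: spheroids_def)
  qed (use f'(2) in simp)
  then have "homotopic_spheroids i E e0 f' g"
    by (rule homotopic_spheroids_equal[OF f'_in])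
  with f'(1) show ?thesis by (rule homotopic_spheroids_trans)
qed

theorem homotopy_group_iso:
  assumes "i \<ge> 2" "e0 \<in> topspace E"
  shows "homotopy_group i E e0 \<cong> homotopy_group i B (p e0)"
proof (rule homotopy_group_isoI[OF _ cont_p])
  fix g assume g: "g \<in> spheroids i B (p e0)"
  then obtain f where f: "f \<in> spheroids i E e0" "\<And>t. t \<in> topspace (cube i) \<Longrightarrow> p (f t) = g t"
    using lift_spheroid assms by blast
  have "homotopic_spheroids i B (p e0) g (p \<circ> f)"
    by (rule homotopic_spheroids_equal[OF g]) (simp add: f)
  then have "homotopic_spheroids i B (p e0) (p \<circ> f) g"
    by (subst homotopic_spheroids_sym)
  then show "\<exists>f\<in>spheroids i E e0. homotopic_spheroids i B (p e0) (p \<circ> f) g"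
    using f(1) by (rule bexI)
next
  fix f g assume "f \<in> spheroids i E e0" "g \<in> spheroids i E e0" "homotopic_spheroids i B (p e0) (p \<circ> f) (p \<circ> g)"
  then show "homotopic_spheroids i E e0 f g"
    using assms(1) by (intro lift_homotopic_spheroids) auto
qed (use assms(1) in auto)

end

section \<open>Asphericity of open sets in the plane\<close>

lemma moebius_denominator_nonzero:
  assumes "norm a < 1" "norm z < 1"
  shows "1 - cnj a * z \<noteq> 0"
proof
  assume "1 - cnj a * z = 0"
  then have "norm (cnj a * z) = 1" by (metis eq_iff_diff_eq_0 norm_one)
  moreover have "norm a * norm z < 1 * 1" using assms by (intro mult_strict_mono') auto
  ultimately show False by (simp add: norm_mult)
qed

lemma moebius_in_disc:
  "norm a < 1 \<Longrightarrow> z \<in> ball 0 1 \<Longrightarrow> Moebius_function 0 a z \<in> ball 0 1"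
  using Moebius_function_norm_lt_1 by simp

lemma moebius_eq_0_iff:
  assumes "norm a < 1" "norm z < 1"
  shows "Moebius_function 0 a z = 0 \<longleftrightarrow> z = a"
  using moebius_denominator_nonzero[OF assms] by (simp add: Moebius_function_simple)

lemma continuous_on_moebius: "norm a < 1 \<Longrightarrow> continuous_on (ball 0 1) (Moebius_function 0 a)"
  using Moebius_function_holomorphic holomorphic_on_imp_continuous_on by blast

lemma moebius_has_field_derivative:
  assumes "norm a < 1" "norm z < 1"
  shows "(Moebius_function 0 a has_field_derivative (1 - (norm a)\<^sup>2) / (1 - cnj a * z)\<^sup>2) (at z)"
proof -
  have nz: "1 - cnj a * z \<noteq> 0" using moebius_denominator_nonzero[OF assms] .
  have *: "((\<lambda>z. (z - a) / (1 - cnj a * z)) has_field_derivative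
      ((1 - cnj a * z) - (z - a) * (- cnj a)) / ((1 - cnj a * z) * (1 - cnj a * z))) (at z)"
    using nz by (auto intro!: derivative_eq_intros)
  have num: "(1 - cnj a * z) - (z - a) * (- cnj a) = 1 - (norm a)\<^sup>2"
    using complex_norm_square[of a] by (simp add: algebra_simps)
  from * show ?thesis
    unfolding num by (simp add: Moebius_function_simple[abs_def] power2_eq_square)
qed

lemma moebius_norm_identity:
  "(norm (1 - cnj a * z))\<^sup>2 - (norm (z - a))\<^sup>2 = (1 - (norm a)\<^sup>2) * (1 - (norm z)\<^sup>2)"
  unfolding cmod_power2 by (simp add: power2_eq_square algebra_simps)

text \<open>Pseudo-hyperbolic distance at most 1/2 from the disc of radius \<open>\<rho>\<close>
  keeps a point in a smaller disc that depends on \<open>\<rho>\<close> only. For \<open>m\<close>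
  the value of the Moebius function, \<open>1 - (norm z)\<^sup>2\<close> equals \<open>(1 - (norm
  a)\<^sup>2) * (1 - (norm m)\<^sup>2) / (norm (1 + cnj a * m))\<^sup>2\<close>. The factors are
  bounded by \<open>1 - \<rho>\<^sup>2\<close>, 3/4 and 9/4, which would allow a third of
  \<open>1 - \<rho>\<^sup>2\<close>; an eighth is enough.\<close>

lemma norm_bound_of_moebius:
  assumes a: "norm a \<le> \<rho>" "\<rho> < 1" and z: "norm z < 1" and m: "norm (Moebius_function 0 a z) \<le> 1/2"
  shows "norm z \<le> sqrt (1 - (1 - \<rho>\<^sup>2) / 8)"
proof -
  have a1: "norm a < 1" using a by simp
  let ?m = "Moebius_function 0 a z"
  have m1: "norm ?m < 1" using m by simp
  have z_eq: "z = (?m + a) / (1 + cnj a * ?m)"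
    using Moebius_function_compose[of a "-a"] Moebius_function_compose[of "-a" a z] a1 z
    by (simp add: Moebius_function_simple)
  have nz: "1 + cnj a * ?m \<noteq> 0"
    using moebius_denominator_nonzero[of "-a" ?m] a1 m1 by simp
  have id: "(norm (1 + cnj a * ?m))\<^sup>2 - (norm (?m + a))\<^sup>2 = (1 - (norm a)\<^sup>2) * (1 - (norm ?m)\<^sup>2)"
    using moebius_norm_identity[of "-a" ?m] by simp
  have "norm (1 + cnj a * ?m) \<le> 1 + norm a * norm ?m"
    using norm_triangle_ineq[of 1 "cnj a * ?m"] by (simp add: norm_mult)
  also have "\<dots> \<le> 1 + 1 * (1/2)"
    using a1 m by (intro add_left_mono mult_mono) auto
  finally have d: "(norm (1 + cnj a * ?m))\<^sup>2 \<le> (3/2)\<^sup>2"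
    by (intro power_mono) auto
  have d0: "(norm (1 + cnj a * ?m))\<^sup>2 > 0" using nz by simp
  have a2: "(norm a)\<^sup>2 \<le> \<rho>\<^sup>2" using a by (intro power_mono) auto
  have m2: "(norm ?m)\<^sup>2 \<le> (1/2)\<^sup>2" using m by (intro power_mono) auto
  have "0 \<le> \<rho>" using a(1) norm_ge_zero order_trans by blast
  then have rho: "\<rho>\<^sup>2 \<le> 1" using a(2) by (simp add: power_le_one)
  have "(1 - \<rho>\<^sup>2) * (3/4) \<le> (1 - (norm a)\<^sup>2) * (1 - (norm ?m)\<^sup>2)"
    using a2 m2 rho by (intro mult_mono) (auto simp: power2_eq_square)
  then have *: "(norm (?m + a))\<^sup>2 \<le> (norm (1 + cnj a * ?m))\<^sup>2 - (1 - \<rho>\<^sup>2) * (3/4)"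
    using id by linarith
  have "(1 - \<rho>\<^sup>2) / 8 * (norm (1 + cnj a * ?m))\<^sup>2 \<le> (1 - \<rho>\<^sup>2) / 8 * (3/2)\<^sup>2"
    using d rho by (intro mult_left_mono) auto
  also have "\<dots> \<le> (1 - \<rho>\<^sup>2) * (3/4)" using rho by (simp add: power2_eq_square)
  finally have "(norm (?m + a))\<^sup>2 \<le> (1 - (1 - \<rho>\<^sup>2) / 8) * (norm (1 + cnj a * ?m))\<^sup>2"
    using * unfolding left_diff_distrib[of 1 "(1 - \<rho>\<^sup>2) / 8"] by linarith
  moreover have "(norm z)\<^sup>2 = (norm (?m + a))\<^sup>2 / (norm (1 + cnj a * ?m))\<^sup>2"
    by (subst z_eq) (simp add: norm_divide power_divide)
  ultimately have "(norm z)\<^sup>2 \<le> 1 - (1 - \<rho>\<^sup>2) / 8"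
    using d0 by (simp add: divide_le_eq)
  then show ?thesis by (intro real_le_rsqrt)
qed

text \<open>The Schwarz lemma, after the ball has been rescaled to the unit disc and the value at
  its centre moved to 0.\<close>

lemma Schwarz_Pick_center:
  assumes L: "L holomorphic_on ball c r" "\<And>z. z \<in> ball c r \<Longrightarrow> norm (L z) < 1" and r: "r > 0" and z: "z \<in> ball c r"
  shows "norm (Moebius_function 0 (L c) (L z)) \<le> norm (z - c) / r"
proof -
  let ?F = "\<lambda>w. Moebius_function 0 (L c) (L (c + of_real r * w))"
  have into: "c + of_real r * w \<in> ball c r" if "norm w < 1" for w
    using that r by (simp add: dist_norm norm_mult)
  have Lc: "norm (L c) < 1" using L(2) r by simp
  have "(\<lambda>w. L (c + of_real r * w)) holomorphic_on ball 0 1"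
    using into by (intro holomorphic_on_compose_gen[OF _ L(1), unfolded o_def] holomorphic_intros) auto
  then have "?F holomorphic_on ball 0 1"
    using L(2) into
    by (intro holomorphic_on_compose_gen[OF _ Moebius_function_holomorphic[OF Lc], unfolded o_def]) auto
  moreover have "?F 0 = 0" by (simp add: Moebius_function_eq_zero)
  moreover have "norm (?F w) < 1" if "norm w < 1" for w
    using Moebius_function_norm_lt_1[OF Lc L(2)[OF into[OF that]]] .
  moreover have w: "norm ((z - c) / of_real r) < 1"
    using z r by (simp add: norm_divide dist_norm norm_minus_commute)
  ultimately have "norm (?F ((z - c) / of_real r)) \<le> norm ((z - c) / of_real r)"
    by (rule Schwarz_Lemma(1))
  then show ?thesis using r by (simp add: norm_divide)
qed

lemma norm_deriv_le_of_disc_map: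
  assumes L: "L holomorphic_on ball c r" "\<And>z. z \<in> ball c r \<Longrightarrow> norm (L z) < 1" "L c = 0" and r: "r > 0"
  shows "norm (deriv L c) \<le> 1 / r"
proof -
  let ?F = "\<lambda>w. L (c + of_real r * w)"
  have into: "c + of_real r * w \<in> ball c r" if "norm w < 1" for w
    using that r by (simp add: dist_norm norm_mult)
  have F: "?F holomorphic_on ball 0 1"
    using into by (intro holomorphic_on_compose_gen[OF _ L(1), unfolded o_def] holomorphic_intros) auto
  have "(L has_field_derivative deriv L c) (at c)"
    using L(1) r by (intro holomorphic_derivI[of _ "ball c r"]) auto
  then have "(?F has_field_derivative deriv L c * of_real r) (at 0)"
    by (intro DERIV_chain2[where f=L]) (auto intro!: derivative_eq_intros)
  then have "deriv ?F 0 = deriv L c * of_real r" by (rule DERIV_imp_deriv)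
  moreover have "norm (deriv ?F 0) \<le> 1"
    by (rule Schwarz_Lemma(2)[OF F, where \<xi>=0]) (use L into in auto)
  ultimately show ?thesis using r by (simp add: norm_mult field_simps)
qed

text \<open>Koebe's map: a branched double cover of the disc, fixing 0, whose branch value is \<open>a = - b\<^sup>2\<close>.\<close>

definition koebe_map :: "complex \<Rightarrow> complex \<Rightarrow> complex \<Rightarrow> complex" where
  "koebe_map a b w = Moebius_function 0 (- a) ((Moebius_function 0 (- b) w)\<^sup>2)"

context
  fixes a b :: complex
  assumes a: "norm a < 1" and b: "b\<^sup>2 = - a"
begin

lemma koebe_norm_b: "norm b < 1" "(norm b)\<^sup>2 = norm a"
proof -
  show *: "(norm b)\<^sup>2 = norm a" using b by (metis norm_minus_cancel norm_power)
  show "norm b < 1" using a unfolding *[symmetric] by (simp add: power_less_one_iff)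
qed

lemma koebe_square_in_disc: "w \<in> ball 0 1 \<Longrightarrow> (Moebius_function 0 (- b) w)\<^sup>2 \<in> ball 0 1"
  using moebius_in_disc[of "-b" w] koebe_norm_b by (simp add: norm_power power_less_one_iff)

lemma koebe_map_in_disc: "w \<in> ball 0 1 \<Longrightarrow> koebe_map a b w \<in> ball 0 1"
  unfolding koebe_map_def using moebius_in_disc[of "-a"] koebe_square_in_disc a by simp

lemma koebe_map_holomorphic: "koebe_map a b holomorphic_on ball 0 1"
proof -
  have "(\<lambda>w. (Moebius_function 0 (- b) w)\<^sup>2) holomorphic_on ball 0 1"
    using Moebius_function_holomorphic[of "-b"] koebe_norm_b by (intro holomorphic_intros) auto
  moreover have "(\<lambda>w. (Moebius_function 0 (- b) w)\<^sup>2) ` ball 0 1 \<subseteq> ball 0 1"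
    using koebe_square_in_disc by blast
  ultimately show ?thesis
    unfolding koebe_map_def
    using holomorphic_on_compose_gen[OF _ Moebius_function_holomorphic[of "-a" 0], unfolded o_def] a by auto
qed

lemma koebe_map_0: "koebe_map a b 0 = 0"
  using b by (simp add: koebe_map_def Moebius_function_of_zero Moebius_function_eq_zero)

text \<open>Preimages of \<open>z\<close> come from square roots of
  \<open>Moebius_function 0 a z\<close>. Lifting through Koebe's map thus means choosing a
  continuous or holomorphic square root.\<close>

lemma koebe_map_moebius:
  assumes "norm s < 1" "norm z < 1" "s\<^sup>2 = Moebius_function 0 a z"
  shows "koebe_map a b (Moebius_function 0 b s) = z"
  unfolding koebe_map_def
  using assms a koebe_norm_b by (simp add: Moebius_function_compose)

lemma koebe_map_deriv:
  "(koebe_map a b has_field_derivative 2 * b * (1 - norm a) / (1 - (norm a)\<^sup>2)) (at 0)"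
proof -
  have "(Moebius_function 0 (- b) has_field_derivative (1 - (norm b)\<^sup>2)) (at 0)"
    using moebius_has_field_derivative[of "-b" 0] koebe_norm_b by simp
  then have 1: "((\<lambda>w. (Moebius_function 0 (- b) w)\<^sup>2) has_field_derivative 2 * b * (1 - norm a)) (at 0)"
    using koebe_norm_b by (auto intro!: derivative_eq_intros simp: Moebius_function_of_zero)
  define x where "x = 1 - (norm a)\<^sup>2"
  have x: "x \<noteq> 0" using a by (simp add: x_def power2_eq_1_iff) (smt (verit) norm_ge_zero)
  have eq: "1 - cnj (- a) * (- a) = of_real x"
    using complex_norm_square[of a] by (simp add: x_def mult.commute)
  have "(Moebius_function 0 (- a) has_field_derivative of_real x / (of_real x)\<^sup>2) (at (- a))"
    using moebius_has_field_derivative[of "-a" "-a", unfolded eq] a by (simp add: x_def)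
  moreover have "of_real x / (of_real x)\<^sup>2 = 1 / (of_real x :: complex)"
    using x by (simp add: power2_eq_square)
  ultimately have "(Moebius_function 0 (- a) has_field_derivative 1 / (1 - (norm a)\<^sup>2)) (at (- a))"
    by (simp add: x_def)
  then have "(Moebius_function 0 (- a) has_field_derivative 1 / (1 - (norm a)\<^sup>2)) (at ((Moebius_function 0 (- b) 0)\<^sup>2))"
    using b by (simp add: Moebius_function_of_zero)
  from DERIV_chain2[OF this 1] show ?thesis
    unfolding koebe_map_def by simp
qed

text \<open>With \<open>x = norm b\<close> and \<open>norm a = x\<^sup>2\<close> the derivative has
  norm \<open>2 * x / (1 + x\<^sup>2) = 1 - (1 - x)\<^sup>2 / (1 + x\<^sup>2)\<close>. Replacing the
  denominator by 2 and \<open>x\<close> by \<open>sqrt \<rho>\<close> gives a bound below 1 that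
  depends on \<open>\<rho>\<close> only.\<close>

lemma koebe_map_deriv_norm:
  assumes "norm a \<le> \<rho>" "\<rho> < 1"
  shows "norm (deriv (koebe_map a b) 0) \<le> 1 - (1 - sqrt \<rho>)\<^sup>2 / 2"
proof -
  define x where "x = norm b"
  have x: "0 \<le> x" "x < 1" "norm a = x\<^sup>2" using koebe_norm_b by (auto simp: x_def)
  have xr: "x \<le> sqrt \<rho>" using assms x by (intro real_le_rsqrt) simp
  have r1: "sqrt \<rho> < 1" using assms by simp
  have x2: "x\<^sup>2 < 1" using x a by simp
  have "norm (deriv (koebe_map a b) 0) = norm (2 * b * (1 - norm a) / (1 - (norm a)\<^sup>2))"
    using DERIV_imp_deriv[OF koebe_map_deriv] by simp
  also have "\<dots> = 2 * x * (1 - x\<^sup>2) / (1 - (x\<^sup>2)\<^sup>2)"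
  proof -
    have *: "norm (1 - complex_of_real y) = 1 - y" if "y < 1" for y
    proof -
      have "1 - complex_of_real y = of_real (1 - y)" by simp
      then show ?thesis using that by (simp only: norm_of_real)
    qed
    have "norm (1 - complex_of_real (norm a)) = 1 - x\<^sup>2"
      using *[of "norm a"] x a by simp
    moreover have "norm (1 - (complex_of_real (norm a))\<^sup>2) = 1 - (x\<^sup>2)\<^sup>2"
      using *[of "(norm a)\<^sup>2"] x a by (simp add: power_less_one_iff)
    ultimately show ?thesis by (simp add: norm_mult norm_divide x_def)
  qed
  also have "\<dots> = 2 * x / (1 + x\<^sup>2)"
  proof -
    have "1 - (x\<^sup>2)\<^sup>2 = (1 - x\<^sup>2) * (1 + x\<^sup>2)" by (simp add: power2_eq_square algebra_simps)
    then show ?thesis using x2 by simp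
  qed
  also have "\<dots> = 1 - (1 - x)\<^sup>2 / (1 + x\<^sup>2)"
  proof -
    have "1 + x\<^sup>2 \<noteq> 0" by (smt (verit) zero_le_power2)
    then show ?thesis by (simp add: field_simps power2_eq_square)
  qed
  also have "\<dots> \<le> 1 - (1 - sqrt \<rho>)\<^sup>2 / 2"
  proof -
    have "(1 - sqrt \<rho>)\<^sup>2 \<le> (1 - x)\<^sup>2" using xr r1 by (intro power_mono) auto
    moreover have "(1 - x)\<^sup>2 / 2 \<le> (1 - x)\<^sup>2 / (1 + x\<^sup>2)"
      using x2 by (intro divide_left_mono) (auto intro: add_pos_nonneg)
    ultimately show ?thesis by linarith
  qed
  finally show ?thesis .
qed

end

text \<open>Uniform continuity in time. Since \<open>D\<close> carries no metric, uniformity in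
  \<open>t\<close> comes from the tube lemma at time \<open>x\<close>.\<close>

lemma homotopy_uniformly_close:
  fixes \<Phi> :: "real \<times> 'a \<Rightarrow> 'b::metric_space"
  assumes D: "compact_space D" and \<Phi>: "continuous_map (prod_topology unit_interval D) euclidean \<Phi>"
    and x: "x \<in> {0..1}" and e: "e > 0"
  obtains d where "d > 0"
    "\<And>s s' t. s \<in> {0..1} \<Longrightarrow> s' \<in> {0..1} \<Longrightarrow> \<bar>s - x\<bar> < d \<Longrightarrow> \<bar>s' - x\<bar> < d \<Longrightarrow> t \<in> topspace D \<Longrightarrow>
       dist (\<Phi> (s, t)) (\<Phi> (s', t)) < e"
proof -
  let ?Z = "prod_topology unit_interval D"
  have "continuous_map ?Z euclidean (\<Phi> \<circ> (\<lambda>z. (x, snd z)))"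
    using x by (intro continuous_map_compose[OF _ \<Phi>] continuous_map_pairedI continuous_map_snd) auto
  then have "continuous_map ?Z (prod_topology euclidean euclidean) (\<lambda>z. (\<Phi> z, (\<Phi> \<circ> (\<lambda>z. (x, snd z))) z))"
    using \<Phi> by (intro continuous_map_pairedI)
  moreover have "openin (prod_topology euclidean euclidean) {z :: 'b \<times> 'b. dist (fst z) (snd z) < e / 2}"
    unfolding euclidean_product_topology[symmetric] by (auto intro!: open_Collect_less continuous_intros)
  ultimately have op: "openin ?Z {z \<in> topspace ?Z. (\<Phi> z, (\<Phi> \<circ> (\<lambda>z. (x, snd z))) z) \<in> {z. dist (fst z) (snd z) < e / 2}}"
    (is "openin ?Z ?V") by (rule openin_continuous_map_preimage)
  have sub: "{x} \<times> topspace D \<subseteq> ?V" using x e by auto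
  obtain U where U: "openin unit_interval U" "x \<in> U" "U \<times> topspace D \<subseteq> ?V"
    using compact_tube[OF D op _ sub] x by auto
  then obtain d where d: "d > 0" "ball x d \<inter> {0..1} \<subseteq> U"
    unfolding openin_contains_ball by auto
  show thesis
  proof (rule that[OF d(1)])
    fix s s' t assume *: "s \<in> {0..1}" "s' \<in> {0..1}" "\<bar>s - x\<bar> < d" "\<bar>s' - x\<bar> < d" "t \<in> topspace D"
    have "s \<in> U" "s' \<in> U" using * d by (auto simp: dist_real_def subset_iff abs_minus_commute)
    then have "dist (\<Phi> (s, t)) (\<Phi> (x, t)) < e / 2" "dist (\<Phi> (s', t)) (\<Phi> (x, t)) < e / 2"
      using U(3) * by (auto simp: subset_iff)
    then show "dist (\<Phi> (s, t)) (\<Phi> (s', t)) < e" by (rule dist_triangle_half_l)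
  qed
qed

section \<open>Square roots of spheroids\<close>

text \<open>When \<open>b / e\<^sup>2\<close> has positive real part, its principal root is
  continuous and \<open>e * csqrt (b / e\<^sup>2)\<close> is the root of \<open>b\<close> on the
  side of \<open>e\<close>. The last set consists of the pairs in which \<open>e'\<close> is closer
  to \<open>e\<close> than \<open>- e'\<close> is, and this excludes
  \<open>e' = - e\<close>.\<close>

interpretation square: covering_transport "top_of_set (- {0})" "top_of_set (- {0::complex})" "\<lambda>z. z\<^sup>2"
  "{x \<in> topspace (prod_topology (top_of_set (- {0})) (top_of_set (- {0}))). Re (snd x / fst x) \<in> {0<..}}"
  "\<lambda>e b. e * csqrt (b / e\<^sup>2)"
  "{x \<in> topspace (prod_topology (top_of_set (- {0})) (top_of_set (- {0}))). norm (fst x + snd x) - norm (fst x - snd x) \<in> {0<..}}"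
proof
  show "continuous_map (top_of_set (- {0})) (top_of_set (- {0::complex})) (\<lambda>z. z\<^sup>2)"
    by (intro continuous_map_into_subtopology) (auto intro!: continuous_intros)
  show "openin (prod_topology (top_of_set (- {0})) (top_of_set (- {0})))
     {x \<in> topspace (prod_topology (top_of_set (- {0})) (top_of_set (- {0::complex}))). Re (snd x / fst x) \<in> {0<..}}"
    by (rule openin_continuous_map_preimage[where Y=euclideanreal]) (auto intro!: continuous_intros)
  show "openin (prod_topology (top_of_set (- {0})) (top_of_set (- {0})))
     {x \<in> topspace (prod_topology (top_of_set (- {0})) (top_of_set (- {0::complex}))). norm (fst x + snd x) - norm (fst x - snd x) \<in> {0<..}}"
    by (rule openin_continuous_map_preimage[where Y=euclideanreal]) (auto intro!: continuous_intros)
  let ?S = "{x :: complex \<times> complex. fst x \<noteq> 0 \<and> snd x \<noteq> 0 \<and> Re (snd x / (fst x)\<^sup>2) > 0}"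
  have "continuous_on ?S (\<lambda>x. fst x * csqrt (snd x / (fst x)\<^sup>2))"
  proof (intro continuous_intros)
    have "continuous_on {z. Re z > 0} csqrt"
      by (intro continuous_at_imp_continuous_on ballI isCont_csqrt') (auto simp: complex_nonpos_Reals_iff)
    then show "continuous_on ?S (\<lambda>x. csqrt (snd x / (fst x)\<^sup>2))"
      by (rule continuous_on_compose2) (auto intro!: continuous_intros)
  qed
  then have "continuous_map (top_of_set ?S) (top_of_set (- {0})) (\<lambda>x. fst x * csqrt (snd x / (fst x)\<^sup>2))"
    by (intro continuous_map_into_subtopology) auto
  moreover have "subtopology (prod_topology (top_of_set (- {0})) (top_of_set (- {0})))
     {(e, b). (e\<^sup>2, b) \<in> {x \<in> topspace (prod_topology (top_of_set (- {0})) (top_of_set (- {0::complex}))). Re (snd x / fst x) \<in> {0<..}}}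
     = top_of_set ?S"
    by (simp add: subtopology_subtopology) (rule arg_cong[where f="\<lambda>S. top_of_set S"], auto)
  ultimately show "continuous_map (subtopology (prod_topology (top_of_set (- {0})) (top_of_set (- {0})))
     {(e, b). (e\<^sup>2, b) \<in> {x \<in> topspace (prod_topology (top_of_set (- {0})) (top_of_set (- {0::complex}))). Re (snd x / fst x) \<in> {0<..}}})
     (top_of_set (- {0})) (\<lambda>(e, b). e * csqrt (b / e\<^sup>2))"
    by (simp add: case_prod_unfold)
  show "Hausdorff_space (top_of_set (- {0::complex}))"
    by (simp add: Hausdorff_space_subtopology)
next
  fix e e' :: complex
  assume "(e, e') \<in> {x \<in> topspace (prod_topology (top_of_set (- {0})) (top_of_set (- {0}))). norm (fst x + snd x) - norm (fst x - snd x) \<in> {0<..}}"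
    "e\<^sup>2 = e'\<^sup>2"
  then show "e = e'" by (auto simp: power2_eq_iff)
qed (auto simp: power_mult_distrib)

lemma sqrt_spheroid:
  assumes i: "i \<ge> 2" and F: "F \<in> spheroids i (top_of_set (- {0::complex})) c"
  obtains b s where "b\<^sup>2 = c" "s \<in> spheroids i (top_of_set (- {0})) b" "\<And>t. t \<in> topspace (cube i) \<Longrightarrow> (s t)\<^sup>2 = F t"
proof -
  have "c \<in> - {0}"
    using F cube_origin_boundary[of i] i cube_origin[of i] continuous_map_image_subset_topspace[of "cube i" "top_of_set (- {0})" F]
    unfolding spheroids_def by force
  then obtain s where "s \<in> spheroids i (top_of_set (- {0})) (csqrt c)" "\<forall>t\<in>topspace (cube i). (s t)\<^sup>2 = F t"
    using square.lift_spheroid[OF i, of "csqrt c" F] F by auto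
  then show thesis
    by (intro that[of "csqrt c" s]) auto
qed

lemma sqrt_unique_on_connected:
  assumes C: "connectedin X C" and u: "continuous_map X euclidean u" and v: "continuous_map X euclidean v"
    and eq: "\<And>t. t \<in> C \<Longrightarrow> (u t)\<^sup>2 = (v t)\<^sup>2" and nz: "\<And>t. t \<in> C \<Longrightarrow> u t \<noteq> (0::complex)"
    and t0: "t0 \<in> C" "u t0 = v t0" and t: "t \<in> C"
  shows "u t = v t"
proof (rule square.unique_lift[where C="subtopology X C" and t=t and t0=t0])
  have sub: "C \<subseteq> topspace X" using C by (simp add: connectedin_def)
  show "connected_space (subtopology X C)" using C by (simp add: connectedin_def)
  show "continuous_map (subtopology X C) (top_of_set (- {0})) u"
    using u nz by (intro continuous_map_into_subtopology continuous_map_from_subtopology) auto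
  have "v t \<noteq> 0" if "t \<in> C" for t using eq[OF that] nz[OF that] by auto
  then show "continuous_map (subtopology X C) (top_of_set (- {0})) v"
    using v by (intro continuous_map_into_subtopology continuous_map_from_subtopology) auto
qed (use assms in \<open>auto simp: connectedin_def\<close>)

lemma continuous_map_continuous_on_compose:
  assumes "continuous_map X (top_of_set S) f" "continuous_on S g"
  shows "continuous_map X euclidean (\<lambda>x. g (f x))"
  using continuous_map_compose[OF assms(1), of euclidean g] assms(2) by (simp add: o_def)

lemma continuous_map_continuous_on_UNIV_compose:
  assumes "continuous_map X euclidean f" "continuous_on UNIV g"
  shows "continuous_map X euclidean (\<lambda>x. g (f x))"
  using continuous_map_compose[OF assms(1), of euclidean g] assms(2) by (simp add: o_def)

lemma continuous_map_mult:
  fixes f :: "'a \<Rightarrow> 'b::real_normed_algebra"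
  shows "continuous_map X euclidean f \<Longrightarrow> continuous_map X euclidean g \<Longrightarrow> continuous_map X euclidean (\<lambda>x. f x * g x)"
  by (simp add: continuous_map_atin tendsto_mult)

lemma continuous_map_complex_of_real:
  "continuous_map X euclidean f \<Longrightarrow> continuous_map X euclidean (\<lambda>x. complex_of_real (f x))"
  by (simp add: continuous_map_atin tendsto_of_real)

lemma holomorphic_on_moebius_compose:
  assumes "L holomorphic_on S" "\<And>z. z \<in> S \<Longrightarrow> L z \<in> ball 0 1" "norm a < 1"
  shows "(\<lambda>z. Moebius_function 0 a (L z)) holomorphic_on S"
proof -
  have "L ` S \<subseteq> ball 0 1" using assms(2) by blast
  from holomorphic_on_compose_gen[OF assms(1) Moebius_function_holomorphic[OF assms(3)] this]
  show ?thesis by (simp add: o_def)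
qed

section \<open>Koebe's argument for one spheroid in a bounded open set\<close>

locale planar_spheroid =
  fixes i :: nat and U :: "complex set" and c :: complex and R :: real and f :: "(nat \<Rightarrow> real) \<Rightarrow> complex"
  assumes i: "i \<ge> 2" and open_U: "open U" and bounded_U: "U \<subseteq> ball c R"
    and f: "f \<in> spheroids i (top_of_set U) c"
begin

text \<open>The lift \<open>g\<close> of \<open>f\<close> through \<open>h\<close>; the last clause replaces the statement that \<open>h\<close> restricts to a covering of \<open>U\<close>.\<close>

definition uniformizing :: "(complex \<Rightarrow> complex) \<Rightarrow> ((nat \<Rightarrow> real) \<Rightarrow> complex) \<Rightarrow> bool" where
  "uniformizing h g \<longleftrightarrow> h holomorphic_on ball 0 1 \<and> h 0 = c \<and>
     g \<in> spheroids i (top_of_set (ball 0 1)) 0 \<and> (\<forall>t\<in>topspace (cube i). h (g t) = f t) \<and>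
     (\<forall>C r t0. connectedin (cube i) C \<longrightarrow> t0 \<in> C \<longrightarrow> r > 0 \<longrightarrow> ball (f t0) r \<subseteq> U \<longrightarrow> f ` C \<subseteq> ball (f t0) r \<longrightarrow>
        (\<exists>L. L holomorphic_on ball (f t0) r \<and> L ` ball (f t0) r \<subseteq> ball 0 1 \<and>
          (\<forall>z\<in>ball (f t0) r. h (L z) = z) \<and> (\<forall>t\<in>C. L (f t) = g t)))"

lemma uniformizing_section:
  assumes "uniformizing h g" "connectedin (cube i) C" "t0 \<in> C" "r > 0" "ball (f t0) r \<subseteq> U" "f ` C \<subseteq> ball (f t0) r"
  obtains L where "L holomorphic_on ball (f t0) r" "\<And>z. z \<in> ball (f t0) r \<Longrightarrow> L z \<in> ball 0 1"
    "\<And>z. z \<in> ball (f t0) r \<Longrightarrow> h (L z) = z" "\<And>t. t \<in> C \<Longrightarrow> L (f t) = g t"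
proof -
  have "\<exists>L. L holomorphic_on ball (f t0) r \<and> L ` ball (f t0) r \<subseteq> ball 0 1 \<and>
          (\<forall>z\<in>ball (f t0) r. h (L z) = z) \<and> (\<forall>t\<in>C. L (f t) = g t)"
    using assms(1)[unfolded uniformizing_def, THEN conjunct2, THEN conjunct2, THEN conjunct2, THEN conjunct2,
        rule_format, OF assms(2-)] .
  then show thesis using that by blast
qed

lemma continuous_f: "continuous_map (cube i) euclidean f"
  and f_in_U: "t \<in> topspace (cube i) \<Longrightarrow> f t \<in> U"
  and f_boundary: "t \<in> cube_boundary i \<Longrightarrow> f t = c"
  using f continuous_map_image_subset_topspace[of "cube i" "top_of_set U" f]
  by (auto simp: spheroids_def continuous_map_in_subtopology)

lemma c_in_U: "c \<in> U"
  using f_boundary[OF cube_origin_boundary] f_in_U[OF cube_origin] i by simp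

lemma R_pos: "R > 0"
  using c_in_U bounded_U by (meson mem_ball less_le_trans not_le subset_iff zero_le_dist le_less_trans)

text \<open>A first competitor for the extremal problem. It exists because \<open>U\<close> is
  bounded: the affine map takes the unit disc onto \<open>ball c R\<close>.\<close>

lemma uniformizing_affine: "uniformizing (\<lambda>w. c + of_real R * w) (\<lambda>t. (f t - c) / of_real R)"
proof -
  have in_disc: "(z - c) / of_real R \<in> ball 0 1" if "z \<in> U" for z
  proof -
    have "norm (z - c) < R" using that bounded_U by (auto simp: dist_norm norm_minus_commute)
    then show ?thesis using R_pos by (simp add: norm_divide)
  qed
  have cont: "continuous_map (cube i) euclidean (\<lambda>t. (f t - c) / of_real R)"
    using R_pos by (intro continuous_map_continuous_on_UNIV_compose[OF continuous_f] continuous_intros) auto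
  have "(\<lambda>t. (f t - c) / of_real R) \<in> spheroids i (top_of_set (ball 0 1)) 0"
    unfolding spheroids_def using cont in_disc f_in_U f_boundary
    by (auto intro!: continuous_map_into_subtopology simp del: mem_ball)
  moreover have "\<exists>L. L holomorphic_on ball (f t0) r \<and> L ` ball (f t0) r \<subseteq> ball 0 1 \<and>
          (\<forall>z\<in>ball (f t0) r. c + of_real R * (L z) = z) \<and> (\<forall>t\<in>C. L (f t) = (f t - c) / of_real R)"
    if "ball (f t0) r \<subseteq> U" for t0 r C
    using that in_disc R_pos
    by (intro exI[of _ "\<lambda>z. (z - c) / of_real R"] conjI) (auto intro!: holomorphic_intros simp del: mem_ball)
  ultimately show ?thesis
    unfolding uniformizing_def using R_pos by (auto intro!: holomorphic_intros)
qed

text \<open>As \<open>h a\<close> lies outside \<open>U\<close> while \<open>h (g t) = f t\<close>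
  lies inside, \<open>g\<close> avoids \<open>a\<close>. So
  \<open>Moebius_function 0 a (g t)\<close> never vanishes and has a continuous square root, which
  lifts \<open>g\<close> through Koebe's map. Local sections \<open>L\<close> of \<open>h\<close>
  over balls in \<open>U\<close> avoid \<open>a\<close> for the same reason and are lifted by
  holomorphic roots.\<close>

lemma uniformizing_step:
  assumes hg: "uniformizing h g" and a: "norm a < 1" "h a \<notin> U"
  obtains b g' where "b\<^sup>2 = - a" "uniformizing (h \<circ> koebe_map a b) g'"
proof -
  have h: "h holomorphic_on ball 0 1" "h 0 = c" and g: "g \<in> spheroids i (top_of_set (ball 0 1)) 0"
    and hgf: "\<And>t. t \<in> topspace (cube i) \<Longrightarrow> h (g t) = f t"
    using hg unfolding uniformizing_def by blast+
  have gc: "continuous_map (cube i) (top_of_set (ball 0 1)) g" and g0: "\<And>t. t \<in> cube_boundary i \<Longrightarrow> g t = 0"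
    using g by (auto simp: spheroids_def)
  have g_disc: "g t \<in> ball 0 1" if "t \<in> topspace (cube i)" for t
    using continuous_map_image_subset_topspace[OF gc] that by auto
  let ?F = "\<lambda>t. Moebius_function 0 a (g t)"
  have Fc: "continuous_map (cube i) euclidean ?F"
    using continuous_map_continuous_on_compose[OF gc continuous_on_moebius[OF a(1)]] .
  have F_nz: "?F t \<noteq> 0" if "t \<in> topspace (cube i)" for t
    using moebius_eq_0_iff[OF a(1), of "g t"] g_disc[OF that] hgf[OF that] f_in_U[OF that] a(2) by auto
  have "?F \<in> spheroids i (top_of_set (- {0})) (- a)"
    unfolding spheroids_def using Fc F_nz g0 by (auto intro!: continuous_map_into_subtopology simp: Moebius_function_of_zero)
  then obtain b s where b: "b\<^sup>2 = - a" and s: "s \<in> spheroids i (top_of_set (- {0})) b"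
    and s2: "\<And>t. t \<in> topspace (cube i) \<Longrightarrow> (s t)\<^sup>2 = ?F t"
    using sqrt_spheroid[OF i] by metis
  have sc: "continuous_map (cube i) euclidean s"
    using s by (auto simp: spheroids_def continuous_map_in_subtopology)
  note b1 = koebe_norm_b(1)[OF a(1) b]
  have s_disc: "s t \<in> ball 0 1" if "t \<in> topspace (cube i)" for t
  proof -
    have "norm ((s t)\<^sup>2) < 1" using moebius_in_disc[OF a(1) g_disc[OF that]] s2[OF that] by simp
    then show ?thesis by (simp add: norm_power power_less_one_iff)
  qed
  let ?g' = "\<lambda>t. Moebius_function 0 b (s t)"
  let ?h' = "h \<circ> koebe_map a b"
  have "continuous_map (cube i) (top_of_set (ball 0 1)) s"
    using sc s_disc by (auto intro!: continuous_map_into_subtopology simp del: mem_ball)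
  from continuous_map_continuous_on_compose[OF this continuous_on_moebius[OF b1]]
  have "continuous_map (cube i) euclidean ?g'" .
  then have "continuous_map (cube i) (top_of_set (ball 0 1)) ?g'"
    using moebius_in_disc[OF b1 s_disc] by (auto intro!: continuous_map_into_subtopology simp del: mem_ball)
  moreover have "?g' t = 0" if "t \<in> cube_boundary i" for t
    using s that by (simp add: spheroids_def Moebius_function_eq_zero)
  ultimately have g': "?g' \<in> spheroids i (top_of_set (ball 0 1)) 0"
    by (simp add: spheroids_def)
  have km: "koebe_map a b (Moebius_function 0 b w) = z" if "w\<^sup>2 = Moebius_function 0 a z" "z \<in> ball 0 1" for w z
  proof (rule koebe_map_moebius[OF a(1) b _ _ that(1)])
    have "norm (w\<^sup>2) < 1" using moebius_in_disc[OF a(1) that(2)] that(1) by simp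
    then show "norm w < 1" by (simp add: norm_power power_less_one_iff)
  qed (use that in simp)
  have sec: "\<exists>L. L holomorphic_on ball (f t0) r \<and> L ` ball (f t0) r \<subseteq> ball 0 1 \<and>
          (\<forall>z\<in>ball (f t0) r. ?h' (L z) = z) \<and> (\<forall>t\<in>C. L (f t) = ?g' t)"
    if C: "connectedin (cube i) C" "t0 \<in> C" and r: "r > 0" "ball (f t0) r \<subseteq> U" "f ` C \<subseteq> ball (f t0) r" for C r t0
  proof -
    obtain L where L: "L holomorphic_on ball (f t0) r" "\<And>z. z \<in> ball (f t0) r \<Longrightarrow> L z \<in> ball 0 1"
      "\<And>z. z \<in> ball (f t0) r \<Longrightarrow> h (L z) = z" "\<And>t. t \<in> C \<Longrightarrow> L (f t) = g t"
      using uniformizing_section[OF hg C r] by metis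
    let ?M = "\<lambda>z. Moebius_function 0 a (L z)"
    have "?M holomorphic_on ball (f t0) r"
      using L(1,2) a(1) by (rule holomorphic_on_moebius_compose)
    moreover have M_nz: "?M z \<noteq> 0" if "z \<in> ball (f t0) r" for z
      using moebius_eq_0_iff[OF a(1), of "L z"] L(2,3)[OF that] that r(2) a(2) by auto
    ultimately obtain \<sigma> where \<sigma>: "\<sigma> holomorphic_on ball (f t0) r" "\<And>z. z \<in> ball (f t0) r \<Longrightarrow> ?M z = (\<sigma> z)\<^sup>2"
      using contractible_imp_holomorphic_sqrt[of ?M "ball (f t0) r"] convex_imp_contractible[OF convex_ball] by metis
    have Csub: "C \<subseteq> topspace (cube i)" using C(1) connectedin_subset_topspace by blast
    have t0: "f t0 \<in> ball (f t0) r" using r(1) by simp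
    \<comment> \<open>The holomorphic root on the ball is matched with \<open>s\<close> at
      \<open>t0\<close> by a choice of sign. Connectedness of \<open>C\<close> then propagates the
      agreement to all of \<open>C\<close>.\<close>
    have "(\<sigma> (f t0))\<^sup>2 = (s t0)\<^sup>2"
      using \<sigma>(2)[OF t0] s2 L(4) C Csub by auto
    then have "\<exists>\<tau>. \<tau> holomorphic_on ball (f t0) r \<and> (\<forall>z\<in>ball (f t0) r. ?M z = (\<tau> z)\<^sup>2) \<and> \<tau> (f t0) = s t0"
      unfolding power2_eq_iff
    proof
      assume "\<sigma> (f t0) = s t0" then show ?thesis using \<sigma> by blast
    next
      assume "\<sigma> (f t0) = - s t0" then show ?thesis
        using \<sigma> by (intro exI[of _ "\<lambda>z. - \<sigma> z"]) (auto intro!: holomorphic_intros)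
    qed
    then obtain \<tau> where \<tau>: "\<tau> holomorphic_on ball (f t0) r" "\<And>z. z \<in> ball (f t0) r \<Longrightarrow> (\<tau> z)\<^sup>2 = ?M z" "\<tau> (f t0) = s t0"
      by metis
    have \<tau>_disc: "\<tau> z \<in> ball 0 1" if "z \<in> ball (f t0) r" for z
    proof -
      have "norm ((\<tau> z)\<^sup>2) < 1" using moebius_in_disc[OF a(1) L(2)[OF that]] \<tau>(2)[OF that] by simp
      then show ?thesis by (simp add: norm_power power_less_one_iff)
    qed
    have fC: "f t \<in> ball (f t0) r" if "t \<in> C" for t using r(3) that by blast
    have conn: "connectedin (subtopology (cube i) C) C"
      using C(1) by (simp add: connectedin_subtopology)
    have "\<tau> (f t) = s t" if t: "t \<in> C" for t
    proof (rule sqrt_unique_on_connected[OF conn])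
      have "continuous_map (subtopology (cube i) C) (top_of_set (ball (f t0) r)) f"
        by (intro continuous_map_into_subtopology continuous_map_from_subtopology[OF continuous_f]) (use fC in simp)
      from continuous_map_continuous_on_compose[OF this holomorphic_on_imp_continuous_on[OF \<tau>(1)]]
      show "continuous_map (subtopology (cube i) C) euclidean (\<lambda>t. \<tau> (f t))" .
      show "continuous_map (subtopology (cube i) C) euclidean s"
        using sc by (rule continuous_map_from_subtopology)
      show "(\<tau> (f t))\<^sup>2 = (s t)\<^sup>2" if "t \<in> C" for t
        using \<tau>(2)[OF fC[OF that]] s2 L(4)[OF that] Csub that by auto
      show "\<tau> (f t) \<noteq> 0" if "t \<in> C" for t
        using \<tau>(2)[OF fC[OF that]] M_nz[OF fC[OF that]] by auto
    qed (use C \<tau>(3) t in auto)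
    then have "\<forall>t\<in>C. Moebius_function 0 b (\<tau> (f t)) = ?g' t" by simp
    moreover have "(\<lambda>z. Moebius_function 0 b (\<tau> z)) holomorphic_on ball (f t0) r"
      using \<tau>(1) \<tau>_disc b1 by (rule holomorphic_on_moebius_compose)
    moreover have "(\<lambda>z. Moebius_function 0 b (\<tau> z)) ` ball (f t0) r \<subseteq> ball 0 1"
      using moebius_in_disc[OF b1 \<tau>_disc] by blast
    moreover have "\<forall>z\<in>ball (f t0) r. ?h' (Moebius_function 0 b (\<tau> z)) = z"
      using km[OF \<tau>(2) L(2)] L(3) by simp
    ultimately show ?thesis by (intro exI[of _ "\<lambda>z. Moebius_function 0 b (\<tau> z)"]) blast
  qed
  have "?h' holomorphic_on ball 0 1"
    using holomorphic_on_compose_gen[OF koebe_map_holomorphic[OF a(1) b] h(1)] koebe_map_in_disc[OF a(1) b] by blast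
  moreover have "?h' 0 = c" using koebe_map_0[OF a(1) b] h(2) by simp
  moreover have "?h' (?g' t) = f t" if "t \<in> topspace (cube i)" for t
    using km[OF s2[OF that] g_disc[OF that]] hgf[OF that] by simp
  ultimately have "uniformizing ?h' ?g'"
    unfolding uniformizing_def using g' sec by blast
  then show thesis using that b by blast
qed

lemma ball_radius:
  obtains r where "r > 0" "\<And>t. t \<in> topspace (cube i) \<Longrightarrow> ball (f t) r \<subseteq> U"
proof -
  have "compact (f ` topspace (cube i))"
    using image_compactin[OF _ continuous_f, of "topspace (cube i)"] compact_space_cube
    by (simp add: compact_space_def)
  moreover have "f ` topspace (cube i) \<subseteq> U" using f_in_U by blast
  ultimately obtain r where "r > 0" "(\<Union>x\<in>f ` topspace (cube i). ball x r) \<subseteq> U"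
    using compact_subset_open_imp_ball_epsilon_subset[OF _ open_U] by metis
  then show thesis using that by blast
qed

lemma connectedin_cube_segment:
  assumes t: "t \<in> topspace (cube i)" and ab: "0 \<le> a" "b \<le> 1"
  shows "connectedin (cube i) ((\<lambda>s. cube_scale i s t) ` {a..b})"
proof (rule connectedin_continuous_map_image)
  have "continuous_map (top_of_set {a..b}) (prod_topology unit_interval (cube i)) (\<lambda>s. (s, t))"
    using ab t by (intro continuous_map_pairedI continuous_map_into_subtopology) auto
  from continuous_map_compose[OF this continuous_map_cube_scale]
  show "continuous_map (top_of_set {a..b}) (cube i) (\<lambda>s. cube_scale i s t)"
    by (simp add: o_def)
  show "connectedin (top_of_set {a..b}) {a..b}"
    by (simp add: connectedin_subtopology)
qed

text \<open>The bound spreads along the segments from the origin of the cube, where every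
  \<open>g\<close> vanishes. While \<open>f\<close> moves by less than half the radius
  \<open>r\<close> of balls contained in \<open>U\<close>, a section over such a ball moves
  \<open>g\<close> by a pseudo-hyperbolic distance of at most 1/2. The step length depends on
  \<open>f\<close> alone, so the bound is common to all \<open>h\<close> and
  \<open>g\<close>.\<close>

lemma uniformizing_bounded:
  obtains \<rho> where "0 \<le> \<rho>" "\<rho> < 1" "\<And>h g t. uniformizing h g \<Longrightarrow> t \<in> topspace (cube i) \<Longrightarrow> norm (g t) \<le> \<rho>"
proof -
  obtain r where r: "r > 0" "\<And>t. t \<in> topspace (cube i) \<Longrightarrow> ball (f t) r \<subseteq> U"
    using ball_radius by blast
  let ?sc = "cube_scale i"
  have sc_in: "?sc s t \<in> topspace (cube i)" if "s \<in> {0..1}" "t \<in> topspace (cube i)" for s t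
    using that by (simp add: cube_scale_def topspace_cube PiE_iff mult_le_one extensional_def)
  define bd where "bd s \<rho> \<longleftrightarrow> 0 \<le> \<rho> \<and> \<rho> < 1 \<and>
      (\<forall>h g. \<forall>t\<in>topspace (cube i). uniformizing h g \<longrightarrow> norm (g (?sc s t)) \<le> \<rho>)" for s \<rho>
  define P where "P a b \<longleftrightarrow> (0 \<le> a \<and> a \<le> b \<and> b \<le> 1 \<longrightarrow> (\<exists>\<rho>. bd a \<rho>) \<longrightarrow> (\<exists>\<rho>. bd b \<rho>))" for a b
  have "(0::real) \<le> 1" by simp
  then have "P 0 1"
  proof (induction rule: Bolzano[where P=P])
    case (trans a b c)
    then show ?case unfolding P_def by auto
  next
    case (local x)
    have \<Phi>: "continuous_map (prod_topology unit_interval (cube i)) euclidean (\<lambda>x. f (?sc (fst x) (snd x)))"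
      using continuous_map_compose[OF continuous_map_cube_scale continuous_f] by (simp add: o_def)
    \<comment> \<open>Moving by less than \<open>r / 2\<close> keeps \<open>f\<close> in the ball of
      radius \<open>r\<close> about the starting value and yields the ratio 1/2 in the Schwarz-Pick
      estimate.\<close>
    obtain d where d: "d > 0" "\<And>s s' t. s \<in> {0..1} \<Longrightarrow> s' \<in> {0..1} \<Longrightarrow> \<bar>s - x\<bar> < d \<Longrightarrow> \<bar>s' - x\<bar> < d \<Longrightarrow>
       t \<in> topspace (cube i) \<Longrightarrow> dist (f (?sc s t)) (f (?sc s' t)) < r / 2"
      using homotopy_uniformly_close[OF compact_space_cube \<Phi>, of x "r / 2"] local r(1) by auto
    show ?case
    proof (intro exI conjI allI impI)
      show "d > 0" by fact
      fix a b assume ab: "a \<le> x \<and> x \<le> b \<and> b - a < d"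
      show "P a b" unfolding P_def
      proof (intro impI)
        assume bds: "0 \<le> a \<and> a \<le> b \<and> b \<le> 1" and "\<exists>\<rho>. bd a \<rho>"
        then obtain \<rho> where \<rho>: "bd a \<rho>" by blast
        let ?\<rho>' = "sqrt (1 - (1 - \<rho>\<^sup>2) / 8)"
        have \<rho>2: "0 \<le> \<rho>\<^sup>2" "\<rho>\<^sup>2 < 1" using \<rho> by (auto simp: bd_def power_less_one_iff)
        have "norm (g (?sc b t)) \<le> ?\<rho>'" if hg: "uniformizing h g" and t: "t \<in> topspace (cube i)" for h g t
        proof -
          let ?C = "(\<lambda>s. ?sc s t) ` {a..b}"
          have t0: "?sc a t \<in> ?C" using bds by auto
          have close: "dist (f (?sc a t)) (f (?sc s t)) < r / 2" if "s \<in> {a..b}" for s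
            using ab bds that t by (intro d(2)) auto
          have sub: "f ` ?C \<subseteq> ball (f (?sc a t)) r"
            using close r(1) by fastforce
          have ballU: "ball (f (?sc a t)) r \<subseteq> U" using r(2) sc_in t bds by auto
          have conn: "connectedin (cube i) ?C" using connectedin_cube_segment t bds by blast
          obtain L where L: "L holomorphic_on ball (f (?sc a t)) r" "\<And>z. z \<in> ball (f (?sc a t)) r \<Longrightarrow> L z \<in> ball 0 1"
            "\<And>t'. t' \<in> ?C \<Longrightarrow> L (f t') = g t'"
            using uniformizing_section[OF hg conn t0 r(1) ballU sub] by metis
          have fb: "f (?sc b t) \<in> ball (f (?sc a t)) r" using close[of b] r(1) bds by auto
          have "norm (Moebius_function 0 (L (f (?sc a t))) (L (f (?sc b t)))) \<le> norm (f (?sc b t) - f (?sc a t)) / r"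
            by (rule Schwarz_Pick_center[OF L(1) _ r(1) fb]) (use L(2) in simp)
          also have "\<dots> \<le> (r / 2) / r"
            using close[of b] bds r(1) by (intro divide_right_mono) (auto simp: dist_norm norm_minus_commute)
          also have "\<dots> = 1/2" using r(1) by simp
          finally have "norm (Moebius_function 0 (g (?sc a t)) (g (?sc b t))) \<le> 1/2"
            using L(3)[OF t0] L(3)[of "?sc b t"] bds by auto
          moreover have "norm (g (?sc a t)) \<le> \<rho>" "\<rho> < 1" using \<rho> hg t by (auto simp: bd_def)
          moreover have "norm (g (?sc b t)) < 1"
            using L(2)[OF fb] L(3)[of "?sc b t"] bds by auto
          ultimately show ?thesis using norm_bound_of_moebius by blast
        qed
        moreover have "0 \<le> 1 - (1 - x) / 8 \<and> 1 - (1 - x) / 8 < 1" if "0 \<le> x" "x < 1" for x :: real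
          using that by auto
        from this[OF \<rho>2] have "0 \<le> 1 - (1 - \<rho>\<^sup>2) / 8" "1 - (1 - \<rho>\<^sup>2) / 8 < 1" by blast+
        then have "0 \<le> ?\<rho>'" "?\<rho>' < 1" by (simp_all only: real_sqrt_ge_zero real_sqrt_lt_1_iff)
        ultimately have "bd b ?\<rho>'" unfolding bd_def by blast
        then show "\<exists>\<rho>. bd b \<rho>" by blast
      qed
    qed
  qed
  moreover have "bd 0 0"
    unfolding bd_def uniformizing_def spheroids_def
    using cube_origin_boundary[of i] i by (auto simp: cube_scale_0)
  ultimately obtain \<rho> where "bd 1 \<rho>" unfolding P_def by auto
  then show thesis
    using that[of \<rho>] unfolding bd_def by (auto simp: cube_scale_1)
qed

text \<open>A section of \<open>h\<close> over a ball of radius \<open>r\<close> about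
  \<open>c\<close> takes \<open>c\<close> to 0. Its derivative at \<open>c\<close> has norm at most
  \<open>1 / r\<close> by the Schwarz lemma and is inverse to \<open>deriv h 0\<close>, so
  \<open>m = r\<close> works.\<close>

lemma uniformizing_deriv_ge:
  obtains m where "m > 0" "\<And>h g. uniformizing h g \<Longrightarrow> m \<le> norm (deriv h 0)"
proof -
  obtain r where r: "r > 0" "\<And>t. t \<in> topspace (cube i) \<Longrightarrow> ball (f t) r \<subseteq> U"
    using ball_radius by blast
  let ?o = "cube_origin i"
  have o: "?o \<in> cube_boundary i" "?o \<in> topspace (cube i)"
    using cube_origin_boundary[of i] i cube_origin[of i] by auto
  have fo: "f ?o = c" using f_boundary[OF o(1)] .
  have "r \<le> norm (deriv h 0)" if hg: "uniformizing h g" for h g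
  proof -
    have conn: "connectedin (cube i) {?o}" using o(2) by (simp add: connectedin_sing)
    have sub: "f ` {?o} \<subseteq> ball (f ?o) r" using r(1) by simp
    obtain L where L0: "L holomorphic_on ball (f ?o) r" "\<And>z. z \<in> ball (f ?o) r \<Longrightarrow> L z \<in> ball 0 1"
      "\<And>z. z \<in> ball (f ?o) r \<Longrightarrow> h (L z) = z" "\<And>t. t \<in> {?o} \<Longrightarrow> L (f t) = g t"
      using uniformizing_section[OF hg conn singletonI r(1) r(2)[OF o(2)] sub] by blast
    note L = L0(1-3)[unfolded fo] L0(4)[OF singletonI, unfolded fo]
    have h: "h holomorphic_on ball 0 1" and g0: "g ?o = 0"
      using hg o unfolding uniformizing_def spheroids_def by auto
    have Lc: "L c = 0" using L(4) g0 by simp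
    have "(L has_field_derivative deriv L c) (at c)"
      using L(1) r by (intro holomorphic_derivI[of _ "ball c r"]) auto
    moreover have "(h has_field_derivative deriv h 0) (at (L c))"
      unfolding Lc using h by (intro holomorphic_derivI[of _ "ball 0 1"]) auto
    ultimately have "((\<lambda>z. h (L z)) has_field_derivative deriv h 0 * deriv L c) (at c)"
      by (intro DERIV_chain2)
    moreover have "((\<lambda>z. z) has_field_derivative 1) (at c)" by simp
    then have "((\<lambda>z. h (L z)) has_field_derivative 1) (at c)"
      by (rule has_field_derivative_transform_within_open[of _ _ _ "ball c r"]) (use r(1) L(3) in auto)
    ultimately have "deriv h 0 * deriv L c = 1" by (rule DERIV_unique)
    then have "norm (deriv h 0) * norm (deriv L c) = 1" by (metis norm_mult norm_one)
    moreover have "norm (deriv L c) \<le> 1 / r"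
      by (rule norm_deriv_le_of_disc_map[OF L(1) _ Lc r(1)]) (use L(2) in simp)
    ultimately have "1 \<le> norm (deriv h 0) * (1 / r)"
      by (metis mult_left_mono norm_ge_zero)
    then show ?thesis using r(1) by (simp add: field_simps)
  qed
  then show thesis using that r(1) by blast
qed

text \<open>If \<open>h\<close> nearly minimizes \<open>norm (deriv h 0)\<close>, no \<open>a\<close> with \<open>norm a \<le> \<rho>\<close> and \<open>h a \<notin> U\<close> exists, because composing
  with \<^const>\<open>koebe_map\<close> would shrink the derivative by a factor that depends only on \<open>\<rho>\<close>.\<close>

lemma uniformizing_covers:
  assumes "\<rho> < 1"
  obtains h g where "uniformizing h g" "\<And>a. norm a \<le> \<rho> \<Longrightarrow> h a \<in> U"
proof -
  note found = that
  obtain m where m: "m > 0" "\<And>h g. uniformizing h g \<Longrightarrow> m \<le> norm (deriv h 0)"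
    using uniformizing_deriv_ge by blast
  define S where "S = {norm (deriv h 0) | h. \<exists>g. uniformizing h g}"
  have S: "S \<noteq> {}" "bdd_below S" using uniformizing_affine m(2) unfolding S_def by (blast, intro bdd_belowI[of _ m], blast)
  have "m \<le> Inf S" using S(1) m(2) by (intro cInf_greatest) (auto simp: S_def)
  show thesis
  proof (rule ccontr)
    assume no: "\<not> thesis"
    define k where "k = 1 - (1 - sqrt \<rho>)\<^sup>2 / 2"
    have k: "k < 1" using assms by (simp add: k_def)
    have dec: "\<exists>h' g'. uniformizing h' g' \<and> norm (deriv h' 0) \<le> norm (deriv h 0) * k" if hg: "uniformizing h g" for h g
    proof -
      obtain a where a: "norm a \<le> \<rho>" "h a \<notin> U" using no found[OF hg] by blast
      have a1: "norm a < 1" using a assms by simp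
      obtain b g' where b: "b\<^sup>2 = - a" and g': "uniformizing (h \<circ> koebe_map a b) g'"
        using uniformizing_step[OF hg a1 a(2)] by blast
      have h: "h holomorphic_on ball 0 1" using hg unfolding uniformizing_def by blast
      have k0: "koebe_map a b 0 = 0" using koebe_map_0[OF a1 b] .
      have "deriv (h \<circ> koebe_map a b) 0 = deriv h (koebe_map a b 0) * deriv (koebe_map a b) 0"
      proof (rule deriv_chain)
        show "koebe_map a b field_differentiable at 0"
          using koebe_map_deriv[OF a1 b] field_differentiable_def by blast
        show "h field_differentiable at (koebe_map a b 0)"
          unfolding k0 using h holomorphic_on_imp_differentiable_at[OF h, of 0] by simp
      qed
      then have "norm (deriv (h \<circ> koebe_map a b) 0) = norm (deriv h 0) * norm (deriv (koebe_map a b) 0)"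
        by (simp add: k0 norm_mult)
      also have "\<dots> \<le> norm (deriv h 0) * k"
        unfolding k_def using koebe_map_deriv_norm[OF a1 b a(1) assms] by (intro mult_left_mono) auto
      finally show ?thesis using g' by blast
    qed
    \<comment> \<open>For negative \<open>\<rho>\<close> the formula alone does not make
      \<open>k\<close> positive. Positivity is read off from a competitor whose derivative has been
      multiplied by at most \<open>k\<close> and is still nonzero.\<close>
    have k0: "k > 0"
    proof -
      obtain h g where hg: "uniformizing h g" using uniformizing_affine by blast
      obtain h' g' where "uniformizing h' g'" "norm (deriv h' 0) \<le> norm (deriv h 0) * k"
        using dec[OF hg] by blast
      then have "0 < norm (deriv h 0) * k" using m by (meson less_le_trans)
      then show ?thesis by (simp add: zero_less_mult_iff)
    qed
    \<comment> \<open>The infimum may fail to be attained, but a derivative below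
      \<open>Inf S / k\<close> is enough: one more Koebe step takes it below
      \<open>Inf S\<close>.\<close>
    have "Inf S < Inf S / k" using k k0 \<open>m \<le> Inf S\<close> m(1) by (simp add: field_simps)
    then obtain h g where hg: "uniformizing h g" "norm (deriv h 0) < Inf S / k"
      using cInf_lessD[OF S(1)] unfolding S_def by blast
    obtain h' g' where h': "uniformizing h' g'" "norm (deriv h' 0) \<le> norm (deriv h 0) * k"
      using dec[OF hg(1)] by blast
    have "Inf S \<le> norm (deriv h' 0)" using h'(1) by (intro cInf_lower S(2)) (auto simp: S_def)
    also have "\<dots> < Inf S" using h'(2) hg(2) k0 by (simp add: field_simps)
    finally show False by simp
  qed
qed

lemma null_homotopic_bounded: "homotopic_spheroids i (top_of_set U) c f (\<lambda>_. c)"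
proof -
  obtain \<rho> where \<rho>: "0 \<le> \<rho>" "\<rho> < 1" "\<And>h g t. uniformizing h g \<Longrightarrow> t \<in> topspace (cube i) \<Longrightarrow> norm (g t) \<le> \<rho>"
    using uniformizing_bounded by blast
  obtain h g where hg: "uniformizing h g" "\<And>a. norm a \<le> \<rho> \<Longrightarrow> h a \<in> U"
    using uniformizing_covers[OF \<rho>(2)] by blast
  have h: "h holomorphic_on ball 0 1" "h 0 = c" and g: "g \<in> spheroids i (top_of_set (ball 0 1)) 0"
    and hgf: "\<And>t. t \<in> topspace (cube i) \<Longrightarrow> h (g t) = f t"
    using hg(1) unfolding uniformizing_def by blast+
  have gc: "continuous_map (cube i) euclidean g" and g0: "\<And>t. t \<in> cube_boundary i \<Longrightarrow> g t = 0"
    using g by (auto simp: spheroids_def continuous_map_in_subtopology)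
  let ?Z = "prod_topology unit_interval (cube i)"
  have small: "norm ((1 - of_real s) * g t) \<le> \<rho>" if "s \<in> {0..1}" "t \<in> topspace (cube i)" for s t
  proof -
    have "norm ((1 - of_real s) * g t) = (1 - s) * norm (g t)"
    proof -
      have "(1 :: complex) - of_real s = of_real (1 - s)" by simp
      then show ?thesis using that by (simp only: norm_mult norm_of_real) simp
    qed
    also have "\<dots> \<le> 1 * norm (g t)" using that by (intro mult_right_mono) auto
    finally show ?thesis using \<rho>(3)[OF hg(1) that(2)] by simp
  qed
  have "continuous_map ?Z euclidean (\<lambda>x. (1 - of_real (fst x)) * g (snd x))"
    using continuous_map_compose[OF continuous_map_snd gc, of unit_interval, unfolded o_def]
    by (intro continuous_map_mult continuous_map_diff continuous_map_complex_of_real continuous_map_fst_top_of_set) auto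
  then have "continuous_map ?Z (top_of_set (cball 0 \<rho>)) (\<lambda>x. (1 - of_real (fst x)) * g (snd x))"
    using small by (intro continuous_map_into_subtopology) auto
  moreover have "continuous_on (cball 0 \<rho>) h"
    by (rule continuous_on_subset[OF holomorphic_on_imp_continuous_on[OF h(1)]]) (use \<rho>(2) in auto)
  ultimately have "continuous_map ?Z euclidean (\<lambda>x. h ((1 - of_real (fst x)) * g (snd x)))"
    by (rule continuous_map_continuous_on_compose)
  then have "continuous_map ?Z (top_of_set U) (\<lambda>x. h ((1 - of_real (fst x)) * g (snd x)))"
    using hg(2) small by (intro continuous_map_into_subtopology) auto
  then show ?thesis
    unfolding homotopic_spheroids
    by (intro exI[of _ "\<lambda>x. h ((1 - of_real (fst x)) * g (snd x))"]) (simp add: hgf h(2) g0)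
qed

end

text \<open>The image of \<open>f\<close> is compact, so \<open>U\<close> can be cut down to its
  part in a large ball about \<open>c\<close>.\<close>

theorem planar_open_aspherical:
  assumes i: "i \<ge> 2" and U: "open U" and f: "f \<in> spheroids i (top_of_set (U :: complex set)) c"
  shows "homotopic_spheroids i (top_of_set U) c f (\<lambda>_. c)"
proof -
  have fc: "continuous_map (cube i) euclidean f" and fU: "f ` topspace (cube i) \<subseteq> U"
    and f0: "\<And>t. t \<in> cube_boundary i \<Longrightarrow> f t = c"
    using f by (auto simp: spheroids_def continuous_map_in_subtopology)
  have "compact (f ` topspace (cube i))"
    using image_compactin[OF _ fc, of "topspace (cube i)"] compact_space_cube
    by (simp add: compact_space_def)
  then obtain R where R: "f ` topspace (cube i) \<subseteq> ball c R"
    using bounded_subset_ballD compact_imp_bounded by blast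
  interpret planar_spheroid i "U \<inter> ball c R" c R f
  proof
    show "f \<in> spheroids i (top_of_set (U \<inter> ball c R)) c"
      using fc fU R f0 by (auto simp: spheroids_def intro!: continuous_map_into_subtopology simp del: mem_ball)
  qed (use i U in auto)
  have "continuous_map (top_of_set (U \<inter> ball c R)) (top_of_set U) id"
    by (intro continuous_map_into_subtopology) auto
  from homotopic_spheroids_compose[OF null_homotopic_bounded this]
  show ?thesis by (simp add: o_def)
qed

section \<open>Complements of moving points in the plane\<close>

locale moving_points =
  fixes B :: "'b topology" and J :: "'j set" and a :: "'j \<Rightarrow> 'b \<Rightarrow> complex"
  assumes finite_J: "finite J"
    and continuous_a: "\<And>j. j \<in> J \<Longrightarrow> continuous_map B euclidean (a j)"
    and distinct_a: "\<And>j k b. j \<in> J \<Longrightarrow> k \<in> J \<Longrightarrow> j \<noteq> k \<Longrightarrow> b \<in> topspace B \<Longrightarrow> a j b \<noteq> a k b"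
begin

definition complement_bundle :: "('b \<times> complex) topology" where
  "complement_bundle = subtopology (prod_topology B euclidean) {x. \<forall>j\<in>J. snd x \<noteq> a j (fst x)}"

text \<open>A continuous stand-in for a quarter of the minimal distance between punctures: the sum
  of the reciprocals dominates each single one. The summand 1 keeps the denominator positive when
  there are fewer than two punctures.\<close>

definition radius :: "'b \<Rightarrow> real" where
  "radius b = 1 / (4 * (1 + (\<Sum>j\<in>J. \<Sum>k\<in>J - {j}. 1 / norm (a j b - a k b))))"

text \<open>Every puncture drags the disc of the given radius around it along, and leaves the other discs fixed.\<close>

definition push :: "'b \<times> complex \<Rightarrow> 'b \<Rightarrow> complex" where
  "push e b = snd e + (\<Sum>j\<in>J. (a j b - a j (fst e)) * of_real (max 0 (1 - norm (snd e - a j (fst e)) / radius (fst e))))"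

definition close_pairs :: "('b \<times> 'b) set" where
  "close_pairs = {x \<in> topspace (prod_topology B B). radius (fst x) - (\<Sum>j\<in>J. norm (a j (snd x) - a j (fst x))) \<in> {0<..}}"

lemma radius_denominator_pos: "1 + (\<Sum>j\<in>J. \<Sum>k\<in>J - {j}. 1 / norm (a j b - a k b)) > 0"
  by (intro add_pos_nonneg sum_nonneg) auto

lemma radius_pos: "radius b > 0"
  using radius_denominator_pos[of b] by (simp add: radius_def)

lemma radius_le:
  assumes j: "j \<in> J" "k \<in> J" "j \<noteq> k" and b: "b \<in> topspace B"
  shows "4 * radius b \<le> norm (a j b - a k b)"
proof -
  let ?S = "\<Sum>j\<in>J. \<Sum>k\<in>J - {j}. 1 / norm (a j b - a k b)"
  have d: "norm (a j b - a k b) > 0" using distinct_a[OF j b] by simp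
  have "1 / norm (a j b - a k b) \<le> (\<Sum>k\<in>J - {j}. 1 / norm (a j b - a k b))"
    using j finite_J by (intro member_le_sum) auto
  also have "\<dots> \<le> ?S"
    using j finite_J by (intro member_le_sum[of j J "\<lambda>j. \<Sum>k\<in>J - {j}. 1 / norm (a j b - a k b)"] sum_nonneg) auto
  finally have "1 / norm (a j b - a k b) \<le> 1 + ?S" by simp
  then have "1 / (1 + ?S) \<le> norm (a j b - a k b)"
    using d radius_denominator_pos[of b] by (simp add: field_simps)
  moreover have "4 * (1 / (4 * x)) = 1 / x" for x :: real by simp
  then have "4 * radius b = 1 / (1 + ?S)" unfolding radius_def .
  ultimately show ?thesis by simp
qed

lemma continuous_radius: "continuous_map B euclideanreal radius"
  unfolding radius_def[abs_def]
proof (intro continuous_map_real_divide continuous_map_real_mult continuous_map_add continuous_map_sum continuous_map_norm continuous_map_diff)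
  fix b show "4 * (1 + (\<Sum>j\<in>J. \<Sum>k\<in>J - {j}. 1 / norm (a j b - a k b))) \<noteq> 0"
    using radius_denominator_pos[of b] by simp
qed (use finite_J continuous_a distinct_a in auto)

lemma close_pairsD:
  assumes "(b, b') \<in> close_pairs" "j \<in> J"
  shows "norm (a j b' - a j b) < radius b"
proof -
  have "norm (a j b' - a j b) \<le> (\<Sum>j\<in>J. norm (a j b' - a j b))"
    using assms(2) finite_J by (intro member_le_sum) auto
  then show ?thesis using assms(1) by (simp add: close_pairs_def)
qed

text \<open>Let \<open>r\<close> be the radius at \<open>b\<close>; every puncture moves by less
  than \<open>r\<close>. A point outside all discs stays put, too far from each old puncture to be
  reached. Otherwise \<open>z\<close> lies in exactly one disc, that of some \<open>j\<close>.
  Hitting the puncture \<open>j\<close> itself would force a motion of exactly \<open>r\<close>,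
  because the weight falls linearly from 1 at the centre to 0 at distance \<open>r\<close>. Hitting
  another puncture would bring the two old ones within \<open>3 * r\<close>, against the separation
  \<open>4 * r\<close>.\<close>

lemma push_avoids:
  assumes W: "(b, b') \<in> close_pairs" and z: "\<And>j. j \<in> J \<Longrightarrow> z \<noteq> a j b" and m: "m \<in> J"
  shows "push (b, z) b' \<noteq> a m b'"
proof
  assume eq: "push (b, z) b' = a m b'"
  have b: "b \<in> topspace B" using W by (simp add: close_pairs_def)
  let ?r = "radius b"
  have r: "?r > 0" by (rule radius_pos)
  let ?w = "\<lambda>j. max 0 (1 - norm (z - a j b) / ?r)"
  have w0: "?w j = 0" if "norm (z - a j b) \<ge> ?r" for j using that r by (simp add: field_simps)
  have dm: "norm (a m b' - a m b) < ?r" using close_pairsD[OF W m] .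
  show False
  proof (cases "\<exists>j\<in>J. norm (z - a j b) < ?r")
    case False
    then have "push (b, z) b' = z" using w0 unfolding push_def by (auto intro!: sum.neutral)
    then show False using False eq dm m by (metis norm_minus_commute)
  next
    case True
    then obtain j where j: "j \<in> J" "norm (z - a j b) < ?r" by blast
    have far: "norm (z - a k b) \<ge> ?r" if "k \<in> J" "k \<noteq> j" for k
    proof (rule ccontr)
      assume "\<not> norm (z - a k b) \<ge> ?r"
      then have "norm (a j b - a k b) < ?r + ?r"
        using j(2) norm_triangle_ineq4[of "z - a k b" "z - a j b"] by (simp add: algebra_simps)
      then show False using radius_le[OF j(1) that(1) _ b] that(2) r by auto
    qed
    have "(\<Sum>k\<in>J. (a k b' - a k b) * of_real (?w k)) = (a j b' - a j b) * of_real (?w j)"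
      using finite_J j(1) far w0 by (subst sum.remove[of J j]) (auto intro!: sum.neutral)
    then have push: "a m b' = z + (a j b' - a j b) * of_real (?w j)"
      using eq unfolding push_def by simp
    have w: "?w j = 1 - norm (z - a j b) / ?r" "0 \<le> ?w j" "?w j \<le> 1" using j(2) r by (auto simp: field_simps)
    show False
    proof (cases "j = m")
      case True
      have "z - a m b = (a m b' - a m b) * of_real (norm (z - a m b) / ?r)"
        using push[unfolded w(1), unfolded True] by (simp add: algebra_simps)
      then have "norm (z - a m b) = norm (a m b' - a m b) * (norm (z - a m b) / ?r)"
        using r by (metis norm_mult norm_of_real abs_of_nonneg divide_nonneg_pos norm_ge_zero)
      moreover have "norm (z - a m b) > 0" using z[OF m] by simp
      ultimately have "norm (a m b' - a m b) = ?r" using r by (simp add: field_simps)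
      then show False using dm by simp
    next
      case False
      have "norm ((a j b' - a j b) * of_real (?w j)) \<le> norm (a j b' - a j b) * 1"
        unfolding norm_mult norm_of_real abs_of_nonneg[OF w(2)] by (rule mult_left_mono[OF w(3) norm_ge_zero])
      then have 1: "norm ((a j b' - a j b) * of_real (?w j)) < ?r"
        using close_pairsD[OF W j(1)] by simp
      have eq_diff: "a m b - a j b = (z - a j b) + (a j b' - a j b) * of_real (?w j) - (a m b' - a m b)"
        unfolding push by simp
      have "norm (a m b - a j b) \<le> norm (z - a j b) + norm ((a j b' - a j b) * of_real (?w j)) + norm (a m b' - a m b)"
        unfolding eq_diff by (rule order_trans[OF norm_triangle_ineq4 add_right_mono[OF norm_triangle_ineq]])
      then have "norm (a m b - a j b) < 3 * ?r" using 1 j(2) dm by simp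
      then show False using radius_le[OF m j(1) _ b] False r by auto
    qed
  qed
qed

lemma continuous_snd_complement_bundle: "continuous_map complement_bundle euclidean snd"
  unfolding complement_bundle_def
  by (intro continuous_map_from_subtopology continuous_map_snd)

sublocale fibration: local_transport complement_bundle B fst close_pairs "\<lambda>e b. (b, push e b)"
proof
  show "continuous_map complement_bundle B fst"
    unfolding complement_bundle_def by (intro continuous_map_from_subtopology continuous_map_fst)
  have f: "continuous_map (prod_topology B B) B fst" and s: "continuous_map (prod_topology B B) B snd"
    by (intro continuous_map_fst continuous_map_snd)+
  have cont_a2: "continuous_map (prod_topology B B) euclidean (\<lambda>x. a j (fst x))"
    "continuous_map (prod_topology B B) euclidean (\<lambda>x. a j (snd x))" if "j \<in> J" for j
    using continuous_map_compose[OF f continuous_a[OF that]] continuous_map_compose[OF s continuous_a[OF that]]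
    by (simp_all add: o_def)
  show "openin (prod_topology B B) close_pairs"
    unfolding close_pairs_def
  proof (rule openin_continuous_map_preimage)
    show "continuous_map (prod_topology B B) euclideanreal (\<lambda>x. radius (fst x) - (\<Sum>j\<in>J. norm (a j (snd x) - a j (fst x))))"
      using continuous_map_compose[OF f continuous_radius, unfolded o_def] cont_a2 finite_J
      by (intro continuous_map_diff continuous_map_sum continuous_map_norm)
  qed simp
  show "(b, b) \<in> close_pairs" if "b \<in> topspace B" for b
    using that radius_pos by (simp add: close_pairs_def)
  show "(fst e, push e (fst e)) = e" for e
    by (simp add: push_def)
  let ?X = "subtopology (prod_topology complement_bundle B) {(e, b). (fst e, b) \<in> close_pairs}"
  have X: "continuous_map ?X B snd" "continuous_map ?X complement_bundle fst"
    by (intro continuous_map_from_subtopology continuous_map_snd continuous_map_fst)+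
  have X1: "continuous_map ?X B (\<lambda>x. fst (fst x))"
    using continuous_map_compose[OF X(2), of B fst] \<open>continuous_map complement_bundle B fst\<close> by (simp add: o_def)
  have X2: "continuous_map ?X euclidean (\<lambda>x. snd (fst x))"
    using continuous_map_compose[OF X(2), of euclidean snd] continuous_snd_complement_bundle by (simp add: o_def)
  have Xa: "continuous_map ?X euclidean (\<lambda>x. a j (snd x))" "continuous_map ?X euclidean (\<lambda>x. a j (fst (fst x)))" if "j \<in> J" for j
    using continuous_map_compose[OF X(1) continuous_a[OF that]] continuous_map_compose[OF X1 continuous_a[OF that]]
    by (simp_all add: o_def)
  have Xr: "continuous_map ?X euclidean (\<lambda>x. radius (fst (fst x)))"
    using continuous_map_compose[OF X1 continuous_radius] by (simp add: o_def)
  have rne: "radius b \<noteq> 0" for b using radius_pos[of b] by simp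
  have "continuous_map ?X euclidean (\<lambda>x. push (fst x) (snd x))"
    unfolding push_def
    by (intro continuous_map_add continuous_map_sum continuous_map_mult continuous_map_diff continuous_map_complex_of_real
         continuous_map_real_max continuous_map_real_divide continuous_map_norm X2 Xa Xr finite_J rne) auto
  then have "continuous_map ?X (prod_topology B euclidean) (\<lambda>x. (snd x, push (fst x) (snd x)))"
    using X(1) by (intro continuous_map_pairedI)
  then have "continuous_map ?X complement_bundle (\<lambda>x. (snd x, push (fst x) (snd x)))"
    unfolding complement_bundle_def by (intro continuous_map_into_subtopology) (auto dest: push_avoids)
  then show "continuous_map ?X complement_bundle (\<lambda>(e, b). (b, push e b))"
    by (simp add: case_prod_unfold)
qed auto

text \<open>A piece of the exact sequence of a fibration: lifting the contraction in the base
  deforms \<open>f\<close> into the fibre over \<open>b0\<close>, and this fibre is an open subset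
  of the plane.\<close>

lemma complement_bundle_null_homotopic:
  assumes i: "i \<ge> 2" and f: "f \<in> spheroids i complement_bundle (b0, z0)"
    and base: "homotopic_spheroids i B b0 (fst \<circ> f) (\<lambda>_. b0)"
  shows "homotopic_spheroids i complement_bundle (b0, z0) f (\<lambda>_. (b0, z0))"
proof -
  obtain g where 1: "homotopic_spheroids i complement_bundle (b0, z0) f g" and fst_g: "\<And>t. t \<in> topspace (cube i) \<Longrightarrow> fst (g t) = b0"
    using fibration.lift_spheroid_homotopy[OF f] base unfolding fst_conv by blast
  note g = homotopic_spheroids_imp_spheroids(2)[OF 1]
  then have gc: "continuous_map (cube i) complement_bundle g" by (simp add: spheroids_def)
  define w where "w t = snd (g t)" for t
  have g_eq: "g t = (b0, w t)" if "t \<in> topspace (cube i)" for t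
    using fst_g[OF that] by (simp add: prod_eq_iff w_def)
  have w_boundary: "w t = z0" if "t \<in> cube_boundary i" for t
    using g that by (simp add: spheroids_def w_def)
  let ?U = "- (\<lambda>j. a j b0) ` J"
  have "continuous_map (cube i) euclidean w"
    using continuous_map_compose[OF gc, of euclidean snd] continuous_snd_complement_bundle by (simp add: o_def w_def[abs_def])
  moreover have bundle_iff: "(b0, z) \<in> topspace complement_bundle \<longleftrightarrow> b0 \<in> topspace B \<and> z \<in> ?U" for z
    by (auto simp: complement_bundle_def)
  moreover have g_in: "g t \<in> topspace complement_bundle" if "t \<in> topspace (cube i)" for t
    using continuous_map_image_subset_topspace[OF gc] that by blast
  moreover have U_in: "w t \<in> ?U" if "t \<in> topspace (cube i)" for t
    using g_in[OF that] unfolding g_eq[OF that] bundle_iff by blast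
  ultimately have "w \<in> spheroids i (top_of_set ?U) z0"
    using w_boundary by (auto simp: spheroids_def intro!: continuous_map_into_subtopology)
  moreover have "open ?U" using finite_J by (simp add: finite_imp_closed open_Compl)
  ultimately have "homotopic_spheroids i (top_of_set ?U) z0 w (\<lambda>_. z0)"
    using planar_open_aspherical[OF i] by blast
  moreover have b0: "b0 \<in> topspace B"
    using g_in[OF cube_origin] unfolding g_eq[OF cube_origin] bundle_iff by blast
  have "continuous_map (top_of_set ?U) (prod_topology B euclidean) (\<lambda>z. (b0, z))"
    using b0 by (intro continuous_map_pairedI) auto
  then have "continuous_map (top_of_set ?U) complement_bundle (\<lambda>z. (b0, z))"
    unfolding complement_bundle_def by (intro continuous_map_into_subtopology) auto
  ultimately have 2: "homotopic_spheroids i complement_bundle (b0, z0) ((\<lambda>z. (b0, z)) \<circ> w) (\<lambda>_. (b0, z0))"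
    using homotopic_spheroids_compose[of i "top_of_set ?U" z0 w "\<lambda>_. z0" complement_bundle "\<lambda>z. (b0, z)"] by (simp add: o_def)
  have "homotopic_spheroids i complement_bundle (b0, z0) g ((\<lambda>z. (b0, z)) \<circ> w)"
    using g by (rule homotopic_spheroids_equal) (simp add: g_eq)
  from homotopic_spheroids_trans[OF 1 homotopic_spheroids_trans[OF this 2]] show ?thesis .
qed

end

section \<open>Planar configurations as an iterated bundle\<close>

text \<open>Stereographic coordinates of the configurations on the sphere whose first point is the pole at infinity
  and whose second point lies on the positive real half-line; antipodes are related by \<open>w = - 1 / cnj z\<close>.\<close>

definition planar_configurations :: "nat \<Rightarrow> (nat \<Rightarrow> complex) topology" where
  "planar_configurations n = subtopology (product_topology (\<lambda>_. euclidean) {1..<n})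
     {z. (\<exists>r>0. z 1 = of_real r) \<and> (\<forall>j\<in>{1..<n}. z j \<noteq> 0) \<and>
         (\<forall>j\<in>{1..<n}. \<forall>k\<in>{1..<n}. j \<noteq> k \<longrightarrow> z j \<noteq> z k \<and> z j * cnj (z k) \<noteq> -1)}"

lemma topspace_planar_configurations:
  "topspace (planar_configurations n) = {z \<in> extensional {1..<n}. (\<exists>r>0. z 1 = of_real r) \<and> (\<forall>j\<in>{1..<n}. z j \<noteq> 0) \<and>
         (\<forall>j\<in>{1..<n}. \<forall>k\<in>{1..<n}. j \<noteq> k \<longrightarrow> z j \<noteq> z k \<and> z j * cnj (z k) \<noteq> -1)}"
  by (auto simp: planar_configurations_def PiE_def)

lemma continuous_map_planar_configurations:
  "continuous_map X (planar_configurations n) f \<longleftrightarrow>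
     f \<in> topspace X \<rightarrow> topspace (planar_configurations n) \<and> (\<forall>j\<in>{1..<n}. continuous_map X euclidean (\<lambda>x. f x j))"
  unfolding topspace_planar_configurations unfolding planar_configurations_def continuous_map_in_subtopology continuous_map_componentwise
  by (auto simp: Pi_iff)

lemma continuous_map_planar_configurations_coordinate:
  "j \<in> {1..<n} \<Longrightarrow> continuous_map (planar_configurations n) euclidean (\<lambda>z. z j)"
  using continuous_map_planar_configurations[of "planar_configurations n" n "\<lambda>x. x"] by simp

text \<open>The positions forbidden to a further point. Index 0 stands for the antipode of the first
  point, which sits at infinity; otherwise the flag selects an earlier point or its
  antipode.\<close>

definition puncture :: "nat \<times> bool \<Rightarrow> (nat \<Rightarrow> complex) \<Rightarrow> complex" where
  "puncture x z = (if fst x = 0 then 0 else if snd x then z (fst x) else - 1 / cnj (z (fst x)))"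

definition puncture_indices :: "nat \<Rightarrow> (nat \<times> bool) set" where
  "puncture_indices n = {(0, True)} \<union> {1..<n} \<times> UNIV"

lemma planar_puncture_avoid:
  assumes z: "z \<in> topspace (planar_configurations n)"
  shows "(\<forall>x\<in>puncture_indices n. w \<noteq> puncture x z) \<longleftrightarrow>
     w \<noteq> 0 \<and> (\<forall>j\<in>{1..<n}. w \<noteq> z j \<and> w * cnj (z j) \<noteq> -1)"
proof -
  have "w \<noteq> - 1 / cnj (z j) \<longleftrightarrow> w * cnj (z j) \<noteq> -1" if "j \<in> {1..<n}" for j
  proof -
    have "cnj (z j) \<noteq> 0" using z that by (simp add: topspace_planar_configurations)
    from nonzero_eq_divide_eq[OF this, of w "-1"] show ?thesis by (simp only:)
  qed
  then show ?thesis
    by (auto simp: puncture_indices_def puncture_def)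
qed

interpretation punctures: moving_points "planar_configurations n" "puncture_indices n" puncture for n
proof
  show "finite (puncture_indices n)" by (simp add: puncture_indices_def)
  show "continuous_map (planar_configurations n) euclidean (puncture x)" if "x \<in> puncture_indices n" for x
  proof (cases "fst x = 0")
    case True
    then show ?thesis by (simp add: puncture_def[abs_def])
  next
    case False
    then have x: "fst x \<in> {1..<n}" using that by (auto simp: puncture_indices_def)
    have c: "continuous_map (planar_configurations n) (top_of_set (- {0})) (\<lambda>z. z (fst x))"
      using x continuous_map_planar_configurations_coordinate[OF x]
      by (intro continuous_map_into_subtopology) (auto simp: topspace_planar_configurations)
    have "continuous_on (- {0}) (\<lambda>w. if snd x then w else - 1 / cnj w)"
      by (cases "snd x") (auto intro!: continuous_intros)
    from continuous_map_continuous_on_compose[OF c this] show ?thesis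
      using False by (simp add: puncture_def[abs_def])
  qed
  show "puncture x z \<noteq> puncture y z"
    if xy: "x \<in> puncture_indices n" "y \<in> puncture_indices n" "x \<noteq> y" and z: "z \<in> topspace (planar_configurations n)" for x y z
  proof -
    have nz: "z j \<noteq> 0" if "j \<in> {1..<n}" for j
      using z that by (simp add: topspace_planar_configurations)
    have dist: "z j \<noteq> z k" if "j \<in> {1..<n}" "k \<in> {1..<n}" "j \<noteq> k" for j k
      using z that by (simp add: topspace_planar_configurations)
    \<comment> \<open>The case \<open>j = k\<close> says that no point is its own antipode:
      \<open>z j * cnj (z j)\<close> is a nonnegative real.\<close>
    have anti: "z j * cnj (z k) \<noteq> -1" if "j \<in> {1..<n}" "k \<in> {1..<n}" for j k
    proof (cases "j = k")
      case True
      have sq: "z j * cnj (z k) = of_real ((norm (z j))\<^sup>2)" using True by (metis complex_norm_square)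
      show ?thesis
      proof
        assume "z j * cnj (z k) = -1"
        then have "Re (of_real ((norm (z j))\<^sup>2)) = Re (-1)" unfolding sq by (rule arg_cong)
        then show False using zero_le_power2[of "norm (z j)"] by (simp del: zero_le_power2)
      qed
    next
      case False
      then show ?thesis using z that by (simp add: topspace_planar_configurations)
    qed
    have anti': "z j \<noteq> - 1 / cnj (z k)" if "j \<in> {1..<n}" "k \<in> {1..<n}" for j k
    proof -
      have "cnj (z k) \<noteq> 0" using nz[OF that(2)] by simp
      from nonzero_eq_divide_eq[OF this, of "z j" "-1"] show ?thesis using anti[OF that] by (simp only:) simp
    qed
    obtain j b k c where jk: "x = (j, b)" "y = (k, c)" by fastforce
    consider "j = 0" "k \<in> {1..<n}" | "k = 0" "j \<in> {1..<n}" | "j \<in> {1..<n}" "k \<in> {1..<n}"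
      using xy unfolding jk by (auto simp: puncture_indices_def)
    then show ?thesis
    proof cases
      case 3
      then show ?thesis
        using xy(3) dist[of j k] anti'[of j k] anti'[of k j] nz[of j] nz[of k] unfolding jk puncture_def
        by (cases b; cases c) auto
    qed (use nz in \<open>auto simp: jk puncture_def\<close>)
  qed
qed

text \<open>Splitting off the last point and putting it back. With \<open>n \<ge> 2\<close> the
  coordinate 1, which is bound to the positive half-line, stays in the base, and the new coordinate
  is a free point of the punctured plane.\<close>

lemma planar_configurations_extend:
  assumes "n \<ge> 2"
  shows "continuous_map (punctures.complement_bundle n) (planar_configurations (Suc n)) (\<lambda>x. (fst x)(n := snd x))"
    and "continuous_map (planar_configurations (Suc n)) (punctures.complement_bundle n) (\<lambda>z. (restrict z {1..<n}, z n))"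
proof -
  have Suc: "{1..<Suc n} = insert n {1..<n}" using assms by auto
  have coord: "continuous_map (punctures.complement_bundle n) euclidean (\<lambda>x. fst x j)" if "j \<in> {1..<n}" for j
    using continuous_map_compose[OF punctures.fibration.cont_p continuous_map_planar_configurations_coordinate[OF that]]
    by (simp add: o_def)
  have snd: "continuous_map (punctures.complement_bundle n) euclidean snd"
    by (rule punctures.continuous_snd_complement_bundle)
  show "continuous_map (punctures.complement_bundle n) (planar_configurations (Suc n)) (\<lambda>x. (fst x)(n := snd x))"
    unfolding continuous_map_planar_configurations
  proof (intro conjI ballI funcsetI)
    fix x assume "x \<in> topspace (punctures.complement_bundle n)"
    then obtain z w where x: "x = (z, w)" and z: "z \<in> topspace (planar_configurations n)"
      and w: "w \<noteq> 0" "\<And>j. j \<in> {1..<n} \<Longrightarrow> w \<noteq> z j" "\<And>j. j \<in> {1..<n} \<Longrightarrow> w * cnj (z j) \<noteq> -1"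
      using planar_puncture_avoid unfolding punctures.complement_bundle_def by (cases x) fastforce
    have w': "z j * cnj w \<noteq> -1" if "j \<in> {1..<n}" for j
    proof
      assume "z j * cnj w = -1"
      then have "cnj (z j * cnj w) = cnj (-1)" by (rule arg_cong)
      then show False using w(3)[OF that] by (simp add: mult.commute)
    qed
    show "(fst x)(n := snd x) \<in> topspace (planar_configurations (Suc n))"
      using z w w' not_sym[OF w(2)] assms unfolding topspace_planar_configurations x Suc
      by (auto simp: extensional_def)
  next
    fix j assume "j \<in> {1..<Suc n}"
    then show "continuous_map (punctures.complement_bundle n) euclidean (\<lambda>x. ((fst x)(n := snd x)) j)"
      using coord snd by (cases "j = n") auto
  qed
  have c: "continuous_map (planar_configurations (Suc n)) euclidean (\<lambda>z. z j)" if "j \<in> {1..<Suc n}" for j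
    using continuous_map_planar_configurations_coordinate that .
  have mem: "restrict z {1..<n} \<in> topspace (planar_configurations n)"
    if "z \<in> topspace (planar_configurations (Suc n))" for z
    using that assms unfolding topspace_planar_configurations Suc by auto
  have "continuous_map (planar_configurations (Suc n)) (planar_configurations n) (\<lambda>z. restrict z {1..<n})"
    unfolding continuous_map_planar_configurations using mem c by auto
  then have "continuous_map (planar_configurations (Suc n)) (prod_topology (planar_configurations n) euclidean) (\<lambda>z. (restrict z {1..<n}, z n))"
    using c[of n] assms by (intro continuous_map_pairedI) auto
  moreover have "\<forall>x\<in>puncture_indices n. z n \<noteq> puncture x (restrict z {1..<n})"
    if "z \<in> topspace (planar_configurations (Suc n))" for z
    using that assms unfolding planar_puncture_avoid[OF mem[OF that]] topspace_planar_configurations Suc by auto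
  ultimately show "continuous_map (planar_configurations (Suc n)) (punctures.complement_bundle n) (\<lambda>z. (restrict z {1..<n}, z n))"
    unfolding punctures.complement_bundle_def by (intro continuous_map_into_subtopology) auto
qed

theorem planar_configurations_aspherical:
  assumes i: "i \<ge> 2" and n: "n \<ge> 2" and f: "f \<in> spheroids i (planar_configurations n) z0"
  shows "homotopic_spheroids i (planar_configurations n) z0 f (\<lambda>_. z0)"
  using n f
proof (induction n arbitrary: f z0 rule: dec_induct)
  case base
  \<comment> \<open>For two points only coordinate 1 is left, a positive real. Segments to the base
    point stay in the half-line.\<close>
  let ?Z = "prod_topology unit_interval (cube i)"
  let ?H = "\<lambda>x. restrict (\<lambda>j. (1 - of_real (fst x)) * f (snd x) j + of_real (fst x) * z0 j) {1}"
  have one: "{1..<2::nat} = {1}" by auto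
  have fc: "continuous_map (cube i) (planar_configurations 2) f" and fb: "\<And>t. t \<in> cube_boundary i \<Longrightarrow> f t = z0"
    using base by (auto simp: spheroids_def)
  have fin: "f t \<in> topspace (planar_configurations 2)" if "t \<in> topspace (cube i)" for t
    using continuous_map_image_subset_topspace[OF fc] that by blast
  have zin: "z0 \<in> topspace (planar_configurations 2)"
    using fin[OF cube_origin] fb[OF cube_origin_boundary] i by simp
  have "?H (s, t) \<in> topspace (planar_configurations 2)" if st: "s \<in> {0..1}" "t \<in> topspace (cube i)" for s t
  proof -
    obtain r r' where r: "r > 0" "f t 1 = of_real r" "r' > 0" "z0 1 = of_real r'"
      using fin[OF st(2)] zin unfolding topspace_planar_configurations by blast
    have "(1 - s) * r + s * r' > 0"
      using that r by (cases "s = 0") (auto intro: add_nonneg_pos)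
    moreover have "?H (s, t) 1 = of_real ((1 - s) * r + s * r')"
      using r by simp
    ultimately show ?thesis
      unfolding topspace_planar_configurations one by (auto simp del: of_real_add of_real_mult of_real_diff)
  qed
  moreover have "continuous_map (cube i) euclidean (\<lambda>t. f t 1)"
    using fc unfolding continuous_map_planar_configurations by simp
  from continuous_map_compose[OF continuous_map_snd this, of unit_interval, unfolded o_def]
  have "continuous_map ?Z euclidean (\<lambda>x. (1 - of_real (fst x)) * f (snd x) 1 + of_real (fst x) * z0 1)"
    by (intro continuous_map_mult continuous_map_add continuous_map_diff continuous_map_complex_of_real continuous_map_fst_top_of_set) auto
  ultimately have H: "continuous_map ?Z (planar_configurations 2) ?H"
    unfolding continuous_map_planar_configurations one by auto
  have ext: "restrict z {1} = z" if "z \<in> topspace (planar_configurations 2)" for z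
    using that unfolding topspace_planar_configurations one by (auto simp: extensional_restrict)
  have mix: "(1 - of_real s) * w + of_real s * w = w" for s :: real and w :: complex
    by (simp add: algebra_simps)
  show ?case
    unfolding homotopic_spheroids
    by (intro exI[of _ ?H] conjI ballI H) (use ext[OF fin] ext[OF zin] fb mix in \<open>auto simp: restrict_def[of z0] simp del: restrict_apply\<close>)
next
  case (step n)
  note maps = planar_configurations_extend[OF step.hyps(1)]
  let ?split = "\<lambda>z. (restrict z {1..<n}, z n)" and ?join = "\<lambda>x :: (nat \<Rightarrow> complex) \<times> complex. (fst x)(n := snd x)"
  have join_split: "?join (?split z) = z" if "z \<in> topspace (planar_configurations (Suc n))" for z
    \<comment> \<open>Extensionality restores the coordinates beyond \<open>n\<close> that
      \<open>restrict\<close> has set to \<open>undefined\<close>.\<close>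
    using that unfolding topspace_planar_configurations by (auto simp: extensional_def fun_eq_iff)
  have sf: "?split \<circ> f \<in> spheroids i (punctures.complement_bundle n) (?split z0)"
    using spheroids_compose[OF step.prems maps(2)] .
  have "fst \<circ> (?split \<circ> f) \<in> spheroids i (planar_configurations n) (restrict z0 {1..<n})"
    using spheroids_compose[OF sf punctures.fibration.cont_p] by (simp only: fst_conv)
  from punctures.complement_bundle_null_homotopic[OF i sf step.IH[OF this]]
  have "homotopic_spheroids i (punctures.complement_bundle n) (?split z0) (?split \<circ> f) (\<lambda>_. ?split z0)" .
  from homotopic_spheroids_compose[OF this maps(1)]
  have *: "homotopic_spheroids i (planar_configurations (Suc n)) (?join (?split z0)) (?join \<circ> (?split \<circ> f)) (?join \<circ> (\<lambda>_. ?split z0))" .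
  have fin: "f t \<in> topspace (planar_configurations (Suc n))" if "t \<in> topspace (cube i)" for t
    using step.prems that continuous_map_image_subset_topspace unfolding spheroids_def by blast
  have "f (cube_origin i) = z0" using step.prems cube_origin_boundary i by (auto simp: spheroids_def)
  then have z0: "?join (?split z0) = z0" using join_split fin[OF cube_origin] by simp
  have 1: "homotopic_spheroids i (planar_configurations (Suc n)) z0 f (?join \<circ> (?split \<circ> f))"
    using step.prems by (rule homotopic_spheroids_equal) (use join_split fin in auto)
  have 2: "?join \<circ> (\<lambda>_. ?split z0) = (\<lambda>_. z0)" using z0 by (simp add: o_def)
  from homotopic_spheroids_trans[OF 1 *[unfolded z0 2]] show ?case .
qed

section \<open>Configurations of lines\<close>

lemma openin_Ball_preimage:
  assumes "finite I" "\<And>j. j \<in> I \<Longrightarrow> continuous_map X Y (g j)" "\<And>j. j \<in> I \<Longrightarrow> openin Y (V j)"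
  shows "openin X {x \<in> topspace X. \<forall>j\<in>I. g j x \<in> V j}"
  using assms
proof (induction I rule: finite_induct)
  case (insert j I)
  have "openin X ({x \<in> topspace X. g j x \<in> V j} \<inter> {x \<in> topspace X. \<forall>j\<in>I. g j x \<in> V j})"
    using insert by (intro openin_Int openin_continuous_map_preimage[where Y=Y]) auto
  moreover have "{x \<in> topspace X. g j x \<in> V j} \<inter> {x \<in> topspace X. \<forall>j\<in>I. g j x \<in> V j}
      = {x \<in> topspace X. \<forall>j\<in>insert j I. g j x \<in> V j}" by auto
  ultimately show ?case by simp
qed simp

definition inner_upto :: "nat \<Rightarrow> (nat \<Rightarrow> real) \<Rightarrow> (nat \<Rightarrow> real) \<Rightarrow> real" where
  "inner_upto m x y = (\<Sum>k\<le>m. x k * y k)"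

abbreviation antipode :: "(nat \<Rightarrow> real) \<Rightarrow> nat \<Rightarrow> real" where
  "antipode x \<equiv> (\<lambda>k. - x k)"

lemma topspace_nsphere: "topspace (nsphere m) = {x. inner_upto m x x = 1 \<and> (\<forall>k>m. x k = 0)}"
  by (auto simp: nsphere inner_upto_def power2_eq_square)

lemma continuous_map_nsphere:
  "continuous_map X (nsphere m) f \<longleftrightarrow> f \<in> topspace X \<rightarrow> topspace (nsphere m) \<and> (\<forall>k\<le>m. continuous_map X euclideanreal (\<lambda>x. f x k))"
proof
  assume f: "continuous_map X (nsphere m) f"
  then show "f \<in> topspace X \<rightarrow> topspace (nsphere m) \<and> (\<forall>k\<le>m. continuous_map X euclideanreal (\<lambda>x. f x k))"
    using continuous_map_compose[OF f continuous_map_nsphere_projection] continuous_map_funspace[OF f] by (simp add: o_def)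
next
  assume f: "f \<in> topspace X \<rightarrow> topspace (nsphere m) \<and> (\<forall>k\<le>m. continuous_map X euclideanreal (\<lambda>x. f x k))"
  have "continuous_map X euclideanreal (\<lambda>x. f x k)" for k
  proof (cases "k \<le> m")
    case False
    have "continuous_map X euclideanreal (\<lambda>x. 0)" by simp
    then show ?thesis
      by (rule continuous_map_eq) (use f False in \<open>auto simp: topspace_nsphere Pi_iff\<close>)
  qed (use f in blast)
  then show "continuous_map X (nsphere m) f"
    using f unfolding nsphere continuous_map_in_subtopology continuous_map_componentwise_UNIV by (auto simp: Pi_iff)
qed

lemma Hausdorff_space_nsphere: "Hausdorff_space (nsphere m)"
  unfolding nsphere by (intro Hausdorff_space_subtopology) (simp add: Hausdorff_space_product_topology)

lemma antipode_in_nsphere: "x \<in> topspace (nsphere m) \<Longrightarrow> antipode x \<in> topspace (nsphere m)"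
  by (auto simp: topspace_nsphere inner_upto_def)

lemma topspace_real_projective_space: "topspace (real_projective_space m) = (\<lambda>x. {x, antipode x}) ` topspace (nsphere m)"
  using quotient_imp_surjective_map[OF quotient_map_quotient_topology[of "nsphere m" "\<lambda>x. {x, antipode x}"]]
  by (simp add: real_projective_space_def)

lemma quotient_map_real_projective_space: "quotient_map (nsphere m) (real_projective_space m) (\<lambda>x. {x, antipode x})"
  unfolding real_projective_space_def by (rule quotient_map_quotient_topology)

text \<open>On \<open>L = {x, antipode x}\<close> the result does not depend on the choice of the point of \<open>L\<close>.\<close>

definition line_projection :: "(nat \<Rightarrow> real) set \<Rightarrow> nat \<Rightarrow> nat \<Rightarrow> real" where
  "line_projection L k l = (let x = SOME x. x \<in> L in x k * x l)"

lemma line_projection: "line_projection {x, antipode x} k l = x k * x l"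
proof -
  have "(SOME y. y \<in> {x, antipode x}) \<in> {x, antipode x}" by (rule someI[of _ x]) simp
  then show ?thesis by (auto simp: line_projection_def Let_def)
qed

lemma continuous_map_line_projection:
  "continuous_map (real_projective_space m) euclideanreal (\<lambda>L. line_projection L k l)"
proof (rule continuous_compose_quotient_map[OF quotient_map_real_projective_space])
  show "continuous_map (nsphere m) euclideanreal ((\<lambda>L. line_projection L k l) \<circ> (\<lambda>x. {x, antipode x}))"
    by (simp add: o_def line_projection continuous_map_real_mult continuous_map_nsphere_projection)
qed

definition spherical_configurations :: "nat \<Rightarrow> nat \<Rightarrow> (nat \<Rightarrow> nat \<Rightarrow> real) topology" where
  "spherical_configurations m n = subtopology (product_topology (\<lambda>_. nsphere m) {..<n})
     {x. \<forall>i<n. \<forall>j<n. i \<noteq> j \<longrightarrow> x i \<noteq> x j \<and> x i \<noteq> antipode (x j)}"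

lemma topspace_spherical_configurations:
  "x \<in> topspace (spherical_configurations m n) \<longleftrightarrow> x \<in> extensional {..<n} \<and> (\<forall>i<n. x i \<in> topspace (nsphere m)) \<and>
     (\<forall>i<n. \<forall>j<n. i \<noteq> j \<longrightarrow> x i \<noteq> x j \<and> x i \<noteq> antipode (x j))"
  by (auto simp: spherical_configurations_def PiE_iff)

lemma continuous_map_spherical_configurations:
  "continuous_map X (spherical_configurations m n) f \<longleftrightarrow>
     f \<in> topspace X \<rightarrow> topspace (spherical_configurations m n) \<and> (\<forall>j<n. \<forall>k\<le>m. continuous_map X euclideanreal (\<lambda>x. f x j k))"
  unfolding spherical_configurations_def continuous_map_in_subtopology continuous_map_componentwise continuous_map_nsphere
  by (auto simp: Pi_iff PiE_iff)

lemma continuous_map_spherical_configurations_coordinate: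
  "j < n \<Longrightarrow> k \<le> m \<Longrightarrow> continuous_map (spherical_configurations m n) euclideanreal (\<lambda>x. x j k)"
  using continuous_map_spherical_configurations[of "spherical_configurations m n" m n "\<lambda>x. x"] by simp

lemma Hausdorff_space_spherical_configurations: "Hausdorff_space (spherical_configurations m n)"
  unfolding spherical_configurations_def
  by (intro Hausdorff_space_subtopology) (simp add: Hausdorff_space_product_topology Hausdorff_space_nsphere)

definition lines_of :: "nat \<Rightarrow> (nat \<Rightarrow> nat \<Rightarrow> real) \<Rightarrow> nat \<Rightarrow> (nat \<Rightarrow> real) set" where
  "lines_of n x = (\<lambda>j\<in>{..<n}. {x j, antipode (x j)})"

lemma line_eq_iff: "{x, antipode x} = {y, antipode y} \<longleftrightarrow> x = y \<or> x = antipode y"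
  by (auto simp: doubleton_eq_iff)

lemma lines_of_cong:
  assumes "\<And>j. j < n \<Longrightarrow> x j = y j \<or> x j = antipode (y j)"
  shows "lines_of n x = lines_of n y"
  unfolding lines_of_def by (rule restrict_ext) (use assms line_eq_iff in blast)

lemma lines_of_in_configuration_space:
  assumes "x \<in> topspace (spherical_configurations m n)"
  shows "lines_of n x \<in> topspace (configuration_space n (real_projective_space m))"
  using assms unfolding topspace_spherical_configurations configuration_space_def
  by (auto simp: lines_of_def topspace_real_projective_space line_eq_iff simp del: insert_iff)

lemma configuration_space_lift:
  assumes "b \<in> topspace (configuration_space n (real_projective_space m))"
  obtains y where "y \<in> topspace (spherical_configurations m n)" "b = lines_of n y"
proof -
  have b: "b \<in> extensional {..<n}" "\<And>j. j < n \<Longrightarrow> b j \<in> topspace (real_projective_space m)"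
    "\<And>i j. i < n \<Longrightarrow> j < n \<Longrightarrow> i \<noteq> j \<Longrightarrow> b i \<noteq> b j"
    using assms by (auto simp: configuration_space_def PiE_iff)
  have "\<forall>j. \<exists>x. j < n \<longrightarrow> x \<in> topspace (nsphere m) \<and> b j = {x, antipode x}"
    using b(2) unfolding topspace_real_projective_space by blast
  then obtain z where z: "\<And>j. j < n \<Longrightarrow> z j \<in> topspace (nsphere m)" "\<And>j. j < n \<Longrightarrow> b j = {z j, antipode (z j)}"
    by metis
  have "restrict z {..<n} \<in> topspace (spherical_configurations m n)"
    unfolding topspace_spherical_configurations using z(1) b(3) z(2) line_eq_iff by auto
  moreover have "b = lines_of n (restrict z {..<n})"
    using b(1) z(2) by (auto simp: lines_of_def extensional_def fun_eq_iff)
  ultimately show thesis using that by blast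
qed

text \<open>If the line of \<open>b j\<close> is spanned by \<open>y\<close> then the new point is the multiple of \<open>y\<close> by the sign of \<open>y \<bullet> x j\<close>.\<close>

definition line_transport :: "nat \<Rightarrow> nat \<Rightarrow> (nat \<Rightarrow> nat \<Rightarrow> real) \<Rightarrow> (nat \<Rightarrow> (nat \<Rightarrow> real) set) \<Rightarrow> nat \<Rightarrow> nat \<Rightarrow> real" where
  "line_transport m n x b = (\<lambda>j\<in>{..<n}. \<lambda>k. if k \<le> m then (\<Sum>l\<le>m. line_projection (b j) k l * x j l) /
      sqrt (\<Sum>k\<le>m. \<Sum>l\<le>m. line_projection (b j) k l * (x j k * x j l)) else 0)"

text \<open>The sum is the trace of the product of two line projections, that is, the squared inner
  product of spanning unit vectors. Close configurations are those in which no two corresponding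
  lines are orthogonal.\<close>

definition close_lines :: "nat \<Rightarrow> nat \<Rightarrow> ((nat \<Rightarrow> (nat \<Rightarrow> real) set) \<times> (nat \<Rightarrow> (nat \<Rightarrow> real) set)) set" where
  "close_lines m n = {x \<in> topspace (prod_topology (configuration_space n (real_projective_space m)) (configuration_space n (real_projective_space m))).
     \<forall>j\<in>{..<n}. (\<Sum>k\<le>m. \<Sum>l\<le>m. line_projection (fst x j) k l * line_projection (snd x j) k l) \<in> {0<..}}"

lemma inner_upto_square: "(\<Sum>k\<le>m. \<Sum>l\<le>m. y k * y l * (x k * x l)) = (inner_upto m y x)\<^sup>2"
  by (simp add: inner_upto_def power2_eq_square sum_product mult_ac)

lemma close_lines_iff:
  assumes "x \<in> topspace (spherical_configurations m n)" "y \<in> topspace (spherical_configurations m n)"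
  shows "(lines_of n x, lines_of n y) \<in> close_lines m n \<longleftrightarrow> (\<forall>j<n. inner_upto m (y j) (x j) \<noteq> 0)"
proof -
  have "(\<Sum>k\<le>m. \<Sum>l\<le>m. line_projection (lines_of n x j) k l * line_projection (lines_of n y j) k l) = (inner_upto m (y j) (x j))\<^sup>2"
    if "j < n" for j
    using that inner_upto_square[of "y j" "x j" m] by (simp add: lines_of_def line_projection mult.commute)
  then show ?thesis
    using assms lines_of_in_configuration_space by (simp add: close_lines_def Ball_def)
qed

lemma line_transport:
  assumes x: "x \<in> topspace (spherical_configurations m n)" and y: "y \<in> topspace (spherical_configurations m n)"
    and j: "j < n" and nz: "inner_upto m (y j) (x j) \<noteq> 0"
  shows "line_transport m n x (lines_of n y) j = (\<lambda>k. sgn (inner_upto m (y j) (x j)) * y j k)"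
proof
  fix k
  let ?c = "inner_upto m (y j) (x j)"
  have y0: "y j k = 0" if "k > m" using y that j unfolding topspace_spherical_configurations topspace_nsphere by auto
  have "(\<Sum>l\<le>m. y j k * y j l * x j l) = y j k * ?c"
    by (simp add: inner_upto_def sum_distrib_left mult.assoc)
  then show "line_transport m n x (lines_of n y) j k = sgn ?c * y j k"
    using j nz y0 inner_upto_square[of "y j" "x j" m]
    by (auto simp: line_transport_def lines_of_def line_projection real_sgn_eq)
qed

lemma continuous_map_into_configuration_space:
  assumes "f \<in> topspace X \<rightarrow> topspace (configuration_space n M)" "\<And>j. j < n \<Longrightarrow> continuous_map X M (\<lambda>x. f x j)"
  shows "continuous_map X (configuration_space n M) f"
  using assms unfolding configuration_space_def continuous_map_in_subtopology continuous_map_componentwise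
  by (auto simp: Pi_iff PiE_iff)

lemma continuous_map_configuration_space_coordinate:
  "j < n \<Longrightarrow> continuous_map (configuration_space n M) M (\<lambda>x. x j)"
  unfolding configuration_space_def
  by (intro continuous_map_from_subtopology continuous_map_product_projection) simp

text \<open>The \<open>2\<^sup>n\<close>-fold covering by choices of unit vectors. Changing the sign
  of a vector makes the corresponding inner product negative, so positivity in every coordinate
  separates the points of a fibre.\<close>

interpretation line_covering: covering_transport "spherical_configurations m n" "configuration_space n (real_projective_space m)"
  "lines_of n" "close_lines m n" "line_transport m n"
  "{x \<in> topspace (prod_topology (spherical_configurations m n) (spherical_configurations m n)).
     \<forall>j\<in>{..<n}. inner_upto m (fst x j) (snd x j) \<in> {0<..}}" for m n
proof
  let ?G = "spherical_configurations m n" and ?F = "configuration_space n (real_projective_space m)"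
  show "continuous_map ?G ?F (lines_of n)"
  proof (rule continuous_map_into_configuration_space)
    show "lines_of n \<in> topspace ?G \<rightarrow> topspace ?F" using lines_of_in_configuration_space by blast
    fix j assume j: "j < n"
    have "continuous_map ?G (nsphere m) (\<lambda>x. x j)"
      unfolding spherical_configurations_def
      using j by (intro continuous_map_from_subtopology continuous_map_product_projection) simp
    from continuous_map_compose[OF this quotient_imp_continuous_map[OF quotient_map_real_projective_space]]
    show "continuous_map ?G (real_projective_space m) (\<lambda>x. lines_of n x j)"
      using j by (simp add: lines_of_def o_def)
  qed
  have pc: "continuous_map ?F euclideanreal (\<lambda>b. line_projection (b j) k l)" if "j < n" for j k l
    using continuous_map_compose[OF continuous_map_configuration_space_coordinate[OF that] continuous_map_line_projection]
    by (simp add: o_def)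
  show "openin (prod_topology ?F ?F) (close_lines m n)"
    unfolding close_lines_def
  proof (rule openin_Ball_preimage)
    fix j assume j: "j \<in> {..<n}"
    show "continuous_map (prod_topology ?F ?F) euclideanreal (\<lambda>x. \<Sum>k\<le>m. \<Sum>l\<le>m. line_projection (fst x j) k l * line_projection (snd x j) k l)"
      using continuous_map_compose[OF continuous_map_fst pc[of j], unfolded o_def]
        continuous_map_compose[OF continuous_map_snd pc[of j], unfolded o_def] j
      by (intro continuous_map_sum continuous_map_real_mult) auto
  qed auto
  have sph1: "inner_upto m (x j) (x j) = 1" if "x \<in> topspace ?G" "j < n" for x j
    using that unfolding topspace_spherical_configurations topspace_nsphere by auto
  show "(b, b) \<in> close_lines m n" if "b \<in> topspace ?F" for b
  proof -
    obtain y where y: "y \<in> topspace ?G" "b = lines_of n y" using configuration_space_lift \<open>b \<in> topspace ?F\<close> by blast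
    then show ?thesis using close_lines_iff[OF y(1) y(1)] sph1 by simp
  qed
  have tr: "line_transport m n x (lines_of n y) \<in> topspace ?G \<and> lines_of n (line_transport m n x (lines_of n y)) = lines_of n y"
    if x: "x \<in> topspace ?G" and y: "y \<in> topspace ?G" and c: "(lines_of n x, lines_of n y) \<in> close_lines m n" for x y
  proof -
    have "line_transport m n x (lines_of n y) j = y j \<or> line_transport m n x (lines_of n y) j = antipode (y j)" if "j < n" for j
    proof -
      have "inner_upto m (y j) (x j) \<noteq> 0" using close_lines_iff[OF x y] c that by blast
      then show ?thesis using line_transport[OF x y that] by (auto simp: sgn_if)
    qed
    note * = this
    \<comment> \<open>Being neither equal nor antipodal is insensitive to sign changes of single
      vectors, so the transported tuple is again a configuration.\<close>
    have anti1: "antipode a = antipode b \<longleftrightarrow> a = b" for a b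
      by (simp add: fun_eq_iff)
    have "a k = - b k \<longleftrightarrow> - a k = b k" for a b :: "nat \<Rightarrow> real" and k by linarith
    then have "a = antipode b \<longleftrightarrow> antipode a = b" for a b
      unfolding fun_eq_iff by blast
    note anti2 = anti1 this
    have ext: "line_transport m n x (lines_of n y) \<in> extensional {..<n}"
      by (simp add: line_transport_def)
    have "line_transport m n x (lines_of n y) j \<in> topspace (nsphere m)" if "j < n" for j
      using *[OF that] y antipode_in_nsphere that unfolding topspace_spherical_configurations by metis
    moreover have "line_transport m n x (lines_of n y) i \<noteq> line_transport m n x (lines_of n y) j \<and>
       line_transport m n x (lines_of n y) i \<noteq> antipode (line_transport m n x (lines_of n y) j)" if "i < n" "j < n" "i \<noteq> j" for i j
    proof -
      have ne: "y i \<noteq> y j" "y i \<noteq> antipode (y j)" using y that unfolding topspace_spherical_configurations by auto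
      then have "antipode (y i) \<noteq> y j" "antipode (y i) \<noteq> antipode (y j)" using anti2 by blast+
      with ne show ?thesis using *[OF that(1)] *[OF that(2)] by (elim disjE) simp_all
    qed
    ultimately have "line_transport m n x (lines_of n y) \<in> topspace ?G"
      using ext unfolding topspace_spherical_configurations by blast
    moreover have "lines_of n (line_transport m n x (lines_of n y)) = lines_of n y"
      using lines_of_cong[OF *] .
    ultimately show ?thesis by blast
  qed
  let ?X = "subtopology (prod_topology ?G ?F) {(e, b). (lines_of n e, b) \<in> close_lines m n}"
  show "continuous_map ?X ?G (\<lambda>(e, b). line_transport m n e b)"
    unfolding continuous_map_spherical_configurations
  proof (intro conjI allI impI funcsetI)
    fix z assume z: "z \<in> topspace ?X"
    then obtain x b where xb: "z = (x, b)" "x \<in> topspace ?G" "b \<in> topspace ?F" "(lines_of n x, b) \<in> close_lines m n"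
      by (cases z) auto
    obtain y where y: "y \<in> topspace ?G" "b = lines_of n y" using configuration_space_lift xb(3) by blast
    show "(\<lambda>(e, b). line_transport m n e b) z \<in> topspace ?G"
      using tr[OF xb(2) y(1)] xb(4) unfolding xb(1) y(2) by simp
  next
    fix j k assume j: "j < n" and k: "k \<le> m"
    have Xp: "continuous_map ?X euclideanreal (\<lambda>x. line_projection (snd x j) k l)" for k l
      using continuous_map_compose[OF continuous_map_snd pc[OF j], unfolded o_def] by (intro continuous_map_from_subtopology)
    have Xc: "continuous_map ?X euclideanreal (\<lambda>x. fst x j l)" if "l \<le> m" for l
      using continuous_map_compose[OF continuous_map_fst continuous_map_spherical_configurations_coordinate[OF j that], unfolded o_def]
      by (intro continuous_map_from_subtopology)
    have "continuous_map ?X euclideanreal (\<lambda>x. (\<Sum>l\<le>m. line_projection (snd x j) k l * fst x j l) /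
      sqrt (\<Sum>k\<le>m. \<Sum>l\<le>m. line_projection (snd x j) k l * (fst x j k * fst x j l)))"
    proof (intro continuous_map_real_divide continuous_map_sum continuous_map_real_mult continuous_map_sqrt Xp Xc)
      fix z assume z: "z \<in> topspace ?X"
      then obtain x b where xb: "z = (x, b)" "x \<in> topspace ?G" "b \<in> topspace ?F" "(lines_of n x, b) \<in> close_lines m n"
        by (cases z) auto
      obtain y where y: "y \<in> topspace ?G" "b = lines_of n y" using configuration_space_lift xb(3) by blast
      have "inner_upto m (y j) (x j) \<noteq> 0" using close_lines_iff[OF xb(2) y(1)] xb(4) j unfolding y(2) by blast
      then show "sqrt (\<Sum>k\<le>m. \<Sum>l\<le>m. line_projection (snd z j) k l * (fst z j k * fst z j l)) \<noteq> 0"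
        using j inner_upto_square[of "y j" "x j" m] by (simp add: xb(1) y(2) lines_of_def line_projection)
    qed auto
    then show "continuous_map ?X euclideanreal (\<lambda>x. (\<lambda>(e, b). line_transport m n e b) x j k)"
      using j k by (simp add: line_transport_def case_prod_unfold)
  qed
  show "lines_of n (line_transport m n e b) = b"
    if e: "e \<in> topspace ?G" and b: "b \<in> topspace ?F" and c: "(lines_of n e, b) \<in> close_lines m n" for e b
  proof -
    obtain y where y: "y \<in> topspace ?G" "b = lines_of n y" using configuration_space_lift b by blast
    show ?thesis using tr[OF e y(1)] c unfolding y(2) by blast
  qed
  show "line_transport m n e (lines_of n e) = e" if e: "e \<in> topspace ?G" for e
  proof (rule extensionalityI[of _ "{..<n}"])
    show "line_transport m n e (lines_of n e) \<in> extensional {..<n}" by (simp add: line_transport_def)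
    show "e \<in> extensional {..<n}" using e unfolding topspace_spherical_configurations by blast
    show "line_transport m n e (lines_of n e) j = e j" if "j \<in> {..<n}" for j
      using line_transport[OF e e, of j] sph1[OF e, of j] that by simp
  qed
  show "Hausdorff_space ?G" by (rule Hausdorff_space_spherical_configurations)
  show "openin (prod_topology ?G ?G) {x \<in> topspace (prod_topology ?G ?G). \<forall>j\<in>{..<n}. inner_upto m (fst x j) (snd x j) \<in> {0<..}}"
  proof (rule openin_Ball_preimage)
    fix j assume j: "j \<in> {..<n}"
    show "continuous_map (prod_topology ?G ?G) euclideanreal (\<lambda>x. inner_upto m (fst x j) (snd x j))"
      unfolding inner_upto_def
      using continuous_map_compose[OF continuous_map_fst continuous_map_spherical_configurations_coordinate[of j], unfolded o_def]
        continuous_map_compose[OF continuous_map_snd continuous_map_spherical_configurations_coordinate[of j], unfolded o_def] j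
      by (intro continuous_map_sum continuous_map_real_mult) auto
  qed auto
  show "(e, e) \<in> {x \<in> topspace (prod_topology ?G ?G). \<forall>j\<in>{..<n}. inner_upto m (fst x j) (snd x j) \<in> {0<..}}"
    if "e \<in> topspace ?G" for e
    using that sph1 by simp
  fix e e' assume e: "e \<in> topspace ?G" "e' \<in> topspace ?G"
    and c: "(e, e') \<in> {x \<in> topspace (prod_topology ?G ?G). \<forall>j\<in>{..<n}. inner_upto m (fst x j) (snd x j) \<in> {0<..}}"
    and eq: "lines_of n e = lines_of n e'"
  show "e = e'"
  proof (rule extensionalityI[of _ "{..<n}"])
    show "e \<in> extensional {..<n}" "e' \<in> extensional {..<n}" using e unfolding topspace_spherical_configurations by blast+
    fix j assume j: "j \<in> {..<n}"
    have "{e j, antipode (e j)} = {e' j, antipode (e' j)}"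
      using fun_cong[OF eq, of j] j by (simp add: lines_of_def)
    moreover have "inner_upto m (e j) (e' j) > 0" using c j by simp
    then have "e j \<noteq> antipode (e' j)"
    proof (rule contrapos_pn)
      assume "e j = antipode (e' j)"
      then have "inner_upto m (e j) (e' j) = - inner_upto m (e' j) (e' j)" by (simp add: inner_upto_def sum_negf)
      then show "\<not> inner_upto m (e j) (e' j) > 0" using j sph1[OF e(2), of j] by simp
    qed
    ultimately show "e j = e' j" using line_eq_iff by metis
  qed
qed

definition vec3 :: "real \<Rightarrow> real \<Rightarrow> real \<Rightarrow> nat \<Rightarrow> real" where
  "vec3 a b c k = (if k = 0 then a else if k = 1 then b else if k = 2 then c else 0)"

definition vec4 :: "real \<Rightarrow> real \<Rightarrow> real \<Rightarrow> real \<Rightarrow> nat \<Rightarrow> real" where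
  "vec4 a b c d k = (if k = 0 then a else if k = 1 then b else if k = 2 then c else if k = 3 then d else 0)"

lemma vec3_simps [simp]: "vec3 a b c 0 = a" "vec3 a b c 1 = b" "vec3 a b c (Suc 0) = b" "vec3 a b c 2 = c"
  by (simp_all add: vec3_def)

lemma vec4_simps [simp]: "vec4 a b c d 0 = a" "vec4 a b c d 1 = b" "vec4 a b c d (Suc 0) = b" "vec4 a b c d 2 = c" "vec4 a b c d 3 = d"
  by (simp_all add: vec4_def)

lemma vec3_eq_iff: "vec3 a b c = vec3 a' b' c' \<longleftrightarrow> a = a' \<and> b = b' \<and> c = c'"
  by (metis vec3_simps)

lemma vec3_minus: "antipode (vec3 a b c) = vec3 (- a) (- b) (- c)"
  by (auto simp: vec3_def)

lemma inner_upto_2: "inner_upto 2 x y = x 0 * y 0 + x 1 * y 1 + x 2 * y 2"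
  by (simp add: inner_upto_def numeral_2_eq_2)

lemma sum_atMost_3: "(\<Sum>k\<le>(3::nat). f k) = f 0 + f 1 + f 2 + (f 3 :: real)"
  by (simp add: numeral_3_eq_3 numeral_2_eq_2)

lemma vec3_of_sphere: "x \<in> topspace (nsphere 2) \<Longrightarrow> vec3 (x 0) (x 1) (x 2) = x"
  by (auto simp: topspace_nsphere vec3_def fun_eq_iff less_Suc_eq numeral_2_eq_2 not_less_eq)

lemma vec3_in_sphere: "vec3 a b c \<in> topspace (nsphere 2) \<longleftrightarrow> a * a + b * b + c * c = 1"
  by (simp add: topspace_nsphere inner_upto_2) (auto simp: vec3_def)

lemma continuous_map_vec3:
  "continuous_map X euclideanreal a \<Longrightarrow> continuous_map X euclideanreal b \<Longrightarrow> continuous_map X euclideanreal c \<Longrightarrow>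
   continuous_map X euclideanreal (\<lambda>x. vec3 (a x) (b x) (c x) k)"
  by (simp add: vec3_def)

lemma continuous_map_vec4:
  "continuous_map X euclideanreal a \<Longrightarrow> continuous_map X euclideanreal b \<Longrightarrow> continuous_map X euclideanreal c \<Longrightarrow>
   continuous_map X euclideanreal d \<Longrightarrow> continuous_map X euclideanreal (\<lambda>x. vec4 (a x) (b x) (c x) (d x) k)"
  by (simp add: vec4_def)

section \<open>Frames and quaternions\<close>

definition cross3d :: "(nat \<Rightarrow> real) \<Rightarrow> (nat \<Rightarrow> real) \<Rightarrow> nat \<Rightarrow> real" where
  "cross3d x y = vec3 (x 1 * y 2 - x 2 * y 1) (x 2 * y 0 - x 0 * y 2) (x 0 * y 1 - x 1 * y 0)"

definition orthonormal_pair :: "(nat \<Rightarrow> real) \<Rightarrow> (nat \<Rightarrow> real) \<Rightarrow> bool" where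
  "orthonormal_pair f c \<longleftrightarrow> f \<in> topspace (nsphere 2) \<and> c \<in> topspace (nsphere 2) \<and> inner_upto 2 f c = 0"

text \<open>A pair \<open>f, c\<close> stands for the frame \<open>f, c \<times> f, c\<close>.\<close>

definition frame_apply :: "(nat \<Rightarrow> real) \<Rightarrow> (nat \<Rightarrow> real) \<Rightarrow> (nat \<Rightarrow> real) \<Rightarrow> nat \<Rightarrow> real" where
  "frame_apply f c y = vec3 (y 0 * f 0 + y 1 * cross3d c f 0 + y 2 * c 0) (y 0 * f 1 + y 1 * cross3d c f 1 + y 2 * c 1)
      (y 0 * f 2 + y 1 * cross3d c f 2 + y 2 * c 2)"

definition frame_coords :: "(nat \<Rightarrow> real) \<Rightarrow> (nat \<Rightarrow> real) \<Rightarrow> (nat \<Rightarrow> real) \<Rightarrow> nat \<Rightarrow> real" where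
  "frame_coords f c x = vec3 (inner_upto 2 f x) (inner_upto 2 (cross3d c f) x) (inner_upto 2 c x)"

lemma orthonormal_pairD:
  assumes "orthonormal_pair f c"
  shows "f 0 * f 0 + f 1 * f 1 + f 2 * f 2 = 1" "c 0 * c 0 + c 1 * c 1 + c 2 * c 2 = 1" "f 0 * c 0 + f 1 * c 1 + f 2 * c 2 = 0"
  using assms by (simp_all only: orthonormal_pair_def topspace_nsphere mem_Collect_eq inner_upto_2)

context
  fixes f c :: "nat \<Rightarrow> real"
  assumes fc: "orthonormal_pair f c"
begin

text \<open>This identity and the three after it are polynomial consequences of the relations in
  \<open>orthonormal_pairD\<close>.\<close>

lemma frame_coords_apply: "frame_coords f c (frame_apply f c y) = vec3 (y 0) (y 1) (y 2)"
  unfolding frame_coords_def frame_apply_def inner_upto_2 cross3d_def vec3_simps vec3_eq_iff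
  using orthonormal_pairD[OF fc] by (intro conjI; algebra)

lemma frame_apply_coords: "frame_apply f c (frame_coords f c x) = vec3 (x 0) (x 1) (x 2)"
  unfolding frame_coords_def frame_apply_def inner_upto_2 cross3d_def vec3_simps vec3_eq_iff
  using orthonormal_pairD[OF fc] by (intro conjI; algebra)

lemma inner_frame_apply: "inner_upto 2 (frame_apply f c x) (frame_apply f c y) = inner_upto 2 x y"
  unfolding frame_apply_def inner_upto_2 cross3d_def vec3_simps
  using orthonormal_pairD[OF fc] by algebra

lemma inner_frame_coords: "inner_upto 2 (frame_coords f c x) (frame_coords f c y) = inner_upto 2 x y"
  unfolding frame_coords_def inner_upto_2 cross3d_def vec3_simps
  using orthonormal_pairD[OF fc] by algebra

lemma frame_apply_sphere:
  assumes "y \<in> topspace (nsphere 2)"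
  shows "frame_apply f c y \<in> topspace (nsphere 2)" "frame_coords f c (frame_apply f c y) = y"
proof -
  show "frame_apply f c y \<in> topspace (nsphere 2)"
    using inner_frame_apply[of y y] assms unfolding frame_apply_def vec3_in_sphere
    by (simp add: topspace_nsphere inner_upto_2)
  show "frame_coords f c (frame_apply f c y) = y"
    using frame_coords_apply vec3_of_sphere[OF assms] by simp
qed

lemma frame_coords_sphere:
  assumes "x \<in> topspace (nsphere 2)"
  shows "frame_coords f c x \<in> topspace (nsphere 2)" "frame_apply f c (frame_coords f c x) = x"
proof -
  show "frame_coords f c x \<in> topspace (nsphere 2)"
    using inner_frame_coords[of x x] assms unfolding frame_coords_def vec3_in_sphere
    by (simp add: topspace_nsphere inner_upto_2)
  show "frame_apply f c (frame_coords f c x) = x"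
    using frame_apply_coords vec3_of_sphere[OF assms] by simp
qed

end

lemma frame_apply_antipode: "frame_apply f c (antipode y) = antipode (frame_apply f c y)"
  by (simp add: frame_apply_def vec3_minus)

lemma frame_coords_antipode: "frame_coords f c (antipode y) = antipode (frame_coords f c y)"
  by (simp add: frame_coords_def vec3_minus inner_upto_2)

text \<open>First and third column of the rotation given by a unit quaternion \<open>q\<close>.\<close>

definition quat_f :: "(nat \<Rightarrow> real) \<Rightarrow> nat \<Rightarrow> real" where
  "quat_f q = vec3 (q 0 * q 0 + q 1 * q 1 - q 2 * q 2 - q 3 * q 3) (2 * (q 1 * q 2 + q 0 * q 3)) (2 * (q 1 * q 3 - q 0 * q 2))"

definition quat_c :: "(nat \<Rightarrow> real) \<Rightarrow> nat \<Rightarrow> real" where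
  "quat_c q = vec3 (2 * (q 1 * q 3 + q 0 * q 2)) (2 * (q 2 * q 3 - q 0 * q 1)) (q 0 * q 0 - q 1 * q 1 - q 2 * q 2 + q 3 * q 3)"

text \<open>The entries of \<open>q q\<^sup>T\<close> are affine functions of the rotation matrix.\<close>

definition quat_matrix :: "(nat \<Rightarrow> real) \<Rightarrow> (nat \<Rightarrow> real) \<Rightarrow> nat \<Rightarrow> nat \<Rightarrow> real" where
  "quat_matrix f c i j = (let b = cross3d c f in vec4
     (vec4 ((1 + f 0 + b 1 + c 2) / 4) ((b 2 - c 1) / 4) ((c 0 - f 2) / 4) ((f 1 - b 0) / 4) j)
     (vec4 ((b 2 - c 1) / 4) ((1 + f 0 - b 1 - c 2) / 4) ((f 1 + b 0) / 4) ((c 0 + f 2) / 4) j)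
     (vec4 ((c 0 - f 2) / 4) ((f 1 + b 0) / 4) ((1 - f 0 + b 1 - c 2) / 4) ((b 2 + c 1) / 4) j)
     (vec4 ((f 1 - b 0) / 4) ((c 0 + f 2) / 4) ((b 2 + c 1) / 4) ((1 - f 0 - b 1 + c 2) / 4) j) i)"

lemma quat_sphereD: "q \<in> topspace (nsphere 3) \<Longrightarrow> q 0 * q 0 + q 1 * q 1 + q 2 * q 2 + q 3 * q 3 = 1"
  by (simp add: topspace_nsphere inner_upto_def sum_atMost_3)

lemma orthonormal_quat:
  assumes "q \<in> topspace (nsphere 3)"
  shows "orthonormal_pair (quat_f q) (quat_c q)"
proof -
  note q = quat_sphereD[OF assms]
  have "(a * a + b * b - c * c - d * d) * (a * a + b * b - c * c - d * d) + 2 * (b * c + a * d) * (2 * (b * c + a * d)) +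
      2 * (b * d - a * c) * (2 * (b * d - a * c)) = (a * a + b * b + c * c + d * d) * (a * a + b * b + c * c + d * d)"
    "2 * (b * d + a * c) * (2 * (b * d + a * c)) + 2 * (c * d - a * b) * (2 * (c * d - a * b)) +
      (a * a - b * b - c * c + d * d) * (a * a - b * b - c * c + d * d) = (a * a + b * b + c * c + d * d) * (a * a + b * b + c * c + d * d)"
    "(a * a + b * b - c * c - d * d) * (2 * (b * d + a * c)) + 2 * (b * c + a * d) * (2 * (c * d - a * b)) +
      2 * (b * d - a * c) * (a * a - b * b - c * c + d * d) = 0" for a b c d :: real
    by algebra+
  then show ?thesis
    unfolding orthonormal_pair_def quat_f_def quat_c_def vec3_in_sphere inner_upto_2 vec3_simps
    using q by (simp only: mult_1_left simp_thms)
qed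

text \<open>The middle column of the rotation. As polynomials, both sides differ by the factor
  \<open>?N\<close>, the squared norm of \<open>q\<close>.\<close>

lemma cross3d_quat:
  assumes "q \<in> topspace (nsphere 3)"
  shows "cross3d (quat_c q) (quat_f q) = vec3 (2 * (q 1 * q 2 - q 0 * q 3))
    (q 0 * q 0 - q 1 * q 1 + q 2 * q 2 - q 3 * q 3) (2 * (q 2 * q 3 + q 0 * q 1))"
proof -
  let ?N = "q 0 * q 0 + q 1 * q 1 + q 2 * q 2 + q 3 * q 3"
  have "cross3d (quat_c q) (quat_f q) = vec3 (?N * (2 * (q 1 * q 2 - q 0 * q 3)))
    (?N * (q 0 * q 0 - q 1 * q 1 + q 2 * q 2 - q 3 * q 3)) (?N * (2 * (q 2 * q 3 + q 0 * q 1)))"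
    unfolding cross3d_def quat_f_def quat_c_def vec3_simps vec3_eq_iff by (intro conjI; algebra)
  then show ?thesis unfolding quat_sphereD[OF assms] by simp
qed

lemma ball_0123: "(\<forall>k\<in>{0, 1, 2, 3 :: nat}. P k) \<longleftrightarrow> P 0 \<and> P 1 \<and> P 2 \<and> P 3"
  by simp

lemma le_3_iff: "(k::nat) \<le> 3 \<longleftrightarrow> k \<in> {0, 1, 2, 3}"
  by auto

lemma quat_matrix_quat:
  assumes q: "q \<in> topspace (nsphere 3)" and ij: "i \<le> 3" "j \<le> 3"
  shows "quat_matrix (quat_f q) (quat_c q) i j = q i * q j"
proof -
  have eq: "x / 4 = y" if "x = 4 * y" for x y :: real using that by simp
  have "\<forall>i\<in>{0, 1, 2, 3}. \<forall>j\<in>{0, 1, 2, 3}. quat_matrix (quat_f q) (quat_c q) i j = q i * q j"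
    unfolding ball_0123 quat_matrix_def Let_def cross3d_quat[OF q]
    unfolding quat_f_def quat_c_def vec3_simps vec4_simps
    by (insert quat_sphereD[OF q]; intro conjI; rule eq; simp add: algebra_simps)
  then show ?thesis using ij unfolding le_3_iff by blast
qed

text \<open>The minors through a diagonal entry vanish, so the symmetric matrix attached to a
  rotation is determined by any row with nonzero diagonal entry. This rank one property is what
  produces a quaternion.\<close>

lemma quat_matrix_minor:
  assumes fc: "orthonormal_pair f c" and ijk: "i \<le> 3" "j \<le> 3" "k \<le> 3"
  shows "quat_matrix f c i i * quat_matrix f c j k = quat_matrix f c i j * quat_matrix f c i k"
proof -
  have eq: "(x / 4) * (y / 4) = (z / 4) * (w / 4)" if "x * y = z * w" for x y z w :: real using that by simp
  define b where "b = cross3d c f"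
  have b: "b 0 = c 1 * f 2 - c 2 * f 1" "b 1 = c 2 * f 0 - c 0 * f 2" "b 2 = c 0 * f 1 - c 1 * f 0"
    by (simp_all add: b_def cross3d_def)
  have "\<forall>i\<in>{0, 1, 2, 3}. \<forall>j\<in>{0, 1, 2, 3}. \<forall>k\<in>{0, 1, 2, 3}.
      quat_matrix f c i i * quat_matrix f c j k = quat_matrix f c i j * quat_matrix f c i k"
    unfolding ball_0123 quat_matrix_def Let_def b_def[symmetric] vec4_simps
    by (insert orthonormal_pairD[OF fc] b; intro conjI; rule eq; (rule refl | rule mult.commute | algebra))
  then show ?thesis using ijk unfolding le_3_iff by blast
qed

lemma quat_matrix_trace: "quat_matrix f c 0 0 + quat_matrix f c 1 1 + quat_matrix f c 2 2 + quat_matrix f c 3 3 = 1"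
  by (simp add: quat_matrix_def Let_def field_simps)

text \<open>The affine formulas for \<open>quat_matrix\<close> can be inverted: for instance
  \<open>f 0\<close> is the alternating sum, with signs plus, plus, minus, minus, of the diagonal
  entries. Hence the products \<open>q i * q j\<close> fix the rotation.\<close>

lemma quat_matrix_determines:
  assumes fc: "f \<in> topspace (nsphere 2)" "c \<in> topspace (nsphere 2)"
    and q: "\<And>i j. i \<le> 3 \<Longrightarrow> j \<le> 3 \<Longrightarrow> quat_matrix f c i j = q i * q j"
  shows "quat_f q = f" "quat_c q = c"
proof -
  have "quat_f q = vec3 (f 0) (f 1) (f 2)"
    unfolding quat_f_def vec3_eq_iff
    by (simp add: q[symmetric] quat_matrix_def Let_def field_simps)
  then show "quat_f q = f" using vec3_of_sphere[OF fc(1)] by simp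
  have "quat_c q = vec3 (c 0) (c 1) (c 2)"
    unfolding quat_c_def vec3_eq_iff
    by (simp add: q[symmetric] quat_matrix_def Let_def field_simps)
  then show "quat_c q = c" using vec3_of_sphere[OF fc(2)] by simp
qed

text \<open>The trace is 1, so some diagonal entry is positive, and the quaternion is that row
  divided by the root of this entry. The row cannot be fixed beforehand: the entry with index 0
  vanishes for half-turns.\<close>

lemma quat_exists:
  assumes fc: "orthonormal_pair f c"
  obtains q where "q \<in> topspace (nsphere 3)" "\<And>i j. i \<le> 3 \<Longrightarrow> j \<le> 3 \<Longrightarrow> quat_matrix f c i j = q i * q j"
proof -
  let ?K = "quat_matrix f c"
  obtain i where i: "i \<le> 3" "?K i i > 0"
  proof (rule ccontr)
    assume "\<not> thesis"
    then have "?K i i \<le> 0" if "i \<le> 3" for i using that \<open>\<And>i. i \<le> 3 \<Longrightarrow> 0 < ?K i i \<Longrightarrow> thesis\<close> by force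
    from this[of 0] this[of 1] this[of 2] this[of 3] show False using quat_matrix_trace[of f c] by linarith
  qed
  define q where "q k = (if k \<le> 3 then ?K i k / sqrt (?K i i) else 0)" for k
  have q: "?K j k = q j * q k" if "j \<le> 3" "k \<le> 3" for j k
  proof -
    have "q j * q k = ?K i j * ?K i k / ?K i i"
      using that i(2) by (simp add: q_def)
    also have "\<dots> = ?K j k"
      using quat_matrix_minor[OF fc i(1) that] i(2) by (simp add: field_simps)
    finally show ?thesis by simp
  qed
  have "inner_upto 3 q q = 1"
    using quat_matrix_trace[of f c] by (simp add: inner_upto_def sum_atMost_3 q)
  then have "q \<in> topspace (nsphere 3)"
    by (simp add: topspace_nsphere q_def)
  then show thesis using that q by blast
qed

section \<open>Stereographic coordinates\<close>

definition stereo :: "complex \<Rightarrow> nat \<Rightarrow> real" where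
  "stereo z = vec3 (2 * Re z / ((Re z)\<^sup>2 + (Im z)\<^sup>2 + 1)) (2 * Im z / ((Re z)\<^sup>2 + (Im z)\<^sup>2 + 1))
     (((Re z)\<^sup>2 + (Im z)\<^sup>2 - 1) / ((Re z)\<^sup>2 + (Im z)\<^sup>2 + 1))"

definition stereo_inv :: "(nat \<Rightarrow> real) \<Rightarrow> complex" where
  "stereo_inv y = Complex (y 0 / (1 - y 2)) (y 1 / (1 - y 2))"

lemma stereo_denominator_pos: "(Re z)\<^sup>2 + (Im z)\<^sup>2 + 1 > 0"
  by (smt (verit) zero_le_power2)

lemma stereo_in_sphere: "stereo z \<in> topspace (nsphere 2)"
proof -
  have eq: "(2 * x / D) * (2 * x / D) + (2 * y / D) * (2 * y / D) + ((D - 2) / D) * ((D - 2) / D) = 1"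
    if "D = x\<^sup>2 + y\<^sup>2 + 1" "D > 0" for x y D :: real
  proof -
    have "(2 * x) * (2 * x) + (2 * y) * (2 * y) + (D - 2) * (D - 2) = D * D"
      using that(1) by algebra
    then show ?thesis using that(2) by (simp add: add_divide_distrib[symmetric])
  qed
  have "(Re z)\<^sup>2 + (Im z)\<^sup>2 - 1 = ((Re z)\<^sup>2 + (Im z)\<^sup>2 + 1) - 2" by simp
  then show ?thesis
    unfolding stereo_def vec3_in_sphere using eq[OF refl stereo_denominator_pos, of z] by simp
qed

lemma stereo_neq_pole: "stereo z 2 < 1"
  using stereo_denominator_pos[of z] by (simp add: stereo_def)

lemma stereo_inv_stereo: "stereo_inv (stereo z) = z"
proof -
  let ?D = "(Re z)\<^sup>2 + (Im z)\<^sup>2 + 1"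
  have D: "?D > 0" by (rule stereo_denominator_pos)
  have "1 - stereo z 2 = 2 / ?D" using D by (simp add: stereo_def field_simps)
  moreover have "(2 * x / D) / (2 / D) = x" if "D > 0" for x D :: real using that by simp
  ultimately show ?thesis
    unfolding stereo_inv_def using D by (simp add: complex_eq_iff) (simp add: stereo_def)
qed

lemma sphere_2_less_1:
  assumes "y \<in> topspace (nsphere 2)" "y \<noteq> vec3 0 0 1"
  shows "y 2 < 1"
proof -
  have y: "y 0 * y 0 + y 1 * y 1 + y 2 * y 2 = 1"
    using assms(1) by (simp only: topspace_nsphere mem_Collect_eq inner_upto_2)
  have "y 2 * y 2 \<le> 1" using y by (smt (verit) zero_le_square)
  then have "y 2 \<le> 1" by (metis abs_le_square_iff abs_le_D1 abs_one power2_eq_square power_one)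
  moreover have "y 2 \<noteq> 1"
  proof
    assume y2: "y 2 = 1"
    then have "y 0 * y 0 + y 1 * y 1 = 0" using y by simp
    then have "y 0 = 0" "y 1 = 0" using sum_squares_eq_zero_iff by blast+
    then show False using assms(2) vec3_of_sphere[OF assms(1)] y2 by simp
  qed
  ultimately show ?thesis by simp
qed

lemma stereo_stereo_inv:
  assumes "y \<in> topspace (nsphere 2)" "y \<noteq> vec3 0 0 1"
  shows "stereo (stereo_inv y) = y"
proof -
  have y: "y 0 * y 0 + y 1 * y 1 + y 2 * y 2 = 1"
    using assms(1) by (simp only: topspace_nsphere mem_Collect_eq inner_upto_2)
  define e where "e = 1 - y 2"
  have e: "e > 0" using sphere_2_less_1[OF assms] by (simp add: e_def)
  \<comment> \<open>On the sphere
    \<open>y 0 * y 0 + y 1 * y 1 = (1 - y 2) * (1 + y 2) = e * (2 - e)\<close>.\<close>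
  have sq: "(y 0 / e)\<^sup>2 + (y 1 / e)\<^sup>2 = 2 / e - 1"
  proof -
    have "y 0 * y 0 + y 1 * y 1 = 2 * e - e * e" using y unfolding e_def by algebra
    then have "(y 0 * y 0 + y 1 * y 1) / (e * e) = (2 * e - e * e) / (e * e)" by simp
    then show ?thesis using e by (simp add: power2_eq_square add_divide_distrib diff_divide_distrib)
  qed
  have "stereo (stereo_inv y) = vec3 (2 * (y 0 / e) / (2 / e - 1 + 1)) (2 * (y 1 / e) / (2 / e - 1 + 1)) ((2 / e - 1 - 1) / (2 / e - 1 + 1))"
    unfolding stereo_def stereo_inv_def e_def[symmetric] using sq by simp
  also have "\<dots> = vec3 (y 0) (y 1) (y 2)"
  proof -
    have "2 * (t / e) / (2 / e - 1 + 1) = t" for t using e by simp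
    moreover have "(2 / e - 1 - 1) / (2 / e - 1 + 1) = 1 - e" using e by (simp add: field_simps)
    ultimately show ?thesis unfolding vec3_eq_iff by (simp add: e_def)
  qed
  finally show ?thesis using vec3_of_sphere[OF assms(1)] by simp
qed

lemma stereo_inv_antipode_stereo:
  assumes "w \<noteq> 0"
  shows "stereo_inv (antipode (stereo w)) = - 1 / cnj w"
proof -
  let ?n = "(Re w)\<^sup>2 + (Im w)\<^sup>2"
  have n: "?n > 0" using assms complex_neq_0 by blast
  have eq: "(- (2 * x / (n + 1))) / (1 - - ((n - 1) / (n + 1))) = - x / n" if "n > 0" for x n :: real
  proof -
    have "1 - - ((n - 1) / (n + 1)) = 2 * n / (n + 1)" using that by (simp add: field_simps)
    moreover have "(- (2 * x / d)) / (2 * n / d) = - x / n" if "d > 0" for d :: real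
      using that \<open>n > 0\<close> by simp
    then have "(- (2 * x / (n + 1))) / (2 * n / (n + 1)) = - x / n"
      using that by simp
    ultimately show ?thesis by simp
  qed
  have "- 1 / cnj w = Complex (- Re w / ?n) (- Im w / ?n)"
    by (simp add: complex_eq_iff Re_divide Im_divide)
  then show ?thesis
    unfolding stereo_inv_def stereo_def vec3_minus vec3_simps using eq[OF n] by simp
qed

lemma stereo_eq_iff: "stereo z = stereo w \<longleftrightarrow> z = w"
  by (metis stereo_inv_stereo)

lemma stereo_0: "stereo 0 = vec3 0 0 (-1)"
  by (simp add: stereo_def)

text \<open>The origin of the condition \<open>z j * cnj (z k) \<noteq> -1\<close> in
  \<open>planar_configurations\<close>. The assumption on \<open>w\<close> excludes the point whose
  antipode is the pole at infinity.\<close>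

lemma stereo_eq_antipode_iff:
  assumes "w \<noteq> 0"
  shows "stereo z = antipode (stereo w) \<longleftrightarrow> z * cnj w = -1"
proof -
  have cw: "cnj w \<noteq> 0" using assms by simp
  have "antipode (stereo w) \<noteq> vec3 0 0 1"
  proof
    assume *: "antipode (stereo w) = vec3 0 0 1"
    have "stereo w k = antipode (vec3 0 0 1) k" for k using fun_cong[OF *, of k] by linarith
    then have "stereo w = antipode (vec3 0 0 1)" by blast
    then have "stereo w = stereo 0" by (simp add: vec3_minus stereo_0)
    then show False using assms stereo_eq_iff by blast
  qed
  then have "stereo (- 1 / cnj w) = antipode (stereo w)"
    using stereo_stereo_inv[of "antipode (stereo w)"] stereo_inv_antipode_stereo[OF assms] antipode_in_nsphere[OF stereo_in_sphere] by simp
  then have "stereo z = antipode (stereo w) \<longleftrightarrow> z = - 1 / cnj w"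
    using stereo_eq_iff by metis
  also have "\<dots> \<longleftrightarrow> z * cnj w = -1" using nonzero_eq_divide_eq[OF cw] .
  finally show ?thesis .
qed

lemma continuous_map_cross3d:
  assumes "\<And>k. k \<le> 2 \<Longrightarrow> continuous_map X euclideanreal (\<lambda>x. u x k)" "\<And>k. k \<le> 2 \<Longrightarrow> continuous_map X euclideanreal (\<lambda>x. v x k)"
  shows "continuous_map X euclideanreal (\<lambda>x. cross3d (u x) (v x) k)"
  unfolding cross3d_def using assms
  by (intro continuous_map_vec3 continuous_map_diff continuous_map_real_mult) auto

lemma continuous_map_inner_upto:
  assumes "\<And>k. k \<le> m \<Longrightarrow> continuous_map X euclideanreal (\<lambda>x. u x k)" "\<And>k. k \<le> m \<Longrightarrow> continuous_map X euclideanreal (\<lambda>x. v x k)"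
  shows "continuous_map X euclideanreal (\<lambda>x. inner_upto m (u x) (v x))"
  unfolding inner_upto_def using assms by (intro continuous_map_sum continuous_map_real_mult) auto

context
  fixes X :: "'a topology" and f c :: "'a \<Rightarrow> nat \<Rightarrow> real"
  assumes f: "\<And>k. k \<le> 2 \<Longrightarrow> continuous_map X euclideanreal (\<lambda>x. f x k)"
    and c: "\<And>k. k \<le> 2 \<Longrightarrow> continuous_map X euclideanreal (\<lambda>x. c x k)"
begin

lemma continuous_map_frame_apply:
  assumes "\<And>k. k \<le> 2 \<Longrightarrow> continuous_map X euclideanreal (\<lambda>x. y x k)"
  shows "continuous_map X euclideanreal (\<lambda>x. frame_apply (f x) (c x) (y x) k)"
  unfolding frame_apply_def using assms f c
  by (intro continuous_map_vec3 continuous_map_add continuous_map_real_mult continuous_map_cross3d) auto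

lemma continuous_map_frame_coords:
  assumes "\<And>k. k \<le> 2 \<Longrightarrow> continuous_map X euclideanreal (\<lambda>x. y x k)"
  shows "continuous_map X euclideanreal (\<lambda>x. frame_coords (f x) (c x) (y x) k)"
  unfolding frame_coords_def using assms f c
  by (intro continuous_map_vec3 continuous_map_inner_upto continuous_map_cross3d) auto

lemma continuous_map_quat_matrix: "continuous_map X euclideanreal (\<lambda>x. quat_matrix (f x) (c x) i j)"
  unfolding quat_matrix_def Let_def using f c
  by (intro continuous_map_vec4 continuous_map_real_divide continuous_map_add continuous_map_diff continuous_map_cross3d) auto

end

lemma continuous_map_stereo:
  assumes "continuous_map X euclidean z"
  shows "continuous_map X euclideanreal (\<lambda>x. stereo (z x) k)"
proof -
  have nz: "(Re w)\<^sup>2 + (Im w)\<^sup>2 + 1 \<noteq> 0" for w using stereo_denominator_pos[of w] by simp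
  have c: "continuous_on UNIV (\<lambda>w. 2 * Re w / ((Re w)\<^sup>2 + (Im w)\<^sup>2 + 1))"
    "continuous_on UNIV (\<lambda>w. 2 * Im w / ((Re w)\<^sup>2 + (Im w)\<^sup>2 + 1))"
    "continuous_on UNIV (\<lambda>w. ((Re w)\<^sup>2 + (Im w)\<^sup>2 - 1) / ((Re w)\<^sup>2 + (Im w)\<^sup>2 + 1))"
    using nz by (auto intro!: continuous_intros)
  have "continuous_on UNIV (\<lambda>w. stereo w k)"
    unfolding stereo_def vec3_def
    by (cases "k = 0"; cases "k = 1"; cases "k = 2"; simp only: if_True if_False simp_thms c continuous_on_const)
  from continuous_map_continuous_on_UNIV_compose[OF assms this] show ?thesis .
qed

lemma continuous_map_stereo_inv:
  assumes "\<And>k. k \<le> 2 \<Longrightarrow> continuous_map X euclideanreal (\<lambda>x. y x k)" "\<And>x. x \<in> topspace X \<Longrightarrow> y x 2 < 1"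
  shows "continuous_map X euclidean (\<lambda>x. stereo_inv (y x))"
proof -
  have *: "continuous_map X euclidean (\<lambda>x. of_real (y x 0 / (1 - y x 2)) + \<i> * of_real (y x 1 / (1 - y x 2)))"
    using assms by (intro continuous_map_add continuous_map_mult continuous_map_complex_of_real continuous_map_real_divide
        continuous_map_diff) (auto dest: assms(2))
  have "of_real a + \<i> * of_real b = Complex a b" for a b by (simp add: complex_eq_iff)
  from *[unfolded this] show ?thesis unfolding stereo_inv_def .
qed

section \<open>Configurations on the sphere and rotations\<close>

text \<open>The normalized component of \<open>x 1\<close> orthogonal to \<open>x 0\<close>, the
  first vector of the frame whose third vector is \<open>x 0\<close>.\<close>

definition config_f :: "(nat \<Rightarrow> nat \<Rightarrow> real) \<Rightarrow> nat \<Rightarrow> real" where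
  "config_f x = (let d = inner_upto 2 (x 0) (x 1); s = sqrt (1 - d * d) in
     vec3 ((x 1 0 - d * x 0 0) / s) ((x 1 1 - d * x 0 1) / s) ((x 1 2 - d * x 0 2) / s))"

definition config_matrix :: "(nat \<Rightarrow> nat \<Rightarrow> real) \<Rightarrow> nat \<Rightarrow> nat \<Rightarrow> real" where
  "config_matrix x = quat_matrix (config_f x) (x 0)"

definition config_map :: "nat \<Rightarrow> (nat \<Rightarrow> real) \<times> (nat \<Rightarrow> complex) \<Rightarrow> nat \<Rightarrow> nat \<Rightarrow> real" where
  "config_map n e = (\<lambda>j\<in>{..<n}. frame_apply (quat_f (fst e)) (quat_c (fst e)) (if j = 0 then vec3 0 0 1 else stereo (snd e j)))"

text \<open>\<open>config_matrix x\<close> is the projection to the line spanned by the two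
  quaternions of \<open>x\<close>. Normalizing the image of \<open>fst e\<close> selects the one
  with positive inner product with \<open>fst e\<close>. The planar part is the configuration seen
  in its own frame and depends on \<open>x\<close> only.\<close>

definition config_transport :: "nat \<Rightarrow> (nat \<Rightarrow> real) \<times> (nat \<Rightarrow> complex) \<Rightarrow> (nat \<Rightarrow> nat \<Rightarrow> real) \<Rightarrow> (nat \<Rightarrow> real) \<times> (nat \<Rightarrow> complex)" where
  "config_transport n e x =
     ((\<lambda>k. if k \<le> 3 then (\<Sum>l\<le>3. config_matrix x k l * fst e l) / sqrt (\<Sum>k\<le>3. \<Sum>l\<le>3. config_matrix x k l * (fst e k * fst e l)) else 0),
      (\<lambda>j\<in>{1..<n}. stereo_inv (frame_coords (config_f x) (x 0) (x j))))"

definition close_configurations :: "nat \<Rightarrow> ((nat \<Rightarrow> nat \<Rightarrow> real) \<times> (nat \<Rightarrow> nat \<Rightarrow> real)) set" where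
  "close_configurations n = {x \<in> topspace (prod_topology (spherical_configurations 2 n) (spherical_configurations 2 n)).
     (\<Sum>k\<le>3. \<Sum>l\<le>3. config_matrix (fst x) k l * config_matrix (snd x) k l) \<in> {0<..}}"

context
  fixes n :: nat
  assumes n: "n \<ge> 2"
begin

lemma spherical_configurationsD:
  assumes "x \<in> topspace (spherical_configurations 2 n)"
  shows "x 0 \<in> topspace (nsphere 2)" "x 1 \<in> topspace (nsphere 2)" "x 1 \<noteq> x 0" "x 1 \<noteq> antipode (x 0)"
  using assms n unfolding topspace_spherical_configurations by auto

text \<open>For \<open>d\<close> the inner product, \<open>1 - d * d\<close> is the squared length
  of the component of \<open>x 1\<close> orthogonal to \<open>x 0\<close>. It vanishes only when
  \<open>x 1\<close> is \<open>x 0\<close> or its antipode.\<close>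

lemma config_inner_less_1:
  assumes x: "x \<in> topspace (spherical_configurations 2 n)"
  shows "1 - inner_upto 2 (x 0) (x 1) * inner_upto 2 (x 0) (x 1) > 0"
proof -
  note G = spherical_configurationsD[OF x]
  let ?a = "x 0" and ?b = "x 1"
  let ?d = "inner_upto 2 ?a ?b"
  have a: "?a 0 * ?a 0 + ?a 1 * ?a 1 + ?a 2 * ?a 2 = 1" and b: "?b 0 * ?b 0 + ?b 1 * ?b 1 + ?b 2 * ?b 2 = 1"
    using G(1,2) by (simp_all only: topspace_nsphere mem_Collect_eq inner_upto_2)
  have d: "?d = ?a 0 * ?b 0 + ?a 1 * ?b 1 + ?a 2 * ?b 2" by (rule inner_upto_2)
  have sq: "(?b 0 - ?d * ?a 0)\<^sup>2 + (?b 1 - ?d * ?a 1)\<^sup>2 + (?b 2 - ?d * ?a 2)\<^sup>2 = 1 - ?d * ?d"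
    using a b d by algebra
  then have ge: "1 - ?d * ?d \<ge> 0" by (metis add_nonneg_nonneg zero_le_power2)
  have "1 - ?d * ?d \<noteq> 0"
  proof
    assume 0: "1 - ?d * ?d = 0"
    have z: "p = 0" if "p\<^sup>2 + q\<^sup>2 + r\<^sup>2 = (0::real)" for p q r
      using that by (metis add_nonneg_eq_0_iff add_nonneg_nonneg power_eq_0_iff zero_le_power2)
    have bk: "?b 0 = ?d * ?a 0" "?b 1 = ?d * ?a 1" "?b 2 = ?d * ?a 2"
      using sq[unfolded 0] z[of "?b 0 - ?d * ?a 0" "?b 1 - ?d * ?a 1" "?b 2 - ?d * ?a 2"]
        z[of "?b 1 - ?d * ?a 1" "?b 0 - ?d * ?a 0" "?b 2 - ?d * ?a 2"]
        z[of "?b 2 - ?d * ?a 2" "?b 0 - ?d * ?a 0" "?b 1 - ?d * ?a 1"] by (simp_all add: ac_simps)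
    have "?d = 1 \<or> ?d = -1" using 0 by (metis eq_iff_diff_eq_0 power2_eq_1_iff power2_eq_square)
    then have "?b = ?a \<or> ?b = antipode ?a"
    proof
      assume d1: "?d = 1"
      have "vec3 (?b 0) (?b 1) (?b 2) = vec3 (?a 0) (?a 1) (?a 2)" unfolding vec3_eq_iff using bk unfolding d1 by simp
      then show ?thesis using vec3_of_sphere[OF G(1)] vec3_of_sphere[OF G(2)] by simp
    next
      assume d1: "?d = -1"
      have "vec3 (?b 0) (?b 1) (?b 2) = vec3 (- ?a 0) (- ?a 1) (- ?a 2)" unfolding vec3_eq_iff using bk unfolding d1 by simp
      then have "?b = antipode (vec3 (?a 0) (?a 1) (?a 2))" using vec3_of_sphere[OF G(2)] by (simp add: vec3_minus)
      then show ?thesis using vec3_of_sphere[OF G(1)] by simp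
    qed
    then show False using G(3,4) by blast
  qed
  then show ?thesis using ge by linarith
qed

text \<open>In its own frame the configuration is normalized: the first point is the pole, and the
  second lies on the half great circle that corresponds to the positive reals.\<close>

lemma config_frame:
  assumes x: "x \<in> topspace (spherical_configurations 2 n)"
  defines "d \<equiv> inner_upto 2 (x 0) (x 1)"
  shows "orthonormal_pair (config_f x) (x 0)"
    and "frame_coords (config_f x) (x 0) (x 0) = vec3 0 0 1"
    and "frame_coords (config_f x) (x 0) (x 1) = vec3 (sqrt (1 - d * d)) 0 d"
proof -
  note G = spherical_configurationsD[OF x]
  let ?a = "x 0" and ?b = "x 1"
  define s where "s = sqrt (1 - d * d)"
  have a: "?a 0 * ?a 0 + ?a 1 * ?a 1 + ?a 2 * ?a 2 = 1" and b: "?b 0 * ?b 0 + ?b 1 * ?b 1 + ?b 2 * ?b 2 = 1"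
    using G(1,2) by (simp_all only: topspace_nsphere mem_Collect_eq inner_upto_2)
  have dd: "d = ?a 0 * ?b 0 + ?a 1 * ?b 1 + ?a 2 * ?b 2" unfolding d_def by (rule inner_upto_2)
  have s: "s > 0" "s * s = 1 - d * d"
    using config_inner_less_1[OF x] by (simp_all add: s_def d_def)
  let ?f = "config_f x"
  have f: "?f = vec3 ((?b 0 - d * ?a 0) / s) ((?b 1 - d * ?a 1) / s) ((?b 2 - d * ?a 2) / s)"
    by (simp add: config_f_def Let_def d_def s_def)
  \<comment> \<open>Multiplying by \<open>s\<close> removes the denominators, so that orthonormality
    becomes a polynomial identity that can be cancelled afterwards.\<close>
  have sf: "s * ?f 0 = ?b 0 - d * ?a 0" "s * ?f 1 = ?b 1 - d * ?a 1" "s * ?f 2 = ?b 2 - d * ?a 2"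
    using s(1) by (simp_all add: f)
  have "s * s * (?f 0 * ?f 0 + ?f 1 * ?f 1 + ?f 2 * ?f 2) = s * s * 1"
    using sf s(2) a b dd by algebra
  then have ff: "?f 0 * ?f 0 + ?f 1 * ?f 1 + ?f 2 * ?f 2 = 1"
    using s(1) by (simp only: mult_cancel_left) simp
  have "s * (?f 0 * ?a 0 + ?f 1 * ?a 1 + ?f 2 * ?a 2) = s * 0"
    using sf a dd by algebra
  then have fa: "?f 0 * ?a 0 + ?f 1 * ?a 1 + ?f 2 * ?a 2 = 0"
    using s(1) by (simp only: mult_cancel_left) simp
  have fS: "?f \<in> topspace (nsphere 2)"
    using ff unfolding f vec3_in_sphere by simp
  show on: "orthonormal_pair ?f ?a"
    unfolding orthonormal_pair_def inner_upto_2 using fS G(1) fa by blast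
  have "frame_apply ?f ?a (vec3 0 0 1) = ?a"
    using vec3_of_sphere[OF G(1)] by (simp add: frame_apply_def)
  then show "frame_coords ?f ?a ?a = vec3 0 0 1"
    using frame_coords_apply[OF on, of "vec3 0 0 1"] by simp
  have "frame_apply ?f ?a (vec3 s 0 d) = ?b"
    using vec3_of_sphere[OF G(2)] sf by (simp add: frame_apply_def)
  then show "frame_coords ?f ?a ?b = vec3 (sqrt (1 - d * d)) 0 d"
    using frame_coords_apply[OF on, of "vec3 s 0 d"] by (simp add: s_def)
qed

lemma config_coords_neq_pole:
  assumes x: "x \<in> topspace (spherical_configurations 2 n)" and j: "0 < j" "j < n"
  shows "frame_coords (config_f x) (x 0) (x j) \<noteq> vec3 0 0 1"
    "frame_coords (config_f x) (x 0) (x j) \<in> topspace (nsphere 2)"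
proof -
  note on = config_frame(1)[OF x]
  have S: "x 0 \<in> topspace (nsphere 2)" "x j \<in> topspace (nsphere 2)" "x j \<noteq> x 0"
    using x j unfolding topspace_spherical_configurations by auto
  show "frame_coords (config_f x) (x 0) (x j) \<in> topspace (nsphere 2)"
    using frame_coords_sphere(1)[OF on S(2)] .
  show "frame_coords (config_f x) (x 0) (x j) \<noteq> vec3 0 0 1"
  proof
    assume "frame_coords (config_f x) (x 0) (x j) = vec3 0 0 1"
    then have "frame_coords (config_f x) (x 0) (x j) = frame_coords (config_f x) (x 0) (x 0)"
      using config_frame(2)[OF x] by simp
    then have "x j = x 0"
      using frame_coords_sphere(2)[OF on S(1)] frame_coords_sphere(2)[OF on S(2)] by metis
    then show False using S(3) by blast
  qed
qed

lemma config_map_in: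
  assumes q: "q \<in> topspace (nsphere 3)" and z: "z \<in> topspace (planar_configurations n)"
  shows "config_map n (q, z) \<in> topspace (spherical_configurations 2 n)"
proof -
  note on = orthonormal_quat[OF q]
  define y where "y j = (if j = 0 then vec3 0 0 1 else stereo (z j))" for j
  have y_S: "y j \<in> topspace (nsphere 2)" for j
    using stereo_in_sphere by (simp add: y_def vec3_in_sphere)
  have map: "config_map n (q, z) j = frame_apply (quat_f q) (quat_c q) (y j)" if "j < n" for j
    using that by (simp add: config_map_def y_def)
  have z_nz: "z j \<noteq> 0" if "j \<in> {1..<n}" for j
    using z that unfolding topspace_planar_configurations by blast
  have pole: "stereo w \<noteq> vec3 0 0 1" for w
    using stereo_neq_pole[of w] by (metis less_irrefl vec3_simps(4))
  have apole: "stereo w \<noteq> antipode (vec3 0 0 1)" if "w \<noteq> 0" for w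
    using that stereo_eq_iff[of w 0] by (simp add: vec3_minus stereo_0)
  have flip: "a = antipode b \<longleftrightarrow> b = antipode a" for a b :: "nat \<Rightarrow> real"
    by (auto simp: fun_eq_iff)
  have ne: "y i \<noteq> y j \<and> y i \<noteq> antipode (y j)" if ij: "i < n" "j < n" "i \<noteq> j" for i j
  proof (cases "i = 0")
    case True
    then have "j \<in> {1..<n}" "i = 0" "j \<noteq> 0" using ij by auto
    then have "stereo (z j) \<noteq> antipode (vec3 0 0 1)" "stereo (z j) \<noteq> vec3 0 0 1"
      using apole[OF z_nz] pole by blast+
    then show ?thesis using \<open>i = 0\<close> \<open>j \<noteq> 0\<close> flip[of "y i" "y j"] unfolding y_def by auto
  next
    case False
    then have i: "i \<in> {1..<n}" using ij by auto
    show ?thesis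
    proof (cases "j = 0")
      case True
      then show ?thesis using False apole[OF z_nz[OF i]] pole unfolding y_def by auto
    next
      case False
      then have j: "j \<in> {1..<n}" using ij by auto
      have "z i \<noteq> z j" "z i * cnj (z j) \<noteq> -1"
        using z i j ij(3) unfolding topspace_planar_configurations by blast+
      then show ?thesis
        using \<open>i \<noteq> 0\<close> \<open>j \<noteq> 0\<close> stereo_eq_iff stereo_eq_antipode_iff[OF z_nz[OF j]] unfolding y_def by auto
    qed
  qed
  have inj: "a = b" if "frame_apply (quat_f q) (quat_c q) a = frame_apply (quat_f q) (quat_c q) b"
    "a \<in> topspace (nsphere 2)" "b \<in> topspace (nsphere 2)" for a b
    using frame_apply_sphere(2)[OF on that(2)] frame_apply_sphere(2)[OF on that(3)] that(1) by metis
  show ?thesis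
    unfolding topspace_spherical_configurations
  proof (intro conjI allI impI)
    show "config_map n (q, z) \<in> extensional {..<n}" by (simp add: config_map_def)
    show "config_map n (q, z) j \<in> topspace (nsphere 2)" if "j < n" for j
      unfolding map[OF that] using frame_apply_sphere(1)[OF on y_S] .
    fix i j assume ij: "i < n" "j < n" "i \<noteq> j"
    show "config_map n (q, z) i \<noteq> config_map n (q, z) j"
      unfolding map[OF ij(1)] map[OF ij(2)] using inj[OF _ y_S y_S] ne[OF ij] by blast
    show "config_map n (q, z) i \<noteq> antipode (config_map n (q, z) j)"
      unfolding map[OF ij(1)] map[OF ij(2)] frame_apply_antipode[symmetric]
      using inj[OF _ y_S antipode_in_nsphere[OF y_S]] ne[OF ij] by blast
  qed
qed

text \<open>Gram-Schmidt recovers the rotation. Because \<open>z 1\<close> is a positive real, the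
  second point is \<open>u * f + d * c\<close> with \<open>u > 0\<close>, so its normalized
  component orthogonal to \<open>c\<close> is exactly \<open>f\<close>.\<close>

lemma config_map_frame:
  assumes q: "q \<in> topspace (nsphere 3)" and z: "z \<in> topspace (planar_configurations n)"
  shows "config_map n (q, z) 0 = quat_c q" "config_f (config_map n (q, z)) = quat_f q"
proof -
  note on = orthonormal_quat[OF q]
  let ?x = "config_map n (q, z)" and ?f = "quat_f q" and ?c = "quat_c q"
  have fS: "?f \<in> topspace (nsphere 2)" and cS: "?c \<in> topspace (nsphere 2)"
    using on by (auto simp: orthonormal_pair_def)
  have "?x 0 = frame_apply ?f ?c (vec3 0 0 1)" using n by (simp add: config_map_def)
  also have "\<dots> = ?c" using vec3_of_sphere[OF cS] by (simp add: frame_apply_def)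
  finally show x0: "?x 0 = ?c" .
  obtain r where r: "r > 0" "z 1 = of_real r" using z unfolding topspace_planar_configurations by blast
  have x1: "?x 1 = frame_apply ?f ?c (stereo (z 1))" using n by (simp add: config_map_def)
  define u d where "u = 2 * r / (r\<^sup>2 + 1)" and "d = (r\<^sup>2 - 1) / (r\<^sup>2 + 1)"
  have st: "stereo (z 1) = vec3 u 0 d" unfolding r(2) stereo_def by (simp add: u_def d_def)
  have u: "u > 0" using r(1) by (simp add: u_def add_pos_nonneg)
  have ud: "u * u + d * d = 1"
    using stereo_in_sphere[of "z 1"] unfolding st vec3_in_sphere by simp
  have "inner_upto 2 (?x 0) (?x 1) = inner_upto 2 (frame_apply ?f ?c (vec3 0 0 1)) (frame_apply ?f ?c (stereo (z 1)))"
    unfolding x1 using \<open>?x 0 = frame_apply ?f ?c (vec3 0 0 1)\<close> by simp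
  also have "\<dots> = d" unfolding inner_frame_apply[OF on] st by (simp add: inner_upto_2)
  finally have d: "inner_upto 2 (?x 0) (?x 1) = d" .
  have s: "sqrt (1 - d * d) = u"
    using u ud by (intro real_sqrt_unique) (auto simp: power2_eq_square)
  have x1k: "?x 1 0 = u * ?f 0 + d * ?c 0" "?x 1 1 = u * ?f 1 + d * ?c 1" "?x 1 2 = u * ?f 2 + d * ?c 2"
    unfolding x1 st by (simp_all add: frame_apply_def)
  have "config_f ?x = vec3 (?f 0) (?f 1) (?f 2)"
    unfolding config_f_def Let_def d s vec3_eq_iff unfolding x0 x1k using u by simp
  then show "config_f ?x = ?f" using vec3_of_sphere[OF fS] by simp
qed

lemma config_matrix_map:
  assumes "q \<in> topspace (nsphere 3)" "z \<in> topspace (planar_configurations n)" "k \<le> 3" "l \<le> 3"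
  shows "config_matrix (config_map n (q, z)) k l = q k * q l"
  unfolding config_matrix_def config_map_frame[OF assms(1,2)] using quat_matrix_quat[OF assms(1,3,4)] .

lemma config_quat:
  assumes x: "x \<in> topspace (spherical_configurations 2 n)"
  obtains r where "r \<in> topspace (nsphere 3)" "\<And>k l. k \<le> 3 \<Longrightarrow> l \<le> 3 \<Longrightarrow> config_matrix x k l = r k * r l"
  using quat_exists[OF config_frame(1)[OF x]] unfolding config_matrix_def by blast

lemma config_transport_fst:
  assumes r: "r \<in> topspace (nsphere 3)" "\<And>k l. k \<le> 3 \<Longrightarrow> l \<le> 3 \<Longrightarrow> config_matrix x k l = r k * r l"
    and nz: "inner_upto 3 r (fst e) \<noteq> 0"
  shows "fst (config_transport n e x) = (\<lambda>k. sgn (inner_upto 3 r (fst e)) * r k)"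
proof
  fix k
  let ?c = "inner_upto 3 r (fst e)"
  have r0: "r k = 0" if "k > 3" using r(1) that by (simp add: topspace_nsphere)
  have "(\<Sum>l\<le>3. config_matrix x k l * fst e l) = r k * ?c" if "k \<le> 3"
    using r(2)[OF that] by (simp add: inner_upto_def sum_distrib_left mult.assoc)
  moreover have "(\<Sum>k\<le>3. \<Sum>l\<le>3. config_matrix x k l * (fst e k * fst e l)) = ?c\<^sup>2"
    using r(2) inner_upto_square[of r "fst e" 3] by simp
  ultimately show "fst (config_transport n e x) k = sgn ?c * r k"
    using nz r0 by (auto simp: config_transport_def real_sgn_eq not_le)
qed

text \<open>Inequalities between points pass to the coordinates because \<open>frame_coords\<close>
  is injective on the sphere and commutes with antipodes. Positivity of \<open>z 1\<close> is the
  shape of the second point in its own frame.\<close>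

lemma config_transport_snd:
  assumes x: "x \<in> topspace (spherical_configurations 2 n)"
  shows "snd (config_transport n e x) \<in> topspace (planar_configurations n)"
    and "\<And>j. j \<in> {1..<n} \<Longrightarrow> stereo (snd (config_transport n e x) j) = frame_coords (config_f x) (x 0) (x j)"
proof -
  let ?z = "snd (config_transport n e x)"
  let ?y = "\<lambda>j. frame_coords (config_f x) (x 0) (x j)"
  note on = config_frame(1)[OF x]
  have zj: "?z j = stereo_inv (?y j)" if "j \<in> {1..<n}" for j using that by (simp add: config_transport_def)
  show st: "stereo (?z j) = ?y j" if "j \<in> {1..<n}" for j
    unfolding zj[OF that] using config_coords_neq_pole[OF x, of j] that by (intro stereo_stereo_inv) auto
  have xS: "x j \<in> topspace (nsphere 2)" if "j < n" for j
    using x that unfolding topspace_spherical_configurations by blast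
  have ne: "x i \<noteq> x j" "x i \<noteq> antipode (x j)" if "i < n" "j < n" "i \<noteq> j" for i j
    using x that unfolding topspace_spherical_configurations by blast+
  have inj: "x i = a" if "?y i = frame_coords (config_f x) (x 0) a" "i < n" "a \<in> topspace (nsphere 2)" for i a
    using frame_coords_sphere(2)[OF on xS[OF that(2)]] frame_coords_sphere(2)[OF on that(3)] that(1) by metis
  have z_nz: "?z j \<noteq> 0" if j: "j \<in> {1..<n}" for j
  proof
    assume "?z j = 0"
    then have "?y j = antipode (?y 0)"
      using st[OF j] config_frame(2)[OF x] by (simp add: stereo_0 vec3_minus)
    then have "?y j = frame_coords (config_f x) (x 0) (antipode (x 0))" by (simp add: frame_coords_antipode)
    then have "x j = antipode (x 0)" using j n xS[of 0] by (intro inj antipode_in_nsphere) auto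
    then show False using ne(2)[of j 0] j by auto
  qed
  have "?z i \<noteq> ?z j \<and> ?z i * cnj (?z j) \<noteq> -1" if i: "i \<in> {1..<n}" and j: "j \<in> {1..<n}" and "i \<noteq> j" for i j
  proof (intro conjI notI)
    assume "?z i = ?z j"
    then have "?y i = ?y j" using st[OF i] st[OF j] by simp
    then have "x i = x j" using i j xS[of j] by (intro inj) auto
    then show False using ne(1)[of i j] i j \<open>i \<noteq> j\<close> by auto
  next
    assume "?z i * cnj (?z j) = -1"
    from iffD2[OF stereo_eq_antipode_iff[OF z_nz[OF j]] this] have "?y i = antipode (?y j)"
      unfolding st[OF i] st[OF j] .
    then have "?y i = frame_coords (config_f x) (x 0) (antipode (x j))" by (simp add: frame_coords_antipode)
    then have "x i = antipode (x j)" using i j xS[of j] by (intro inj antipode_in_nsphere) auto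
    then show False using ne(2)[of i j] i j \<open>i \<noteq> j\<close> by auto
  qed
  moreover have "\<exists>r>0. ?z 1 = of_real r"
  proof -
    let ?d = "inner_upto 2 (x 0) (x 1)"
    have one: "1 \<in> {1..<n}" using n by auto
    have s: "sqrt (1 - ?d * ?d) > 0" using config_inner_less_1[OF x] by simp
    have "vec3 (sqrt (1 - ?d * ?d)) 0 ?d 2 < 1"
      using sphere_2_less_1[OF config_coords_neq_pole(2,1)[OF x, of 1]] n config_frame(3)[OF x] by simp
    then have "sqrt (1 - ?d * ?d) / (1 - ?d) > 0" using s by simp
    moreover have "?z 1 = of_real (sqrt (1 - ?d * ?d) / (1 - ?d))"
      unfolding zj[OF one] config_frame(3)[OF x] by (simp add: stereo_inv_def complex_eq_iff)
    ultimately show ?thesis by blast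
  qed
  moreover have "?z \<in> extensional {1..<n}" by (simp add: config_transport_def)
  ultimately show "?z \<in> topspace (planar_configurations n)"
    unfolding topspace_planar_configurations using z_nz by blast
qed

text \<open>Both signs of \<open>r\<close> give the same products and hence the same rotation, the
  frame of \<open>x\<close>. Applying it to the coordinates of \<open>x\<close> in this frame
  returns \<open>x\<close>.\<close>

lemma config_transport:
  assumes x: "x \<in> topspace (spherical_configurations 2 n)"
    and r: "r \<in> topspace (nsphere 3)" "\<And>k l. k \<le> 3 \<Longrightarrow> l \<le> 3 \<Longrightarrow> config_matrix x k l = r k * r l"
    and nz: "inner_upto 3 r (fst e) \<noteq> 0"
  shows "fst (config_transport n e x) \<in> topspace (nsphere 3)" "config_map n (config_transport n e x) = x"
proof -
  let ?q = "fst (config_transport n e x)" and ?z = "snd (config_transport n e x)"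
  have "?q = r \<or> ?q = antipode r"
    using config_transport_fst[OF r nz] nz by (auto simp: sgn_if)
  then show q: "?q \<in> topspace (nsphere 3)" using r(1) antipode_in_nsphere by metis
  have "?q k * ?q l = r k * r l" for k l
    using \<open>?q = r \<or> ?q = antipode r\<close> by (elim disjE) simp_all
  then have qq: "quat_matrix (config_f x) (x 0) k l = ?q k * ?q l" if "k \<le> 3" "l \<le> 3" for k l
    using r(2)[OF that] unfolding config_matrix_def by simp
  note on = config_frame(1)[OF x]
  have frame: "quat_f ?q = config_f x" "quat_c ?q = x 0"
    using quat_matrix_determines[OF _ _ qq] on unfolding orthonormal_pair_def by blast+
  show "config_map n (config_transport n e x) = x"
  proof (rule extensionalityI[of _ "{..<n}"])
    show "config_map n (config_transport n e x) \<in> extensional {..<n}" by (simp add: config_map_def)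
    show "x \<in> extensional {..<n}" using x unfolding topspace_spherical_configurations by blast
    fix j assume j: "j \<in> {..<n}"
    have xj: "x j \<in> topspace (nsphere 2)" using x j unfolding topspace_spherical_configurations by blast
    have "(if j = 0 then vec3 0 0 1 else stereo (?z j)) = frame_coords (config_f x) (x 0) (x j)"
      using config_frame(2)[OF x] config_transport_snd(2)[OF x, of j e] j by auto
    then have "config_map n (config_transport n e x) j = frame_apply (config_f x) (x 0) (frame_coords (config_f x) (x 0) (x j))"
      using j frame by (simp add: config_map_def)
    then show "config_map n (config_transport n e x) j = x j"
      using frame_coords_sphere(2)[OF on xj] by simp
  qed
qed

lemma close_configurations_iff:
  assumes q: "q \<in> topspace (nsphere 3)" and z: "z \<in> topspace (planar_configurations n)"
    and x: "x \<in> topspace (spherical_configurations 2 n)"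
    and r: "\<And>k l. k \<le> 3 \<Longrightarrow> l \<le> 3 \<Longrightarrow> config_matrix x k l = r k * r l"
  shows "(config_map n (q, z), x) \<in> close_configurations n \<longleftrightarrow> inner_upto 3 r q \<noteq> 0"
proof -
  have "(\<Sum>k\<le>3. \<Sum>l\<le>3. config_matrix (config_map n (q, z)) k l * config_matrix x k l) = (inner_upto 3 r q)\<^sup>2"
    using config_matrix_map[OF q z] r inner_upto_square[of r q 3] by (simp add: mult.commute)
  then show ?thesis
    using config_map_in[OF q z] x by (simp add: close_configurations_def)
qed

end

lemma Hausdorff_space_planar_configurations: "Hausdorff_space (planar_configurations n)"
  unfolding planar_configurations_def
  by (intro Hausdorff_space_subtopology) (simp add: Hausdorff_space_product_topology)

lemma continuous_map_config:
  assumes n: "n \<ge> 2" and k: "k \<le> 2"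
  shows "continuous_map (spherical_configurations 2 n) euclideanreal (\<lambda>x. config_f x k)"
    and "j < n \<Longrightarrow> continuous_map (spherical_configurations 2 n) euclideanreal (\<lambda>x. x j k)"
    and "continuous_map (spherical_configurations 2 n) euclideanreal (\<lambda>x. config_matrix x l l')"
proof -
  let ?G = "spherical_configurations 2 n"
  have x: "continuous_map ?G euclideanreal (\<lambda>x. x j k)" if "j < n" "k \<le> 2" for j k
    using continuous_map_spherical_configurations_coordinate that .
  then show "j < n \<Longrightarrow> continuous_map ?G euclideanreal (\<lambda>x. x j k)" using k by blast
  have d: "continuous_map ?G euclideanreal (\<lambda>x. inner_upto 2 (x 0) (x 1))"
    using n by (intro continuous_map_inner_upto x) auto
  have s: "sqrt (1 - inner_upto 2 (x 0) (x 1) * inner_upto 2 (x 0) (x 1)) \<noteq> 0" if "x \<in> topspace ?G" for x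
    using config_inner_less_1[OF n that] by simp
  have f: "continuous_map ?G euclideanreal (\<lambda>x. config_f x k)" for k
    unfolding config_f_def Let_def using n
    by (intro continuous_map_vec3 continuous_map_real_divide continuous_map_diff continuous_map_real_mult
        continuous_map_sqrt d x s) auto
  then show "continuous_map ?G euclideanreal (\<lambda>x. config_f x k)" .
  show "continuous_map ?G euclideanreal (\<lambda>x. config_matrix x l l')"
    unfolding config_matrix_def using n by (intro continuous_map_quat_matrix f x) auto
qed

lemma continuous_map_config_map:
  assumes n: "n \<ge> 2"
  shows "continuous_map (prod_topology (nsphere 3) (planar_configurations n)) (spherical_configurations 2 n) (config_map n)"
  unfolding continuous_map_spherical_configurations
proof (intro conjI allI impI funcsetI)
  let ?E = "prod_topology (nsphere 3) (planar_configurations n)"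
  show "config_map n e \<in> topspace (spherical_configurations 2 n)" if "e \<in> topspace ?E" for e
    using that config_map_in[OF n] by (cases e) auto
  fix j k assume j: "j < n" and k: "k \<le> (2::nat)"
  have q: "continuous_map ?E euclideanreal (\<lambda>e. fst e k)" for k
    using continuous_map_compose[OF continuous_map_fst continuous_map_nsphere_projection] by (simp add: o_def)
  have f: "continuous_map ?E euclideanreal (\<lambda>e. quat_f (fst e) k)" and c: "continuous_map ?E euclideanreal (\<lambda>e. quat_c (fst e) k)" for k
    unfolding quat_f_def quat_c_def
    by (intro continuous_map_vec3 continuous_map_diff continuous_map_add continuous_map_real_mult q; simp)+
  have y: "continuous_map ?E euclideanreal (\<lambda>e. (if j = 0 then vec3 0 0 1 else stereo (snd e j)) k)" for k
  proof (cases "j = 0")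
    case False
    have "continuous_map ?E euclidean (\<lambda>e. snd e j)"
      using continuous_map_compose[OF continuous_map_snd continuous_map_planar_configurations_coordinate[of j n]] j False
      by (simp add: o_def)
    then show ?thesis using False continuous_map_stereo by simp
  qed simp
  show "continuous_map ?E euclideanreal (\<lambda>e. config_map n e j k)"
    using continuous_map_frame_apply[OF f c y] j by (simp add: config_map_def)
qed

text \<open>A double covering: the planar part is determined by the configuration, and the rotation
  determines the quaternion up to sign. Positive inner product of the quaternions excludes the
  opposite sign.\<close>

lemma config_covering:
  assumes n: "n \<ge> 2"
  shows "covering_transport (prod_topology (nsphere 3) (planar_configurations n)) (spherical_configurations 2 n)
    (config_map n) (close_configurations n) (config_transport n)
    {x \<in> topspace (prod_topology (prod_topology (nsphere 3) (planar_configurations n)) (prod_topology (nsphere 3) (planar_configurations n))).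
       inner_upto 3 (fst (fst x)) (fst (snd x)) \<in> {0<..}}"
proof
  let ?E = "prod_topology (nsphere 3) (planar_configurations n)" and ?G = "spherical_configurations 2 n"
  show "continuous_map ?E ?G (config_map n)" by (rule continuous_map_config_map[OF n])
  have M: "continuous_map ?G euclideanreal (\<lambda>x. config_matrix x k l)" for k l
    using continuous_map_config(3)[OF n order_refl] .
  show "openin (prod_topology ?G ?G) (close_configurations n)"
    unfolding close_configurations_def
  proof (rule openin_continuous_map_preimage[where Y=euclideanreal])
    show "continuous_map (prod_topology ?G ?G) euclideanreal (\<lambda>x. \<Sum>k\<le>3. \<Sum>l\<le>3. config_matrix (fst x) k l * config_matrix (snd x) k l)"
      using continuous_map_compose[OF continuous_map_fst M, unfolded o_def] continuous_map_compose[OF continuous_map_snd M, unfolded o_def]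
      by (intro continuous_map_sum continuous_map_real_mult) auto
  qed simp
  have close: "\<exists>r. r \<in> topspace (nsphere 3) \<and> (\<forall>k\<le>3. \<forall>l\<le>3. config_matrix x k l = r k * r l) \<and> inner_upto 3 r (fst e) \<noteq> 0"
    if e: "e \<in> topspace ?E" and x: "x \<in> topspace ?G" and c: "(config_map n e, x) \<in> close_configurations n" for e x
  proof -
    obtain r where r: "r \<in> topspace (nsphere 3)" "\<And>k l. k \<le> 3 \<Longrightarrow> l \<le> 3 \<Longrightarrow> config_matrix x k l = r k * r l"
      using config_quat[OF n x] by blast
    then show ?thesis using close_configurations_iff[OF n _ _ x r(2)] e c by (cases e) auto
  qed
  have sph: "inner_upto 3 q q = 1" if "q \<in> topspace (nsphere 3)" for q
    using that by (simp add: topspace_nsphere)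
  show "(x, x) \<in> close_configurations n" if x: "x \<in> topspace ?G" for x
  proof -
    obtain r where r: "r \<in> topspace (nsphere 3)" "\<And>k l. k \<le> 3 \<Longrightarrow> l \<le> 3 \<Longrightarrow> config_matrix x k l = r k * r l"
      using config_quat[OF n x] by blast
    have "(\<Sum>k\<le>3. \<Sum>l\<le>3. config_matrix x k l * config_matrix x k l) = (inner_upto 3 r r)\<^sup>2"
      using r(2) inner_upto_square[of r r 3] by simp
    then show ?thesis using x sph[OF r(1)] by (simp add: close_configurations_def)
  qed
  let ?X = "subtopology (prod_topology ?E ?G) {(e, b). (config_map n e, b) \<in> close_configurations n}"
  have fstX: "continuous_map ?X ?E fst" and sndX: "continuous_map ?X ?G snd"
    by (intro continuous_map_from_subtopology continuous_map_fst continuous_map_snd)+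
  have X_cases: "fst z \<in> topspace ?E" "snd z \<in> topspace ?G" "(config_map n (fst z), snd z) \<in> close_configurations n"
    if "z \<in> topspace ?X" for z using that by (cases z, auto)+
  show "continuous_map ?X ?E (\<lambda>(e, b). config_transport n e b)"
  proof -
    have "continuous_map ?X (nsphere 3) (\<lambda>z. fst (config_transport n (fst z) (snd z)))"
      unfolding continuous_map_nsphere
    proof (intro conjI allI impI funcsetI)
      show "fst (config_transport n (fst z) (snd z)) \<in> topspace (nsphere 3)" if "z \<in> topspace ?X" for z
        using close[OF X_cases[OF that]] config_transport(1)[OF n X_cases(2)[OF that]] by blast
      fix k assume k: "k \<le> (3::nat)"
      have XM: "continuous_map ?X euclideanreal (\<lambda>z. config_matrix (snd z) k l)" for k l
        using continuous_map_compose[OF sndX M] by (simp add: o_def)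
      have "continuous_map ?X (nsphere 3) (\<lambda>z. fst (fst z))"
        using continuous_map_compose[OF fstX continuous_map_fst] by (simp add: o_def)
      from continuous_map_compose[OF this continuous_map_nsphere_projection]
      have Xq: "continuous_map ?X euclideanreal (\<lambda>z. fst (fst z) k)" for k by (simp add: o_def)
      have "continuous_map ?X euclideanreal (\<lambda>z. (\<Sum>l\<le>3. config_matrix (snd z) k l * fst (fst z) l) /
          sqrt (\<Sum>k\<le>3. \<Sum>l\<le>3. config_matrix (snd z) k l * (fst (fst z) k * fst (fst z) l)))"
      proof (intro continuous_map_real_divide continuous_map_sum continuous_map_real_mult continuous_map_sqrt XM Xq)
        fix z assume z: "z \<in> topspace ?X"
        obtain r where r: "\<And>k l. k \<le> 3 \<Longrightarrow> l \<le> 3 \<Longrightarrow> config_matrix (snd z) k l = r k * r l" "inner_upto 3 r (fst (fst z)) \<noteq> 0"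
          using close[OF X_cases[OF z]] by blast
        have "(\<Sum>k\<le>3. \<Sum>l\<le>3. config_matrix (snd z) k l * (fst (fst z) k * fst (fst z) l)) = (inner_upto 3 r (fst (fst z)))\<^sup>2"
          using r(1) inner_upto_square[of r "fst (fst z)" 3] by simp
        then show "sqrt (\<Sum>k\<le>3. \<Sum>l\<le>3. config_matrix (snd z) k l * (fst (fst z) k * fst (fst z) l)) \<noteq> 0"
          using r(2) by simp
      qed auto
      then show "continuous_map ?X euclideanreal (\<lambda>z. fst (config_transport n (fst z) (snd z)) k)"
        using k by (simp add: config_transport_def)
    qed
    moreover have "continuous_map ?X (planar_configurations n) (\<lambda>z. snd (config_transport n (fst z) (snd z)))"
      unfolding continuous_map_planar_configurations
    proof (intro conjI ballI funcsetI)
      show "snd (config_transport n (fst z) (snd z)) \<in> topspace (planar_configurations n)" if "z \<in> topspace ?X" for z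
        using config_transport_snd(1)[OF n X_cases(2)[OF that]] .
      fix j assume j: "j \<in> {1..<n}"
      have Xx: "continuous_map ?X euclideanreal (\<lambda>z. snd z j k)" if "j < n" "k \<le> 2" for j k
        using continuous_map_compose[OF sndX continuous_map_config(2)[OF n that(2,1)]] by (simp add: o_def)
      have Xf: "continuous_map ?X euclideanreal (\<lambda>z. config_f (snd z) k)" if "k \<le> 2" for k
        using continuous_map_compose[OF sndX continuous_map_config(1)[OF n that]] by (simp add: o_def)
      have "continuous_map ?X euclidean (\<lambda>z. stereo_inv (frame_coords (config_f (snd z)) (snd z 0) (snd z j)))"
      proof (intro continuous_map_stereo_inv continuous_map_frame_coords Xf Xx)
        fix z assume "z \<in> topspace ?X"
        then show "frame_coords (config_f (snd z)) (snd z 0) (snd z j) 2 < 1"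
          using sphere_2_less_1 config_coords_neq_pole[OF n X_cases(2)] j by auto
      qed (use j n in auto)
      then show "continuous_map ?X euclidean (\<lambda>z. snd (config_transport n (fst z) (snd z)) j)"
        using j by (simp add: config_transport_def)
    qed
    ultimately have "continuous_map ?X ?E (\<lambda>z. (fst (config_transport n (fst z) (snd z)), snd (config_transport n (fst z) (snd z))))"
      by (rule continuous_map_pairedI)
    then show ?thesis by (simp add: case_prod_unfold)
  qed
  show "config_map n (config_transport n e x) = x"
    if "e \<in> topspace ?E" "x \<in> topspace ?G" "(config_map n e, x) \<in> close_configurations n" for e x
    using close[OF that] config_transport(2)[OF n that(2)] by blast
  have inj: "z = z'" if "q \<in> topspace (nsphere 3)" "z \<in> topspace (planar_configurations n)" "z' \<in> topspace (planar_configurations n)"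
    "config_map n (q, z) = config_map n (q, z')" for q z z'
  proof (rule extensionalityI[of _ "{1..<n}"])
    show "z \<in> extensional {1..<n}" "z' \<in> extensional {1..<n}"
      using that unfolding topspace_planar_configurations by blast+
    fix j assume j: "j \<in> {1..<n}"
    have "frame_apply (quat_f q) (quat_c q) (stereo (z j)) = frame_apply (quat_f q) (quat_c q) (stereo (z' j))"
      using fun_cong[OF that(4), of j] j by (simp add: config_map_def)
    then have "stereo (z j) = stereo (z' j)"
      using frame_apply_sphere(2)[OF orthonormal_quat[OF that(1)] stereo_in_sphere] by metis
    then show "z j = z' j" by (simp add: stereo_eq_iff)
  qed
  show "config_transport n e (config_map n e) = e" if e_in: "e \<in> topspace ?E" for e
  proof -
    obtain q z where e: "e = (q, z)" and q: "q \<in> topspace (nsphere 3)" and z: "z \<in> topspace (planar_configurations n)"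
      using e_in by (cases e) auto
    have nz: "inner_upto 3 q (fst e) \<noteq> 0" using sph[OF q] e by simp
    have M': "config_matrix (config_map n e) k l = q k * q l" if "k \<le> 3" "l \<le> 3" for k l
      unfolding e using config_matrix_map[OF n q z that] .
    have G: "config_map n e \<in> topspace ?G" unfolding e using config_map_in[OF n q z] .
    have 1: "fst (config_transport n e (config_map n e)) = q"
      using config_transport_fst[OF n q M' nz] sph[OF q] e by simp
    have "config_map n (q, snd (config_transport n e (config_map n e))) = config_map n (q, z)"
      using config_transport(2)[OF n G q M' nz] 1 e by (metis prod.collapse)
    then have "snd (config_transport n e (config_map n e)) = z"
      using inj[OF q config_transport_snd(1)[OF n G] z] by blast
    with 1 show ?thesis by (intro prod_eqI) (simp_all only: e fst_conv snd_conv)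
  qed
  show "Hausdorff_space ?E"
    by (simp add: Hausdorff_space_prod_topology Hausdorff_space_nsphere Hausdorff_space_planar_configurations)
  show "openin (prod_topology ?E ?E) {x \<in> topspace (prod_topology ?E ?E). inner_upto 3 (fst (fst x)) (fst (snd x)) \<in> {0<..}}"
  proof (rule openin_continuous_map_preimage[where Y=euclideanreal])
    have "continuous_map (prod_topology ?E ?E) (nsphere 3) (\<lambda>x. fst (fst x))"
      "continuous_map (prod_topology ?E ?E) (nsphere 3) (\<lambda>x. fst (snd x))"
      using continuous_map_compose[OF continuous_map_fst continuous_map_fst] continuous_map_compose[OF continuous_map_snd continuous_map_fst]
      by (simp_all add: o_def)
    then show "continuous_map (prod_topology ?E ?E) euclideanreal (\<lambda>x. inner_upto 3 (fst (fst x)) (fst (snd x)))"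
      unfolding continuous_map_nsphere by (intro continuous_map_inner_upto) auto
  qed simp
  show "(e, e) \<in> {x \<in> topspace (prod_topology ?E ?E). inner_upto 3 (fst (fst x)) (fst (snd x)) \<in> {0<..}}" if "e \<in> topspace ?E" for e
    using that sph by (cases e) auto
  fix e e' assume e: "e \<in> topspace ?E" "e' \<in> topspace ?E"
    and c: "(e, e') \<in> {x \<in> topspace (prod_topology ?E ?E). inner_upto 3 (fst (fst x)) (fst (snd x)) \<in> {0<..}}"
    and eq: "config_map n e = config_map n e'"
  obtain q z q' z' where ee: "e = (q, z)" "e' = (q', z')" by fastforce
  have q: "q \<in> topspace (nsphere 3)" "q' \<in> topspace (nsphere 3)"
    and z: "z \<in> topspace (planar_configurations n)" "z' \<in> topspace (planar_configurations n)"
    using e unfolding ee by auto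
  have qq: "q k * q l = q' k * q' l" if "k \<le> 3" "l \<le> 3" for k l
    using config_matrix_map[OF n q(1) z(1) that] config_matrix_map[OF n q(2) z(2) that] eq unfolding ee by simp
  have pos: "inner_upto 3 q q' > 0" using c unfolding ee by simp
  \<comment> \<open>Equal products mean that \<open>q\<close> and \<open>q'\<close> span the same
    line. Contracting with \<open>q\<close> gives the factor, whose square turns out to be
    1.\<close>
  have q_eq: "q k = q' k * inner_upto 3 q q'" if k: "k \<le> 3" for k
  proof -
    have "q k * inner_upto 3 q q = (\<Sum>l\<le>3. q k * q l * q l)" by (simp add: inner_upto_def sum_distrib_left mult.assoc)
    also have "\<dots> = (\<Sum>l\<le>3. q' k * q' l * q l)" using qq[OF k] by simp
    also have "\<dots> = q' k * inner_upto 3 q q'" by (simp add: inner_upto_def sum_distrib_left mult_ac)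
    finally show ?thesis using sph[OF q(1)] by simp
  qed
  let ?c = "inner_upto 3 q q'"
  have "?c * ?c = 1"
  proof -
    have "inner_upto 3 q q = (\<Sum>k\<le>3. q' k * ?c * (q' k * ?c))"
      unfolding inner_upto_def[of 3 q q] using q_eq by simp
    also have "\<dots> = inner_upto 3 q' q' * (?c * ?c)"
      by (simp add: inner_upto_def[of 3 q' q'] sum_distrib_left sum_distrib_right mult_ac)
    finally show ?thesis using sph[OF q(1)] sph[OF q(2)] by simp
  qed
  then have "?c = 1 \<or> ?c = - 1" by (simp add: square_eq_1_iff)
  then have c1: "?c = 1" using pos by auto
  have "q = q'"
  proof
    fix k show "q k = q' k"
    proof (cases "k \<le> 3")
      case True then show ?thesis using q_eq c1 by simp
    next
      case False then show ?thesis using q by (simp add: topspace_nsphere)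
    qed
  qed
  moreover from this have "z = z'" using inj[OF q(1) z] eq unfolding ee by simp
  ultimately show "e = e'" unfolding ee by simp
qed

section \<open>Products, base points and assembly of the isomorphisms\<close>

text \<open>The second components of two spheroids are homotopic through the constant map, so a
  homotopy of first components can always be completed to one of pairs.\<close>

lemma homotopy_group_prod_aspherical:
  assumes i: "i > 0" and x0: "x0 \<in> topspace X" and y0: "y0 \<in> topspace Y"
    and asph: "\<And>g. g \<in> spheroids i Y y0 \<Longrightarrow> homotopic_spheroids i Y y0 g (\<lambda>_. y0)"
  shows "homotopy_group i (prod_topology X Y) (x0, y0) \<cong> homotopy_group i X x0"
proof (rule homotopy_group_isoI[OF i continuous_map_fst])
  show "fst (x0, y0) = x0" by simp
  fix g assume g: "g \<in> spheroids i X x0"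
  have "(\<lambda>t. (g t, y0)) \<in> spheroids i (prod_topology X Y) (x0, y0)"
    using g y0 by (auto simp: spheroids_def intro!: continuous_map_pairedI)
  moreover have "homotopic_spheroids i X x0 (fst \<circ> (\<lambda>t. (g t, y0))) g"
    using g by (simp add: o_def homotopic_spheroids_refl)
  ultimately show "\<exists>f\<in>spheroids i (prod_topology X Y) (x0, y0). homotopic_spheroids i X x0 (fst \<circ> f) g" by blast
next
  fix f g assume fg: "f \<in> spheroids i (prod_topology X Y) (x0, y0)" "g \<in> spheroids i (prod_topology X Y) (x0, y0)"
    and h: "homotopic_spheroids i X x0 (fst \<circ> f) (fst \<circ> g)"
  have "snd \<circ> f \<in> spheroids i Y y0" "snd \<circ> g \<in> spheroids i Y y0"
    using spheroids_compose[OF fg(1) continuous_map_snd] spheroids_compose[OF fg(2) continuous_map_snd] by simp_all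
  then have 2: "homotopic_spheroids i Y y0 (snd \<circ> f) (snd \<circ> g)"
    using homotopic_spheroids_trans[OF asph iffD1[OF homotopic_spheroids_sym asph]] by blast
  obtain H where H: "continuous_map (prod_topology unit_interval (cube i)) X H"
    "\<And>t. t \<in> topspace (cube i) \<Longrightarrow> H (0, t) = (fst \<circ> f) t" "\<And>t. t \<in> topspace (cube i) \<Longrightarrow> H (1, t) = (fst \<circ> g) t"
    "\<And>s t. s \<in> {0..1} \<Longrightarrow> t \<in> cube_boundary i \<Longrightarrow> H (s, t) = x0"
    using h by (elim homotopic_spheroidsE) blast
  obtain K where K: "continuous_map (prod_topology unit_interval (cube i)) Y K"
    "\<And>t. t \<in> topspace (cube i) \<Longrightarrow> K (0, t) = (snd \<circ> f) t" "\<And>t. t \<in> topspace (cube i) \<Longrightarrow> K (1, t) = (snd \<circ> g) t"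
    "\<And>s t. s \<in> {0..1} \<Longrightarrow> t \<in> cube_boundary i \<Longrightarrow> K (s, t) = y0"
    using 2 by (elim homotopic_spheroidsE) blast
  show "homotopic_spheroids i (prod_topology X Y) (x0, y0) f g"
    unfolding homotopic_spheroids
    using H K by (intro exI[of _ "\<lambda>z. (H z, K z)"]) (auto intro!: continuous_map_pairedI)
qed

lemma homotopy_group_homeomorphism:
  assumes i: "i > 0" and q: "continuous_map X Y q" and r: "continuous_map Y X r"
    and rq: "\<And>x. x \<in> topspace X \<Longrightarrow> r (q x) = x" and qr: "\<And>y. y \<in> topspace Y \<Longrightarrow> q (r y) = y" and x0: "x0 \<in> topspace X"
  shows "homotopy_group i X x0 \<cong> homotopy_group i Y (q x0)"
proof (rule homotopy_group_isoI[OF i q refl])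
  have in_top: "f t \<in> topspace Z" if "f \<in> spheroids i Z z0" "t \<in> topspace (cube i)" for f t z0 and Z :: "'c topology"
    using that continuous_map_image_subset_topspace unfolding spheroids_def by blast
  fix g assume g: "g \<in> spheroids i Y (q x0)"
  have "r \<circ> g \<in> spheroids i X x0" using spheroids_compose[OF g r] rq[OF x0] by simp
  moreover have "homotopic_spheroids i Y (q x0) g (q \<circ> (r \<circ> g))"
    using g by (rule homotopic_spheroids_equal) (use qr in_top[OF g] in auto)
  then have "homotopic_spheroids i Y (q x0) (q \<circ> (r \<circ> g)) g" by (subst homotopic_spheroids_sym)
  ultimately show "\<exists>f\<in>spheroids i X x0. homotopic_spheroids i Y (q x0) (q \<circ> f) g" by blast
next
  have in_top: "f t \<in> topspace X" if "f \<in> spheroids i X x0" "t \<in> topspace (cube i)" for f t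
    using that continuous_map_image_subset_topspace unfolding spheroids_def by blast
  fix f g assume f: "f \<in> spheroids i X x0" and g: "g \<in> spheroids i X x0"
    and h: "homotopic_spheroids i Y (q x0) (q \<circ> f) (q \<circ> g)"
  have 1: "homotopic_spheroids i X x0 f (r \<circ> (q \<circ> f))"
    using f by (rule homotopic_spheroids_equal) (use rq in_top[OF f] in auto)
  have 2: "homotopic_spheroids i X x0 g (r \<circ> (q \<circ> g))"
    using g by (rule homotopic_spheroids_equal) (use rq in_top[OF g] in auto)
  have 3: "homotopic_spheroids i X x0 (r \<circ> (q \<circ> f)) (r \<circ> (q \<circ> g))"
    using homotopic_spheroids_compose[OF h r] rq[OF x0] by simp
  from homotopic_spheroids_trans[OF 1 homotopic_spheroids_trans[OF 3 iffD1[OF homotopic_spheroids_sym 2]]]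
  show "homotopic_spheroids i X x0 f g" .
qed

text \<open>The reflection in the hyperplane orthogonal to \<open>s - x\<close>.\<close>

definition swap_reflection :: "nat \<Rightarrow> (nat \<Rightarrow> real) \<Rightarrow> (nat \<Rightarrow> real) \<Rightarrow> (nat \<Rightarrow> real) \<Rightarrow> nat \<Rightarrow> real" where
  "swap_reflection m s x y = (\<lambda>k. y k - (inner_upto m y s - inner_upto m y x) / (1 - inner_upto m s x) * (s k - x k))"

lemma inner_upto_diff_scale:
  "inner_upto m (\<lambda>k. y k - c * (s k - x k)) z = inner_upto m y z - c * (inner_upto m s z - inner_upto m x z)"
  by (simp add: inner_upto_def sum_subtractf sum_distrib_left sum.distrib algebra_simps)

lemma inner_upto_commute: "inner_upto m x y = inner_upto m y x"
  by (simp add: inner_upto_def mult.commute)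

lemma nsphere_inner_eq_1:
  assumes "s \<in> topspace (nsphere m)" "x \<in> topspace (nsphere m)" "inner_upto m s x = 1"
  shows "s = x"
proof
  fix k
  have "(\<Sum>k\<le>m. (s k - x k)\<^sup>2) = inner_upto m s s - 2 * inner_upto m s x + inner_upto m x x"
    by (simp add: inner_upto_def power2_eq_square sum_distrib_left sum_subtractf sum.distrib algebra_simps)
  also have "\<dots> = 0" using assms by (simp add: topspace_nsphere)
  finally have "\<forall>k\<in>{..m}. (s k - x k)\<^sup>2 = 0" by (subst (asm) sum_nonneg_eq_0_iff) auto
  then show "s k = x k" using assms(1,2) by (cases "k \<le> m") (auto simp: topspace_nsphere)
qed

text \<open>A reflection is a homeomorphism of the sphere that takes \<open>s\<close> to
  \<open>x\<close>, so base points are compared without transport along a path.\<close>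

lemma homotopy_group_nsphere_basepoint:
  assumes i: "i > 0" and s: "s \<in> topspace (nsphere m)" and x: "x \<in> topspace (nsphere m)"
  shows "homotopy_group i (nsphere m) s \<cong> homotopy_group i (nsphere m) x"
proof (cases "s = x")
  case True
  then show ?thesis by (simp add: iso_refl)
next
  case False
  let ?q = "swap_reflection m s x" and ?d = "inner_upto m s x"
  have ss: "inner_upto m s s = 1" and xx: "inner_upto m x x = 1" and xs: "inner_upto m x s = ?d"
    using s x inner_upto_commute by (auto simp: topspace_nsphere)
  have d: "1 - ?d \<noteq> 0" using nsphere_inner_eq_1[OF s x] False by auto
  \<comment> \<open>For \<open>v = s - x\<close> one has
    \<open>v \<bullet> v = 2 * (1 - ?d)\<close>, so \<open>c y\<close> is the usual coefficient
    \<open>2 * (y \<bullet> v) / (v \<bullet> v)\<close> of a reflection.\<close>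
  define c where "c y = (inner_upto m y s - inner_upto m y x) / (1 - ?d)" for y
  have q_def: "?q y = (\<lambda>k. y k - c y * (s k - x k))" for y by (simp add: swap_reflection_def c_def)
  have cd: "c y * (1 - ?d) = inner_upto m y s - inner_upto m y x" for y using d by (simp add: c_def)
  have qs: "inner_upto m (?q y) s = inner_upto m y s - c y * (1 - ?d)" for y
    unfolding q_def inner_upto_diff_scale by (simp add: ss xs)
  have qx: "inner_upto m (?q y) x = inner_upto m y x + c y * (1 - ?d)" for y
    unfolding q_def inner_upto_diff_scale by (simp add: xx algebra_simps)
  have cq: "c (?q y) = - c y" for y
  proof -
    have "inner_upto m (?q y) s - inner_upto m (?q y) x = - (inner_upto m y s - inner_upto m y x)"
      unfolding qs qx cd by simp
    then show ?thesis by (simp add: c_def[of "?q y"] c_def[of y] minus_divide_left)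
  qed
  have qq: "?q (?q y) = y" for y
    unfolding q_def[of "?q y"] cq by (simp add: q_def)
  have norm: "inner_upto m (?q y) (?q y) = inner_upto m y y" for y
  proof -
    have "inner_upto m (?q y) (?q y) = inner_upto m y (?q y) - c y * (inner_upto m s (?q y) - inner_upto m x (?q y))"
      by (subst (1) q_def) (rule inner_upto_diff_scale)
    also have "inner_upto m y (?q y) = inner_upto m y y - c y * (inner_upto m y s - inner_upto m y x)"
      using inner_upto_diff_scale[of m y "c y" s x y] by (simp add: q_def inner_upto_commute)
    also have "inner_upto m s (?q y) - inner_upto m x (?q y) = - (inner_upto m y s - inner_upto m y x)"
      using qs[of y] qx[of y] cd[of y] by (simp add: inner_upto_commute)
    finally show ?thesis by (simp add: algebra_simps)
  qed
  have cont: "continuous_map (nsphere m) (nsphere m) ?q"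
    unfolding continuous_map_nsphere
  proof (intro conjI allI impI funcsetI)
    show "?q y \<in> topspace (nsphere m)" if "y \<in> topspace (nsphere m)" for y
      using that norm[of y] s x by (simp add: topspace_nsphere) (simp add: q_def)
    show "continuous_map (nsphere m) euclideanreal (\<lambda>y. ?q y k)" for k
      unfolding swap_reflection_def using d
      by (intro continuous_map_diff continuous_map_real_mult continuous_map_real_divide continuous_map_inner_upto
          continuous_map_nsphere_projection) auto
  qed
  have "c s = 1" unfolding c_def using d ss by simp
  then have "?q s = x" by (simp add: q_def)
  then show ?thesis
    using homotopy_group_homeomorphism[OF i cont cont qq qq s] by simp
qed

lemma homotopy_group_configuration_space_lift:
  assumes "i \<ge> 2" "x \<in> topspace (spherical_configurations m n)"
  shows "homotopy_group i (configuration_space n (real_projective_space m)) (lines_of n x) \<cong> homotopy_group i (spherical_configurations m n) x"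
  using assms(1) by (intro homotopy_group_iso_sym[OF _ line_covering.homotopy_group_iso[OF assms]]) simp

lemma homotopy_group_spherical_configurations_1:
  assumes i: "i > 0" and x: "x \<in> topspace (spherical_configurations m 1)"
  shows "homotopy_group i (spherical_configurations m 1) x \<cong> homotopy_group i (nsphere m) (x 0)"
proof (rule homotopy_group_homeomorphism[OF i, where r="\<lambda>y. \<lambda>j\<in>{..<1}. y"])
  show "continuous_map (spherical_configurations m 1) (nsphere m) (\<lambda>x. x 0)"
    unfolding spherical_configurations_def by (intro continuous_map_from_subtopology continuous_map_product_projection) simp
  show "continuous_map (nsphere m) (spherical_configurations m 1) (\<lambda>y. \<lambda>j\<in>{..<1}. y)"
    unfolding continuous_map_spherical_configurations
    by (auto simp: topspace_spherical_configurations continuous_map_nsphere_projection)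
  show "(\<lambda>j\<in>{..<1}. z 0) = z" if "z \<in> topspace (spherical_configurations m 1)" for z
    using that by (auto simp: topspace_spherical_configurations extensional_def fun_eq_iff)
qed (use x in auto)

lemma homotopy_group_spherical_configurations:
  assumes i: "i \<ge> 2" and n: "n \<ge> 2" and x: "x \<in> topspace (spherical_configurations 2 n)"
  obtains q where "q \<in> topspace (nsphere 3)"
    "homotopy_group i (spherical_configurations 2 n) x \<cong> homotopy_group i (nsphere 3) q"
proof -
  obtain r where r: "r \<in> topspace (nsphere 3)" "\<And>k l. k \<le> 3 \<Longrightarrow> l \<le> 3 \<Longrightarrow> config_matrix x k l = r k * r l"
    using config_quat[OF n x] by blast
  \<comment> \<open>Transport reads only the quaternion of its first argument, so the zero function
    is a dummy. Started at \<open>r\<close> it returns \<open>r\<close> and the planar part of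
    \<open>x\<close>, which gives a point over \<open>x\<close>.\<close>
  define z where "z = snd (config_transport n (r, \<lambda>_. 0) x)"
  have rr: "inner_upto 3 r (fst (r, \<lambda>_::nat. 0 :: complex)) = 1" using r(1) by (simp add: topspace_nsphere)
  have z: "z \<in> topspace (planar_configurations n)" unfolding z_def using config_transport_snd(1)[OF n x] .
  have "config_transport n (r, \<lambda>_. 0) x = (r, z)"
    using config_transport_fst[OF n r, of "(r, \<lambda>_. 0)"] rr by (simp add: z_def prod_eq_iff)
  then have rz: "config_map n (r, z) = x"
    using config_transport(2)[OF n x r, of "(r, \<lambda>_. 0)"] rr by simp
  interpret covering_transport "prod_topology (nsphere 3) (planar_configurations n)" "spherical_configurations 2 n"
    "config_map n" "close_configurations n" "config_transport n"
    "{x \<in> topspace (prod_topology (prod_topology (nsphere 3) (planar_configurations n)) (prod_topology (nsphere 3) (planar_configurations n))).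
       inner_upto 3 (fst (fst x)) (fst (snd x)) \<in> {0<..}}"
    by (rule config_covering[OF n])
  have i0: "i > 0" using i by simp
  have "homotopy_group i (prod_topology (nsphere 3) (planar_configurations n)) (r, z) \<cong> homotopy_group i (spherical_configurations 2 n) x"
    using homotopy_group_iso[OF i, of "(r, z)"] r(1) z rz by simp
  then have "homotopy_group i (spherical_configurations 2 n) x \<cong> homotopy_group i (prod_topology (nsphere 3) (planar_configurations n)) (r, z)"
    by (rule homotopy_group_iso_sym[OF i0])
  moreover have "homotopy_group i (prod_topology (nsphere 3) (planar_configurations n)) (r, z) \<cong> homotopy_group i (nsphere 3) r"
    by (rule homotopy_group_prod_aspherical[OF i0 r(1) z planar_configurations_aspherical[OF i n]])
  ultimately show thesis using that r(1) iso_trans by blast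
qed

theorem proposition1:
  fixes n i :: nat
  assumes "n \<ge> 1" and "i \<ge> 2"
  shows "(n = 1 \<longrightarrow>
            (\<forall>p \<in> topspace (configuration_space n (real_projective_space 2)).
             \<forall>s \<in> topspace (nsphere 2).
               homotopy_group i (configuration_space n (real_projective_space 2)) p
                 \<cong> homotopy_group i (nsphere 2) s)) \<and>
         (n \<ge> 2 \<longrightarrow>
            (\<forall>p \<in> topspace (configuration_space n (real_projective_space 2)).
             \<forall>s \<in> topspace (nsphere 3).
               homotopy_group i (configuration_space n (real_projective_space 2)) p
                 \<cong> homotopy_group i (nsphere 3) s))"
proof (intro conjI impI ballI)
  fix p s assume n: "n = 1" and p: "p \<in> topspace (configuration_space n (real_projective_space 2))"
    and s: "s \<in> topspace (nsphere 2)"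
  have i: "i > 0" using assms(2) by simp
  obtain x where x: "x \<in> topspace (spherical_configurations 2 n)" "p = lines_of n x"
    using configuration_space_lift[OF p] by blast
  have x0: "x 0 \<in> topspace (nsphere 2)" using x(1) n by (simp add: topspace_spherical_configurations)
  note homotopy_group_configuration_space_lift[OF assms(2) x(1)]
  also note homotopy_group_spherical_configurations_1[OF i x(1)[unfolded n], folded n]
  also note homotopy_group_nsphere_basepoint[OF i x0 s]
  finally show "homotopy_group i (configuration_space n (real_projective_space 2)) p \<cong> homotopy_group i (nsphere 2) s"
    unfolding x(2) .
next
  fix p s assume n: "n \<ge> 2" and p: "p \<in> topspace (configuration_space n (real_projective_space 2))"
    and s: "s \<in> topspace (nsphere 3)"
  have i: "i > 0" using assms(2) by simp
  obtain x where x: "x \<in> topspace (spherical_configurations 2 n)" "p = lines_of n x"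
    using configuration_space_lift[OF p] by blast
  obtain q where q: "q \<in> topspace (nsphere 3)"
    "homotopy_group i (spherical_configurations 2 n) x \<cong> homotopy_group i (nsphere 3) q"
    using homotopy_group_spherical_configurations[OF assms(2) n x(1)] by blast
  note homotopy_group_configuration_space_lift[OF assms(2) x(1)]
  also note q(2)
  also note homotopy_group_nsphere_basepoint[OF i q(1) s]
  finally show "homotopy_group i (configuration_space n (real_projective_space 2)) p \<cong> homotopy_group i (nsphere 3) s"
    unfolding x(2) .
qed

end
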